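(* Let $K(u,v)\neq0$ and $\varkappa(u,v)\neq0$ be two smooth functions, defined in a domain $\mathcal{D}\subset\mathbb{R}^2$, such that $K^2-\varkappa^2>0$, and satisfying the equations $$\sqrt[4]{K^2-\varkappa^2}\;\Delta^h\ln(K^2-\varkappa^2)=8K,$$ $$\sqrt[4]{K^2-\varkappa^2}\;\Delta^h\ln\frac{K+\varepsilon\,\varkappa}{K-\varepsilon\,\varkappa}=4\varepsilon\,\varkappa,$$ where $\varepsilon=\pm1$ and $\Delta^h=\frac{\partial^2}{\partial u^2}-\frac{\partial^2}{\partial v^2}$. Then there exists a unique (up to a rigid motion in $\mathbb{E}^4_2$) minimal Lorentz surface of general type such that $K(u,v)$ and $\varkappa(u,v)$ are its Gauss curvature and its normal curvature, respectively; $\varepsilon=1$ (resp. $\varepsilon=-1$) in the case the geometric normal vector field $n_1$ is spacelike (resp. timelike). Furthermore, $(u,v)$ are the canonical parameters of the surface.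
   Context: $\mathbb{E}^4_2$ is $\mathbb{R}^4$ with the flat metric $g_0=dx_1^2+dx_2^2-dx_3^2-dx_4^2$, with inner product $\langle\cdot,\cdot\rangle$. A vector $w$ is spacelike if $\langle w,w\rangle>0$ or $w=0$, timelike if $\langle w,w\rangle<0$, lightlike if $\langle w,w\rangle=0$ and $w\ne0$. A surface $M^2_1$ in $\mathbb{E}^4_2$ is Lorentz if the induced metric has signature $(1,1)$ (the normal planes then also have signature $(1,1)$). Let $\sigma$ be the second fundamental form; $M^2_1$ is minimal if its mean curvature vector $H=\frac12\operatorname{tr}\sigma$ vanishes identically; for a tangent frame with $\langle x,x\rangle=1$, $\langle x,y\rangle=0$, $\langle y,y\rangle=-1$ this means $\sigma(x,x)=\sigma(y,y)$. The first normal space at $p$ is $\operatorname{span}\{\sigma(X,Y):X,Y\in T_pM^2_1\}$. The Gauss curvature is $$K=\frac{\langle\sigma(x,x),\sigma(y,y)\rangle-\langle\sigma(x,y),\sigma(x,y)\rangle}{\langle x,x\rangle\langle y,y\rangle-\langle x,y\rangle^2},$$ and the normal curvature is $$\varkappa=\frac{\langle R^\perp(x,y)n_1,n_2\rangle}{\langle x,x\rangle\langle y,y\rangle-\langle x,y\rangle^2},$$ where $R^\perp(x,y)n_1=D_xD_yn_1-D_yD_xn_1-D_{[x,y]}n_1$, $D$ is the normal connection and $\{n_1,n_2\}$ is an orthonormal normal frame (changing this frame changes $\varkappa$ at most by sign; when a geometric frame field, defined below, is available, $\varkappa$ is computed with it). A minimal Lorentz surface is of general type if its first normal space is two-dimensional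 at each point and $K^2-\varkappa^2>0$ on a dense open subset. A geometric frame field of a minimal Lorentz surface of general type is an orthonormal frame field $\{x,y,n_1,n_2\}$, with $x,y$ tangent and $n_1,n_2$ normal, $\langle x,x\rangle=1$, $\langle y,y\rangle=-1$, $\langle n_1,n_1\rangle=\varepsilon$, $\langle n_2,n_2\rangle=-\varepsilon$ ($\varepsilon=\pm1$), such that $$\sigma(x,x)=\sigma(y,y)=\nu\,n_1,\qquad \sigma(x,y)=\mu\,n_2$$ with functions $\mu,\nu$, $\mu\nu\neq0$; $n_1$ is called the geometric normal vector field. Parameters $(u,v)$ of the surface $z=z(u,v)$ are canonical if $z_u=\sqrt{E}\,x$, $z_v=\sqrt{-G}\,y$ for the geometric frame field, where $$E=\langle z_u,z_u\rangle=\frac{1}{\sqrt{|\mu^2-\nu^2|}},\quad F=\langle z_u,z_v\rangle=0,\quad G=\langle z_v,z_v\rangle=-\frac{1}{\sqrt{|\mu^2-\nu^2|}}.$$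
   Formalization: The sign ε is taken as −sgn K (the equations allow either sign); uniqueness holds, in canonical parameters, once the sign of μ²−ν² is fixed, each sign giving one surface; existence is claimed on simply connected subdomains of D, since monodromy can obstruct a global surface. *)

theory Defs
  imports "HOL-Analysis.Analysis"
begin

section \<open>Calculus on planar domains\<close>

definition planar_domain :: "(real \<times> real) set \<Rightarrow> bool" where
  "planar_domain D \<longleftrightarrow> open D \<and> connected D \<and> D \<noteq> {}"

definition partial_u :: "(real \<times> real \<Rightarrow> 'a::real_normed_vector) \<Rightarrow> real \<times> real \<Rightarrow> 'a" where
  "partial_u f p = vector_derivative (\<lambda>s. f (s, snd p)) (at (fst p))"

definition partial_v :: "(real \<times> real \<Rightarrow> 'a::real_normed_vector) \<Rightarrow> real \<times> real \<Rightarrow> 'a" where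
  "partial_v f p = vector_derivative (\<lambda>t. f (fst p, t)) (at (snd p))"

fun C_k_on :: "nat \<Rightarrow> (real \<times> real) set \<Rightarrow> (real \<times> real \<Rightarrow> 'a::real_normed_vector) \<Rightarrow> bool" where
  "C_k_on 0 D f \<longleftrightarrow> continuous_on D f"
| "C_k_on (Suc k) D f \<longleftrightarrow>
     f differentiable_on D \<and> C_k_on k D (partial_u f) \<and> C_k_on k D (partial_v f)"

text \<open>Only used for open sets, where it is the usual notion of a \<open>C\<close>-infinity function.\<close>

definition smooth_on :: "(real \<times> real) set \<Rightarrow> (real \<times> real \<Rightarrow> 'a::real_normed_vector) \<Rightarrow> bool" where
  "smooth_on D f \<longleftrightarrow> (\<forall>k. C_k_on k D f)"

definition hyp_laplacian :: "(real \<times> real \<Rightarrow> real) \<Rightarrow> real \<times> real \<Rightarrow> real" where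
  "hyp_laplacian f p = partial_u (partial_u f) p - partial_v (partial_v f) p"

section \<open>The pseudo-Euclidean space with neutral metric\<close>

definition ip :: "real^4 \<Rightarrow> real^4 \<Rightarrow> real" where
  "ip a b = a$1 * b$1 + a$2 * b$2 - a$3 * b$3 - a$4 * b$4"

text \<open>Rigid motions are all affine isometries; orientation need not be preserved.\<close>

definition rigid_motion :: "(real^4 \<Rightarrow> real^4) \<Rightarrow> bool" where
  "rigid_motion f \<longleftrightarrow>
     (\<exists>A b. linear A \<and> (\<forall>v w. ip (A v) (A w) = ip v w) \<and> f = (\<lambda>v. A v + b))"

section \<open>Parametrized Lorentz surfaces\<close>

text \<open>A surface is given by a parametrization \<open>z\<close>. Vectors tangent or normal to the surface
  at the parameter value \<open>p\<close> are elements of \<^typ>\<open>real^4\<close>, and vector fields along the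
  surface are functions from the parameter plane to \<^typ>\<open>real^4\<close>.\<close>

definition tangent_space :: "(real \<times> real \<Rightarrow> real^4) \<Rightarrow> real \<times> real \<Rightarrow> (real^4) set" where
  "tangent_space z p = span {partial_u z p, partial_v z p}"

definition normal_space :: "(real \<times> real \<Rightarrow> real^4) \<Rightarrow> real \<times> real \<Rightarrow> (real^4) set" where
  "normal_space z p = {n. \<forall>t\<in>tangent_space z p. ip n t = 0}"

text \<open>The signature condition forces the tangent space to be two-dimensional, so \<open>z\<close> is an
  immersion.\<close>

definition lorentz_surface :: "(real \<times> real) set \<Rightarrow> (real \<times> real \<Rightarrow> real^4) \<Rightarrow> bool" where
  "lorentz_surface D z \<longleftrightarrow> smooth_on D z \<and>
     (\<forall>p\<in>D. \<exists>x y. tangent_space z p = span {x, y} \<and>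
        ip x x = 1 \<and> ip x y = 0 \<and> ip y y = - 1)"

text \<open>The normal part with respect to the splitting into tangent and normal space, which is
  direct for Lorentz surfaces.\<close>

definition normal_part :: "(real \<times> real \<Rightarrow> real^4) \<Rightarrow> real \<times> real \<Rightarrow> real^4 \<Rightarrow> real^4" where
  "normal_part z p w = (THE n. n \<in> normal_space z p \<and> w - n \<in> tangent_space z p)"

definition tangent_coords :: "(real \<times> real \<Rightarrow> real^4) \<Rightarrow> real \<times> real \<Rightarrow> real^4 \<Rightarrow> real \<times> real" where
  "tangent_coords z p X =
     (THE c. X = fst c *\<^sub>R partial_u z p + snd c *\<^sub>R partial_v z p)"

definition coeff_E :: "(real \<times> real \<Rightarrow> real^4) \<Rightarrow> real \<times> real \<Rightarrow> real" where
  "coeff_E z p = ip (partial_u z p) (partial_u z p)"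

definition coeff_F :: "(real \<times> real \<Rightarrow> real^4) \<Rightarrow> real \<times> real \<Rightarrow> real" where
  "coeff_F z p = ip (partial_u z p) (partial_v z p)"

definition coeff_G :: "(real \<times> real \<Rightarrow> real^4) \<Rightarrow> real \<times> real \<Rightarrow> real" where
  "coeff_G z p = ip (partial_v z p) (partial_v z p)"

definition second_fund_form ::
    "(real \<times> real \<Rightarrow> real^4) \<Rightarrow> real \<times> real \<Rightarrow> real^4 \<Rightarrow> real^4 \<Rightarrow> real^4" where
  "second_fund_form z p X Y =
     (let (a, b) = tangent_coords z p X; (c, d) = tangent_coords z p Y in
      normal_part z p
        ((a * c) *\<^sub>R partial_u (partial_u z) p
         + (a * d + b * c) *\<^sub>R partial_u (partial_v z) p
         + (b * d) *\<^sub>R partial_v (partial_v z) p))"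

definition first_normal_space :: "(real \<times> real \<Rightarrow> real^4) \<Rightarrow> real \<times> real \<Rightarrow> (real^4) set" where
  "first_normal_space z p =
     span {second_fund_form z p X Y | X Y. X \<in> tangent_space z p \<and> Y \<in> tangent_space z p}"

text \<open>Half the trace of the second fundamental form with respect to the induced metric,
  written in the basis of coordinate vectors.\<close>

definition mean_curvature_vector :: "(real \<times> real \<Rightarrow> real^4) \<Rightarrow> real \<times> real \<Rightarrow> real^4" where
  "mean_curvature_vector z p =
     (let zu = partial_u z p; zv = partial_v z p;
          E = coeff_E z p; F = coeff_F z p; G = coeff_G z p in
      (1 / (2 * (E * G - F\<^sup>2))) *\<^sub>R
        (G *\<^sub>R second_fund_form z p zu zu - (2 * F) *\<^sub>R second_fund_form z p zu zv
         + E *\<^sub>R second_fund_form z p zv zv))"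

definition minimal_surface :: "(real \<times> real) set \<Rightarrow> (real \<times> real \<Rightarrow> real^4) \<Rightarrow> bool" where
  "minimal_surface D z \<longleftrightarrow> (\<forall>p\<in>D. mean_curvature_vector z p = 0)"

section \<open>Curvatures\<close>

text \<open>The derivative, in the flat ambient space, of a field \<open>f\<close> in the direction of the
  tangent field \<open>X\<close>.\<close>

definition deriv_along ::
    "(real \<times> real \<Rightarrow> real^4) \<Rightarrow> (real \<times> real \<Rightarrow> real^4) \<Rightarrow> (real \<times> real \<Rightarrow> real^4) \<Rightarrow> real \<times> real \<Rightarrow> real^4" where
  "deriv_along z X f p =
     (let (a, b) = tangent_coords z p (X p) in a *\<^sub>R partial_u f p + b *\<^sub>R partial_v f p)"

definition tangent_bracket ::
    "(real \<times> real \<Rightarrow> real^4) \<Rightarrow> (real \<times> real \<Rightarrow> real^4) \<Rightarrow> (real \<times> real \<Rightarrow> real^4) \<Rightarrow> real \<times> real \<Rightarrow> real^4" where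
  "tangent_bracket z X Y p = deriv_along z X Y p - deriv_along z Y X p"

definition normal_connection ::
    "(real \<times> real \<Rightarrow> real^4) \<Rightarrow> (real \<times> real \<Rightarrow> real^4) \<Rightarrow> (real \<times> real \<Rightarrow> real^4) \<Rightarrow> real \<times> real \<Rightarrow> real^4" where
  "normal_connection z X n p = normal_part z p (deriv_along z X n p)"

definition normal_curvature_tensor ::
    "(real \<times> real \<Rightarrow> real^4) \<Rightarrow> (real \<times> real \<Rightarrow> real^4) \<Rightarrow> (real \<times> real \<Rightarrow> real^4) \<Rightarrow>
     (real \<times> real \<Rightarrow> real^4) \<Rightarrow> real \<times> real \<Rightarrow> real^4" where
  "normal_curvature_tensor z X Y n p =
     normal_connection z X (normal_connection z Y n) p
     - normal_connection z Y (normal_connection z X n) p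
     - normal_connection z (tangent_bracket z X Y) n p"

definition gauss_curvature ::
    "(real \<times> real \<Rightarrow> real^4) \<Rightarrow> (real \<times> real \<Rightarrow> real^4) \<Rightarrow> (real \<times> real \<Rightarrow> real^4) \<Rightarrow> real \<times> real \<Rightarrow> real" where
  "gauss_curvature z x y p =
     (ip (second_fund_form z p (x p) (x p)) (second_fund_form z p (y p) (y p))
      - ip (second_fund_form z p (x p) (y p)) (second_fund_form z p (x p) (y p)))
     / (ip (x p) (x p) * ip (y p) (y p) - (ip (x p) (y p))\<^sup>2)"

definition normal_curvature ::
    "(real \<times> real \<Rightarrow> real^4) \<Rightarrow> (real \<times> real \<Rightarrow> real^4) \<Rightarrow> (real \<times> real \<Rightarrow> real^4) \<Rightarrow>
     (real \<times> real \<Rightarrow> real^4) \<Rightarrow> (real \<times> real \<Rightarrow> real^4) \<Rightarrow> real \<times> real \<Rightarrow> real" where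
  "normal_curvature z x y n\<^sub>1 n\<^sub>2 p =
     ip (normal_curvature_tensor z x y n\<^sub>1 p) (n\<^sub>2 p)
     / (ip (x p) (x p) * ip (y p) (y p) - (ip (x p) (y p))\<^sup>2)"

section \<open>Frames, surfaces of general type and canonical parameters\<close>

definition orthonormal_frame_field ::
    "(real \<times> real) set \<Rightarrow> (real \<times> real \<Rightarrow> real^4) \<Rightarrow> real \<Rightarrow>
     (real \<times> real \<Rightarrow> real^4) \<Rightarrow> (real \<times> real \<Rightarrow> real^4) \<Rightarrow>
     (real \<times> real \<Rightarrow> real^4) \<Rightarrow> (real \<times> real \<Rightarrow> real^4) \<Rightarrow> bool" where
  "orthonormal_frame_field W z \<epsilon> x y n\<^sub>1 n\<^sub>2 \<longleftrightarrow>
     \<epsilon> \<in> {1, - 1} \<and>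
     smooth_on W x \<and> smooth_on W y \<and> smooth_on W n\<^sub>1 \<and> smooth_on W n\<^sub>2 \<and>
     (\<forall>p\<in>W. x p \<in> tangent_space z p \<and> y p \<in> tangent_space z p \<and>
        n\<^sub>1 p \<in> normal_space z p \<and> n\<^sub>2 p \<in> normal_space z p \<and>
        ip (x p) (x p) = 1 \<and> ip (y p) (y p) = - 1 \<and> ip (x p) (y p) = 0 \<and>
        ip (n\<^sub>1 p) (n\<^sub>1 p) = \<epsilon> \<and> ip (n\<^sub>2 p) (n\<^sub>2 p) = - \<epsilon> \<and> ip (n\<^sub>1 p) (n\<^sub>2 p) = 0)"

text \<open>Here no geometric frame is available yet, so the normal curvature is computed with a local
  orthonormal frame field; its square does not depend on the choice.\<close>

definition minimal_lorentz_general_type ::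
    "(real \<times> real) set \<Rightarrow> (real \<times> real \<Rightarrow> real^4) \<Rightarrow> bool" where
  "minimal_lorentz_general_type D z \<longleftrightarrow>
     lorentz_surface D z \<and> minimal_surface D z \<and>
     (\<forall>p\<in>D. dim (first_normal_space z p) = 2) \<and>
     (\<exists>U. open U \<and> U \<subseteq> D \<and> D \<subseteq> closure U \<and>
        (\<forall>p\<in>U. \<exists>W \<epsilon> x y n\<^sub>1 n\<^sub>2. open W \<and> p \<in> W \<and> W \<subseteq> D \<and>
           orthonormal_frame_field W z \<epsilon> x y n\<^sub>1 n\<^sub>2 \<and>
           (gauss_curvature z x y p)\<^sup>2 - (normal_curvature z x y n\<^sub>1 n\<^sub>2 p)\<^sup>2 > 0))"

definition geometric_frame_field ::
    "(real \<times> real) set \<Rightarrow> (real \<times> real \<Rightarrow> real^4) \<Rightarrow> real \<Rightarrow>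
     (real \<times> real \<Rightarrow> real^4) \<Rightarrow> (real \<times> real \<Rightarrow> real^4) \<Rightarrow>
     (real \<times> real \<Rightarrow> real^4) \<Rightarrow> (real \<times> real \<Rightarrow> real^4) \<Rightarrow>
     (real \<times> real \<Rightarrow> real) \<Rightarrow> (real \<times> real \<Rightarrow> real) \<Rightarrow> bool" where
  "geometric_frame_field D z \<epsilon> x y n\<^sub>1 n\<^sub>2 \<mu> \<nu> \<longleftrightarrow>
     orthonormal_frame_field D z \<epsilon> x y n\<^sub>1 n\<^sub>2 \<and>
     (\<forall>p\<in>D. \<mu> p * \<nu> p \<noteq> 0 \<and>
        second_fund_form z p (x p) (x p) = \<nu> p *\<^sub>R n\<^sub>1 p \<and>
        second_fund_form z p (y p) (y p) = \<nu> p *\<^sub>R n\<^sub>1 p \<and>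
        second_fund_form z p (x p) (y p) = \<mu> p *\<^sub>R n\<^sub>2 p)"

text \<open>The tangent fields \<open>x\<close>, \<open>y\<close> and the functions \<open>\<mu>\<close>, \<open>\<nu>\<close> are those of a geometric frame
  field of \<open>z\<close>.\<close>

definition canonical_parameters ::
    "(real \<times> real) set \<Rightarrow> (real \<times> real \<Rightarrow> real^4) \<Rightarrow>
     (real \<times> real \<Rightarrow> real^4) \<Rightarrow> (real \<times> real \<Rightarrow> real^4) \<Rightarrow>
     (real \<times> real \<Rightarrow> real) \<Rightarrow> (real \<times> real \<Rightarrow> real) \<Rightarrow> bool" where
  "canonical_parameters D z x y \<mu> \<nu> \<longleftrightarrow>
     (\<forall>p\<in>D. partial_u z p = sqrt (coeff_E z p) *\<^sub>R x p \<and>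
        partial_v z p = sqrt (- coeff_G z p) *\<^sub>R y p \<and>
        coeff_E z p = 1 / sqrt \<bar>(\<mu> p)\<^sup>2 - (\<nu> p)\<^sup>2\<bar> \<and>
        coeff_F z p = 0 \<and>
        coeff_G z p = - 1 / sqrt \<bar>(\<mu> p)\<^sup>2 - (\<nu> p)\<^sup>2\<bar>)"

section \<open>The natural equations and their realizations\<close>

definition natural_equations ::
    "(real \<times> real) set \<Rightarrow> real \<Rightarrow> (real \<times> real \<Rightarrow> real) \<Rightarrow> (real \<times> real \<Rightarrow> real) \<Rightarrow> bool" where
  "natural_equations D \<epsilon> K \<kappa> \<longleftrightarrow>
     (\<forall>p\<in>D. root 4 ((K p)\<^sup>2 - (\<kappa> p)\<^sup>2) * hyp_laplacian (\<lambda>q. ln ((K q)\<^sup>2 - (\<kappa> q)\<^sup>2)) p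
              = 8 * K p \<and>
            root 4 ((K p)\<^sup>2 - (\<kappa> p)\<^sup>2)
              * hyp_laplacian (\<lambda>q. ln ((K q + \<epsilon> * \<kappa> q) / (K q - \<epsilon> * \<kappa> q))) p
              = 4 * \<epsilon> * \<kappa> p)"

text \<open>\<open>z\<close> is a minimal Lorentz surface of general type with canonical parameters \<open>(u,v)\<close>, Gauss
  curvature \<open>K\<close> and normal curvature \<open>\<kappa>\<close>, and with geometric functions \<open>\<mu>\<close>, \<open>\<nu>\<close>; the
  geometric normal field is spacelike if \<open>\<epsilon> = 1\<close> and timelike if \<open>\<epsilon> = -1\<close>. In a geometric
  frame \<open>K = -\<epsilon>(\<mu>\<^sup>2 + \<nu>\<^sup>2)\<close> and \<open>\<kappa> = -2\<mu>\<nu>\<close>. So \<open>\<epsilon>\<close> is opposite to the sign of \<open>K\<close>, and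
  \<open>K\<close>, \<open>\<kappa>\<close> and \<open>\<epsilon>\<close> do not distinguish \<open>\<mu>\<close> from \<open>\<nu>\<close>, whereas congruent surfaces have the same
  \<open>\<mu>\<^sup>2\<close> and \<open>\<nu>\<^sup>2\<close>: a uniqueness statement has to refer to the sign of \<open>\<mu>\<^sup>2 - \<nu>\<^sup>2\<close>.\<close>

definition realizes ::
    "(real \<times> real) set \<Rightarrow> (real \<times> real \<Rightarrow> real) \<Rightarrow> (real \<times> real \<Rightarrow> real) \<Rightarrow> real \<Rightarrow>
     (real \<times> real \<Rightarrow> real^4) \<Rightarrow> (real \<times> real \<Rightarrow> real) \<Rightarrow> (real \<times> real \<Rightarrow> real) \<Rightarrow> bool" where
  "realizes D K \<kappa> \<epsilon> z \<mu> \<nu> \<longleftrightarrow>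
     minimal_lorentz_general_type D z \<and>
     (\<exists>x y n\<^sub>1 n\<^sub>2.
        geometric_frame_field D z \<epsilon> x y n\<^sub>1 n\<^sub>2 \<mu> \<nu> \<and>
        canonical_parameters D z x y \<mu> \<nu> \<and>
        (\<forall>p\<in>D. gauss_curvature z x y p = K p \<and>
               normal_curvature z x y n\<^sub>1 n\<^sub>2 p = \<kappa> p))"

end

theory Submission
  imports Defs "HOL-Complex_Analysis.Riemann_Mapping"
begin

text \<open>In canonical parameters, put \<open>\<phi> = - ln (K\<^sup>2 - \<kappa>\<^sup>2) / 8\<close> and
  \<open>\<psi> = ln ((K + \<epsilon> \<kappa>) / (K - \<epsilon> \<kappa>)) / 4\<close>. The derivatives of the surface and of its geometric
  frame form a linear system for \<open>(z, x, y, n\<^sub>1, n\<^sub>2)\<close> whose coefficients depend on \<open>\<phi>\<close>, \<open>\<psi>\<close> and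
  the sign of \<open>\<mu>\<^sup>2 - \<nu>\<^sup>2\<close> only. The Codazzi equations hold identically, and the natural
  equations are exactly the Gauss and Ricci equations, so they say that the system is flat.
  On a disc a flat system is solved by Picard iteration along the rays from the centre; a simply
  connected domain is reduced to a disc (or is the plane) by the Riemann mapping theorem, as
  flatness survives conformal changes of the parameters. A solution with orthonormal initial values
  stays orthonormal, and two solutions with the same coefficients differ by a rigid motion: for
  orthonormal frames \<open>e\<^sub>i\<close>, \<open>e'\<^sub>i\<close> with the same coefficients the map sending \<open>e\<^sub>i\<close> to \<open>e'\<^sub>i\<close> has
  vanishing derivative.\<close>

section \<open>Partial derivatives\<close>

text \<open>In a geometric frame put H = -\<epsilon> K = \<mu>^2 + \<nu>^2. With \<kappa> = -2 \<mu>
  \<nu> this gives H - \<kappa> = (\<mu> + \<nu>)^2, H + \<kappa> = (\<mu> - \<nu>)^2 and K^2 -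
  \<kappa>^2 = (\<mu>^2 - \<nu>^2)^2. Canonical parameters have E = |\<mu>^2 - \<nu>^2|^(-1/2) =
  (K^2 - \<kappa>^2)^(-1/4), so \<phi> is the logarithm of sqrt E, and \<psi> is half the logarithm
  of |\<mu> + \<nu>| / |\<mu> - \<nu>|. Up to a common sign, \<mu> and \<nu> are therefore exp(-2
  \<phi>) times cosh \<psi> and sinh \<psi> in one of the two orders, and d/d\<psi> exchanges cosh
  and sinh: this is why the Codazzi equations hold identically. The order is the sign of \<mu>^2 -
  \<nu>^2; a common sign of \<mu> and \<nu> is absorbed by reversing both normals. The obstacle in
  the integration is that iteration along rays controls only the radial derivative, and the iterates
  solve neither equation of the system. Flatness makes the curl of the integrand linear in the
  defects of the previous iterate, so the transversal error decays factorially together with the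
  iteration itself.\<close>

definition has_partials ::
    "(real \<times> real \<Rightarrow> 'a::real_normed_vector) \<Rightarrow> 'a \<Rightarrow> 'a \<Rightarrow> real \<times> real \<Rightarrow> bool" where
  "has_partials f a b p \<longleftrightarrow>
     (f has_derivative (\<lambda>h. fst h *\<^sub>R a + snd h *\<^sub>R b)) (at p)"

lemma has_partials_slice_u:
  assumes "has_partials f a b p"
  shows "((\<lambda>s. f (s, snd p)) has_vector_derivative a) (at (fst p))"
proof -
  have "((\<lambda>s. (s, snd p)) has_derivative (\<lambda>h. (h, 0))) (at (fst p))"
    by (auto intro!: derivative_eq_intros)
  from has_derivative_compose[OF this, of f "\<lambda>h. fst h *\<^sub>R a + snd h *\<^sub>R b"] assms
  show ?thesis by (simp add: has_partials_def has_vector_derivative_def)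
qed

lemma has_partials_slice_v:
  assumes "has_partials f a b p"
  shows "((\<lambda>s. f (fst p, s)) has_vector_derivative b) (at (snd p))"
proof -
  have "((\<lambda>s. (fst p, s)) has_derivative (\<lambda>h. (0, h))) (at (snd p))"
    by (auto intro!: derivative_eq_intros)
  from has_derivative_compose[OF this, of f "\<lambda>h. fst h *\<^sub>R a + snd h *\<^sub>R b"] assms
  show ?thesis by (simp add: has_partials_def has_vector_derivative_def)
qed

lemma has_partials_imp:
  assumes "has_partials f a b p"
  shows "partial_u f p = a" "partial_v f p = b"
  using has_partials_slice_u[OF assms] has_partials_slice_v[OF assms]
  by (auto simp: partial_u_def partial_v_def vector_derivative_at)

lemma has_partials_unique:
  assumes "has_partials f a b p" "has_partials f c d p"
  shows "a = c" "b = d"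
  using has_partials_imp[OF assms(1)] has_partials_imp[OF assms(2)] by auto

lemma differentiable_imp_has_partials:
  assumes "f differentiable (at p)"
  shows "has_partials f (partial_u f p) (partial_v f p) p"
proof -
  obtain f' where f': "(f has_derivative f') (at p)"
    using assms by (auto simp: differentiable_def)
  interpret f': bounded_linear f' using f' by (rule has_derivative_bounded_linear)
  have "f' h = fst h *\<^sub>R f' (1, 0) + snd h *\<^sub>R f' (0, 1)" for h
  proof -
    have "f' h = f' (fst h *\<^sub>R (1, 0) + snd h *\<^sub>R (0, 1))" by simp
    then show ?thesis by (simp only: f'.add f'.scaleR)
  qed
  then have *: "f' = (\<lambda>h. fst h *\<^sub>R f' (1, 0) + snd h *\<^sub>R f' (0, 1))" by (rule ext)
  have "has_partials f (f' (1, 0)) (f' (0, 1)) p"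
    unfolding has_partials_def by (rule has_derivative_eq_rhs[OF f' *])
  then show ?thesis using has_partials_imp by metis
qed

lemma has_partials_imp_differentiable: "has_partials f a b p \<Longrightarrow> f differentiable (at p)"
  by (auto simp: has_partials_def differentiable_def)

lemma has_partials_cong:
  assumes "has_partials f a b p" "open S" "p \<in> S" "\<And>q. q \<in> S \<Longrightarrow> f q = g q"
  shows "has_partials g a b p"
  using assms has_derivative_transform_within_open unfolding has_partials_def by blast

text \<open>Differentiability is not assumed: \<open>vector_derivative\<close> is a choice from the
  predicate \<open>has_vector_derivative\<close>, which is local, so both sides choose from the same
  predicate even where no derivative exists.\<close>

lemma partial_cong:
  assumes "open S" "p \<in> S" "\<And>q. q \<in> S \<Longrightarrow> f q = g q"
  shows "partial_u f p = partial_u g p" "partial_v f p = partial_v g p"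
proof -
  have u: "open ((\<lambda>s. (s, snd p)) -` S)" and v: "open ((\<lambda>s. (fst p, s)) -` S)"
    by (intro open_vimage assms continuous_intros)+
  have eq: "vector_derivative g' (at x) = vector_derivative h' (at x)"
    if T: "open T" "x \<in> T" "\<And>t. t \<in> T \<Longrightarrow> g' t = h' t" for g' h' :: "real \<Rightarrow> 'a" and T x
  proof -
    have "(g' has_vector_derivative d) (at x) \<longleftrightarrow> (h' has_vector_derivative d) (at x)" for d
      using has_vector_derivative_transform_within_open[OF _ T(1,2), of g' d h']
        has_vector_derivative_transform_within_open[OF _ T(1,2), of h' d g'] T(3) by auto
    then show ?thesis by (simp add: vector_derivative_def)
  qed
  show "partial_u f p = partial_u g p" unfolding partial_u_def
    using assms by (intro eq[OF u]) auto
  show "partial_v f p = partial_v g p" unfolding partial_v_def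
    using assms by (intro eq[OF v]) auto
qed

lemma has_partials_const [simp]: "has_partials (\<lambda>_. c) 0 0 p"
  by (simp add: has_partials_def)

lemma has_partials_bilinear:
  assumes "bounded_bilinear B" "has_partials f a b p" "has_partials g c d p"
  shows "has_partials (\<lambda>q. B (f q) (g q)) (B a (g p) + B (f p) c) (B b (g p) + B (f p) d) p"
proof -
  interpret bounded_bilinear B by fact
  from assms(2,3) show ?thesis unfolding has_partials_def
    by (rule has_derivative_eq_rhs[OF FDERIV])
       (auto simp: add_left add_right scaleR_left scaleR_right algebra_simps)
qed

lemma has_partials_add:
  assumes "has_partials f a b p" "has_partials g c d p"
  shows "has_partials (\<lambda>q. f q + g q) (a + c) (b + d) p"
  using assms unfolding has_partials_def
  by (auto intro!: derivative_eq_intros simp: algebra_simps)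

lemma has_partials_diff:
  assumes "has_partials f a b p" "has_partials g c d p"
  shows "has_partials (\<lambda>q. f q - g q) (a - c) (b - d) p"
  using assms unfolding has_partials_def
  by (auto intro!: derivative_eq_intros simp: algebra_simps)

lemma has_partials_linear:
  assumes "bounded_linear L" "has_partials f a b p"
  shows "has_partials (\<lambda>q. L (f q)) (L a) (L b) p"
proof -
  interpret bounded_linear L by fact
  from assms(2) show ?thesis unfolding has_partials_def
    by (rule has_derivative_eq_rhs[OF has_derivative]) (simp add: add scaleR)
qed

lemma has_partials_minus:
  "has_partials f a b p \<Longrightarrow> has_partials (\<lambda>q. - f q) (- a) (- b) p"
  by (rule has_partials_linear[OF bounded_linear_minus[OF bounded_linear_ident]])

lemma has_partials_sum:
  assumes "\<And>i. i \<in> I \<Longrightarrow> has_partials (f i) (a i) (b i) p"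
  shows "has_partials (\<lambda>q. \<Sum>i\<in>I. f i q) (\<Sum>i\<in>I. a i) (\<Sum>i\<in>I. b i) p"
  using assms
  by (induction I rule: infinite_finite_induct) (auto intro: has_partials_add)

lemma has_partials_scaleR:
  assumes "has_partials f a b p" "has_partials g c d p"
  shows "has_partials (\<lambda>q. f q *\<^sub>R g q) (a *\<^sub>R g p + f p *\<^sub>R c) (b *\<^sub>R g p + f p *\<^sub>R d) p"
  by (rule has_partials_bilinear[OF bounded_bilinear_scaleR assms])

lemma has_partials_mult:
  fixes f g :: "real \<times> real \<Rightarrow> real"
  assumes "has_partials f a b p" "has_partials g c d p"
  shows "has_partials (\<lambda>q. f q * g q) (a * g p + f p * c) (b * g p + f p * d) p"
  by (rule has_partials_bilinear[OF bounded_bilinear_mult assms])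

lemma has_partials_compose_real:
  fixes f :: "real \<times> real \<Rightarrow> real"
  assumes "has_partials f a b p" "(g has_real_derivative d) (at (f p))"
  shows "has_partials (\<lambda>q. g (f q)) (d * a) (d * b) p"
  using has_derivative_compose[of f "\<lambda>h. fst h *\<^sub>R a + snd h *\<^sub>R b" p UNIV g "(*) d"] assms
  unfolding has_partials_def has_field_derivative_def
  by (simp add: algebra_simps)

lemma has_partials_0_constant:
  assumes "open S" "connected S" "\<And>p. p \<in> S \<Longrightarrow> has_partials f 0 0 p" "p \<in> S" "q \<in> S"
  shows "f p = f q"
  using has_derivative_zero_unique_connected[OF assms(1,2) _ assms(4,5), of f] assms(3)
  by (simp add: has_partials_def)

section \<open>Smoothness\<close>

lemma C_k_on_cong:
  assumes "open S" "\<And>p. p \<in> S \<Longrightarrow> f p = g p" "C_k_on k S f"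
  shows "C_k_on k S g"
  using assms(2,3)
proof (induction k arbitrary: f g)
  case 0
  have "continuous_on S f" using 0(2) by (simp only: C_k_on.simps)
  then have "continuous_on S g" using 0(1) by (rule continuous_on_eq)
  then show ?case by (simp only: C_k_on.simps)
next
  case (Suc k)
  have "has_partials g (partial_u f p) (partial_v f p) p" if "p \<in> S" for p
  proof (rule has_partials_cong[OF differentiable_imp_has_partials assms(1) that])
    show "f differentiable (at p)" using Suc.prems(2) that
      by (simp add: differentiable_on_eq_differentiable_at[OF assms(1)])
  qed (use Suc.prems(1) in simp)
  then have "g differentiable_on S"
    unfolding differentiable_on_eq_differentiable_at[OF assms(1)]
    by (blast intro: has_partials_imp_differentiable)
  then show ?case
    using Suc.prems(2) Suc.IH[OF partial_cong(1)[OF assms(1) _ Suc.prems(1)]]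
      Suc.IH[OF partial_cong(2)[OF assms(1) _ Suc.prems(1)]] by simp
qed

lemma C_k_on_Suc_D: "C_k_on (Suc k) S f \<Longrightarrow> C_k_on k S f"
proof (induction k arbitrary: f)
  case 0
  then show ?case by (simp add: differentiable_imp_continuous_on)
next
  case (Suc k)
  from Suc.prems have "f differentiable_on S" "C_k_on (Suc k) S (partial_u f)"
    "C_k_on (Suc k) S (partial_v f)"
    by (simp_all only: C_k_on.simps(2)[of "Suc k" S f])
  then show ?case using Suc.IH by (simp only: C_k_on.simps(2)[of k S f])
qed

lemma C_k_on_subset: "C_k_on k S f \<Longrightarrow> T \<subseteq> S \<Longrightarrow> C_k_on k T f"
  by (induction k arbitrary: f) (auto intro: continuous_on_subset differentiable_on_subset)

lemma C_k_on_has_partials: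
  assumes "open S" "C_k_on (Suc k) S f" "p \<in> S"
  shows "has_partials f (partial_u f p) (partial_v f p) p"
  using assms by (auto intro!: differentiable_imp_has_partials
      simp: differentiable_on_eq_differentiable_at)

text \<open>Lets explicit formulas, known only on S, stand in for \<open>partial_u f\<close> and
  \<open>partial_v f\<close>; every induction on the order of differentiability below passes through
  it.\<close>

lemma C_k_on_SucI:
  assumes "open S" "\<And>p. p \<in> S \<Longrightarrow> has_partials f (a p) (b p) p" "C_k_on k S a" "C_k_on k S b"
  shows "C_k_on (Suc k) S f"
proof -
  have "f differentiable_on S"
    unfolding differentiable_on_eq_differentiable_at[OF assms(1)]
    using assms(2) by (blast intro: has_partials_imp_differentiable)
  moreover have "C_k_on k S (partial_u f)"
    by (rule C_k_on_cong[OF assms(1) _ assms(3)]) (simp add: has_partials_imp[OF assms(2)])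
  moreover have "C_k_on k S (partial_v f)"
    by (rule C_k_on_cong[OF assms(1) _ assms(4)]) (simp add: has_partials_imp[OF assms(2)])
  ultimately show ?thesis by simp
qed

lemma C_k_on_const:
  assumes "open S"
  shows "C_k_on k S (\<lambda>_. c)"
proof (induction k arbitrary: c)
  case (Suc k)
  show ?case by (rule C_k_on_SucI[OF assms has_partials_const Suc Suc])
qed simp

lemma C_k_on_add:
  assumes "open S" "C_k_on k S f" "C_k_on k S g"
  shows "C_k_on k S (\<lambda>p. f p + g p)"
  using assms(2,3)
proof (induction k arbitrary: f g)
  case 0
  then show ?case by (simp add: continuous_on_add)
next
  case (Suc k)
  have d: "C_k_on k S (partial_u f)" "C_k_on k S (partial_v f)"
      "C_k_on k S (partial_u g)" "C_k_on k S (partial_v g)"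
    using Suc.prems by simp_all
  show ?case
    by (rule C_k_on_SucI[OF assms(1) has_partials_add[OF
            C_k_on_has_partials[OF assms(1) Suc.prems(1)]
            C_k_on_has_partials[OF assms(1) Suc.prems(2)]]
          Suc.IH[OF d(1,3)] Suc.IH[OF d(2,4)]])
qed

text \<open>By the product rule the partials of B(f, g) are sums of B applied to one derivative and
  one undifferentiated factor, all of class k, so the induction closes. Scalar multiples, real
  products and the indefinite inner product are instances.\<close>

lemma C_k_on_bilinear:
  assumes "open S" "bounded_bilinear B" "C_k_on k S f" "C_k_on k S g"
  shows "C_k_on k S (\<lambda>p. B (f p) (g p))"
  using assms(3,4)
proof (induction k arbitrary: f g)
  case 0
  then show ?case by (simp add: bounded_bilinear.continuous_on[OF assms(2)])
next
  case (Suc k)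
  have d: "C_k_on k S (partial_u f)" "C_k_on k S (partial_v f)"
      "C_k_on k S (partial_u g)" "C_k_on k S (partial_v g)"
    using Suc.prems by simp_all
  note c = C_k_on_Suc_D[OF Suc.prems(1)] C_k_on_Suc_D[OF Suc.prems(2)]
  show ?case
    by (rule C_k_on_SucI[OF assms(1) has_partials_bilinear[OF assms(2)
            C_k_on_has_partials[OF assms(1) Suc.prems(1)]
            C_k_on_has_partials[OF assms(1) Suc.prems(2)]]
          C_k_on_add[OF assms(1) Suc.IH[OF d(1) c(2)] Suc.IH[OF c(1) d(3)]]
          C_k_on_add[OF assms(1) Suc.IH[OF d(2) c(2)] Suc.IH[OF c(1) d(4)]]])
qed

lemma smooth_on_has_partials:
  "open S \<Longrightarrow> smooth_on S f \<Longrightarrow> p \<in> S \<Longrightarrow> has_partials f (partial_u f p) (partial_v f p) p"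
  using C_k_on_has_partials smooth_on_def by blast

lemma smooth_on_partial:
  "smooth_on S f \<Longrightarrow> smooth_on S (partial_u f)"
  "smooth_on S f \<Longrightarrow> smooth_on S (partial_v f)"
  by (metis C_k_on.simps(2) smooth_on_def)+

lemma smooth_onI:
  assumes "open S" "\<And>p. p \<in> S \<Longrightarrow> has_partials f (a p) (b p) p" "smooth_on S a" "smooth_on S b"
  shows "smooth_on S f"
proof -
  have "C_k_on (Suc k) S f" for k
    using C_k_on_SucI[OF assms(1,2)] assms(3,4) by (auto simp: smooth_on_def)
  then show ?thesis using C_k_on_Suc_D smooth_on_def by blast
qed

lemma smooth_on_cong:
  "smooth_on S f \<Longrightarrow> open S \<Longrightarrow> (\<And>p. p \<in> S \<Longrightarrow> f p = g p) \<Longrightarrow> smooth_on S g"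
  using C_k_on_cong smooth_on_def by metis

lemma smooth_on_subset: "smooth_on S f \<Longrightarrow> T \<subseteq> S \<Longrightarrow> smooth_on T f"
  using C_k_on_subset smooth_on_def by metis

lemma smooth_on_imp_continuous_on: "smooth_on S f \<Longrightarrow> continuous_on S f"
  unfolding smooth_on_def by (metis C_k_on.simps(1))

lemma smooth_on_const: "open S \<Longrightarrow> smooth_on S (\<lambda>_. c)"
  by (simp add: smooth_on_def C_k_on_const)

lemma smooth_on_add:
  "open S \<Longrightarrow> smooth_on S f \<Longrightarrow> smooth_on S g \<Longrightarrow> smooth_on S (\<lambda>p. f p + g p)"
  by (simp add: smooth_on_def C_k_on_add)

lemma smooth_on_bilinear:
  "bounded_bilinear B \<Longrightarrow> open S \<Longrightarrow> smooth_on S f \<Longrightarrow> smooth_on S g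
    \<Longrightarrow> smooth_on S (\<lambda>p. B (f p) (g p))"
  by (simp add: smooth_on_def C_k_on_bilinear)

lemmas smooth_on_scaleR = smooth_on_bilinear[OF bounded_bilinear_scaleR]
lemmas smooth_on_mult = smooth_on_bilinear[OF bounded_bilinear_mult]

lemma smooth_on_minus: "open S \<Longrightarrow> smooth_on S f \<Longrightarrow> smooth_on S (\<lambda>p. - f p)"
  using smooth_on_scaleR[of S "\<lambda>_. -1" f] by (simp add: smooth_on_const)

lemma smooth_on_diff:
  "open S \<Longrightarrow> smooth_on S f \<Longrightarrow> smooth_on S g \<Longrightarrow> smooth_on S (\<lambda>p. f p - g p)"
  using smooth_on_add[of S f "\<lambda>p. - g p"] by (simp add: smooth_on_minus)

text \<open>If g' = d(g), the partials of g(f) are d(g(f)) times those of f. Hence g(f) of class k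
  has partials of class k, and no higher chain rule is needed. The exponential has d(x) = x, the
  reciprocal d(x) = -x^2.\<close>

lemma smooth_on_compose_ode:
  fixes f :: "real \<times> real \<Rightarrow> real"
  assumes "open S" "smooth_on S f"
    and g: "\<And>p. p \<in> S \<Longrightarrow> (g has_real_derivative d (g (f p))) (at (f p))"
    and d: "\<And>k h. C_k_on k S h \<Longrightarrow> C_k_on k S (\<lambda>p. d (h p) :: real)"
  shows "smooth_on S (\<lambda>p. g (f p))"
proof -
  note hp = has_partials_compose_real[OF smooth_on_has_partials[OF assms(1,2)] g]
  have "C_k_on k S (\<lambda>p. g (f p))" for k
  proof (induction k)
    case 0
    have "(\<lambda>p. g (f p)) differentiable_on S"
      unfolding differentiable_on_eq_differentiable_at[OF assms(1)]
      using hp by (blast intro: has_partials_imp_differentiable)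
    then show ?case by (simp add: differentiable_imp_continuous_on)
  next
    case (Suc k)
    have "C_k_on k S (partial_u f)" "C_k_on k S (partial_v f)"
      using smooth_on_partial[OF assms(2)] by (auto simp: smooth_on_def)
    then show ?case
      by (intro C_k_on_SucI[OF assms(1) hp]
          C_k_on_bilinear[OF assms(1) bounded_bilinear_mult] d Suc) auto
  qed
  then show ?thesis by (simp add: smooth_on_def)
qed

section \<open>Elementary functions of smooth functions\<close>

lemma smooth_on_exp:
  fixes f :: "real \<times> real \<Rightarrow> real"
  shows "open S \<Longrightarrow> smooth_on S f \<Longrightarrow> smooth_on S (\<lambda>p. exp (f p))"
  by (rule smooth_on_compose_ode[where d = "\<lambda>x. x"]) (auto intro: DERIV_exp)

lemma smooth_on_inverse:
  fixes f :: "real \<times> real \<Rightarrow> real"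
  assumes "open S" "smooth_on S f" "\<And>p. p \<in> S \<Longrightarrow> f p \<noteq> 0"
  shows "smooth_on S (\<lambda>p. inverse (f p))"
proof (rule smooth_on_compose_ode[where g = inverse and d = "\<lambda>x. -1 * (x * x)", OF assms(1,2)])
  show "C_k_on k S (\<lambda>p. -1 * (h p * h p))" if "C_k_on k S h" for k and h :: "real \<times> real \<Rightarrow> real"
    by (intro C_k_on_bilinear[OF assms(1) bounded_bilinear_mult] that C_k_on_const assms)
  show "(inverse has_real_derivative -1 * (inverse (f p) * inverse (f p))) (at (f p))"
    if "p \<in> S" for p
    using DERIV_inverse[OF assms(3)[OF that]] by (simp add: power2_eq_square)
qed

lemma smooth_on_divide:
  fixes f :: "real \<times> real \<Rightarrow> real"
  assumes "open S" "smooth_on S f" "smooth_on S g" "\<And>p. p \<in> S \<Longrightarrow> g p \<noteq> 0"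
  shows "smooth_on S (\<lambda>p. f p / g p)"
  using smooth_on_mult[OF assms(1,2) smooth_on_inverse[OF assms(1,3,4)]]
  by (simp add: divide_inverse)

lemma smooth_on_ln:
  fixes f :: "real \<times> real \<Rightarrow> real"
  assumes "open S" "smooth_on S f" "\<And>p. p \<in> S \<Longrightarrow> f p > 0"
  shows "smooth_on S (\<lambda>p. ln (f p))"
proof (rule smooth_onI[OF assms(1)])
  show "has_partials (\<lambda>p. ln (f p)) (inverse (f p) * partial_u f p)
      (inverse (f p) * partial_v f p) p" if "p \<in> S" for p
    using assms that
    by (intro has_partials_compose_real smooth_on_has_partials DERIV_ln)
  have "f p \<noteq> 0" if "p \<in> S" for p using assms(3)[OF that] by simp
  then show "smooth_on S (\<lambda>p. inverse (f p) * partial_u f p)"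
    "smooth_on S (\<lambda>p. inverse (f p) * partial_v f p)"
    by (intro smooth_on_mult smooth_on_inverse smooth_on_partial assms; simp)+
qed

text \<open>The symmetry theorem of Clairaut and Schwarz: the second difference over a small square
  equals h^2 times a value of either mixed derivative, by the mean value theorem applied in the two
  orders. If the mixed derivatives differed at p, continuity would keep these values apart.\<close>

lemma mixed_partials_commute_real:
  fixes f :: "real \<times> real \<Rightarrow> real"
  assumes "open S" "p \<in> S" and f: "\<And>q. q \<in> S \<Longrightarrow> has_partials f (a q) (b q) q"
    and a: "\<And>q. q \<in> S \<Longrightarrow> has_partials a (aa q) (ab q) q"
    and b: "\<And>q. q \<in> S \<Longrightarrow> has_partials b (ba q) (bb q) q"
    and cont: "continuous_on S ab" "continuous_on S ba"
  shows "ab p = ba p"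
proof (rule ccontr)
  assume ne: "ab p \<noteq> ba p"
  define d where "d = \<bar>ab p - ba p\<bar> / 2"
  have d: "d > 0" using ne by (simp add: d_def)
  have "isCont ab p" "isCont ba p"
    using cont assms(1,2) by (auto simp: continuous_on_eq_continuous_at)
  then obtain r1 r2 where r: "r1 > 0" "\<And>q. dist q p < r1 \<Longrightarrow> dist (ab q) (ab p) < d"
      "r2 > 0" "\<And>q. dist q p < r2 \<Longrightarrow> dist (ba q) (ba p) < d"
    using d unfolding continuous_at_eps_delta by metis
  obtain r3 where r3: "r3 > 0" "ball p r3 \<subseteq> S" using assms(1,2) openE by blast
  \<comment> \<open>Points of the square with corner p and side h are at distance at most 2 h from
    p; a third of the radii makes the bound 3 h strict.\<close>
  define h where "h = min r1 (min r2 r3) / 3"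
  have h: "h > 0" "3 * h \<le> r1" "3 * h \<le> r2" "3 * h \<le> r3"
    using r r3 by (auto simp: h_def)
  obtain u v where p: "p = (u, v)" by fastforce
  have near: "dist (s, t) p < 3 * h" if "u \<le> s" "s \<le> u + h" "v \<le> t" "t \<le> v + h" for s t
  proof -
    have "dist (s, t) p \<le> \<bar>s - u\<bar> + \<bar>t - v\<bar>"
      using sqrt_sum_squares_le_sum_abs by (simp add: p dist_Pair_Pair dist_real_def)
    then show ?thesis using that h by auto
  qed
  have inS: "(s, t) \<in> S" if "u \<le> s" "s \<le> u + h" "v \<le> t" "t \<le> v + h" for s t
    using near[OF that] r3 h by (auto simp: subset_iff dist_commute)
  have fu: "((\<lambda>s. f (s, t)) has_real_derivative a (s, t)) (at s)" if "(s, t) \<in> S" for s t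
    using has_partials_slice_u[OF f[OF that]]
    by (simp add: has_real_derivative_iff_has_vector_derivative)
  have fv: "((\<lambda>t. f (s, t)) has_real_derivative b (s, t)) (at t)" if "(s, t) \<in> S" for s t
    using has_partials_slice_v[OF f[OF that]]
    by (simp add: has_real_derivative_iff_has_vector_derivative)
  have av: "((\<lambda>t. a (s, t)) has_real_derivative ab (s, t)) (at t)" if "(s, t) \<in> S" for s t
    using has_partials_slice_v[OF a[OF that]]
    by (simp add: has_real_derivative_iff_has_vector_derivative)
  have bu: "((\<lambda>s. b (s, t)) has_real_derivative ba (s, t)) (at s)" if "(s, t) \<in> S" for s t
    using has_partials_slice_u[OF b[OF that]]
    by (simp add: has_real_derivative_iff_has_vector_derivative)
  \<comment> \<open>The second difference over the square; it can be read as an increment in u of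
    increments in v, or the reverse.\<close>
  define Q where "Q = f (u + h, v + h) - f (u + h, v) - f (u, v + h) + f (u, v)"
  have "\<exists>s>u. s < u + h \<and> (f (u + h, v + h) - f (u + h, v)) - (f (u, v + h) - f (u, v))
      = (u + h - u) * (a (s, v + h) - a (s, v))"
    using h fu[OF inS]
    by (intro MVT2[where f = "\<lambda>s. f (s, v + h) - f (s, v)"]) (auto intro!: derivative_intros)
  then obtain s where s: "u < s" "s < u + h" "Q = h * (a (s, v + h) - a (s, v))"
    by (auto simp: Q_def)
  have "\<exists>t>v. t < v + h \<and> a (s, v + h) - a (s, v) = (v + h - v) * ab (s, t)"
    using h s av[OF inS] by (intro MVT2[where f = "\<lambda>t. a (s, t)"]) auto
  then obtain t where t: "v < t" "t < v + h" "Q = h * (h * ab (s, t))" using s by auto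
  have "\<exists>s>v. s < v + h \<and> (f (u + h, v + h) - f (u, v + h)) - (f (u + h, v) - f (u, v))
      = (v + h - v) * (b (u + h, s) - b (u, s))"
    using h fv[OF inS]
    by (intro MVT2[where f = "\<lambda>s. f (u + h, s) - f (u, s)"]) (auto intro!: derivative_intros)
  then obtain s' where s': "v < s'" "s' < v + h" "Q = h * (b (u + h, s') - b (u, s'))"
    by (auto simp: Q_def)
  have "\<exists>t>u. t < u + h \<and> b (u + h, s') - b (u, s') = (u + h - u) * ba (t, s')"
    using h s' bu[OF inS] by (intro MVT2[where f = "\<lambda>t. b (t, s')"]) auto
  then obtain t' where t': "u < t'" "t' < u + h" "Q = h * (h * ba (t', s'))" using s' by auto
  have eq: "ab (s, t) = ba (t', s')" using t(3) t'(3) h by simp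
  have "dist (s, t) p < 3 * h" "dist (t', s') p < 3 * h"
    using s t s' t' by (auto intro!: near)
  then have "dist (ab (s, t)) (ab p) < d" "dist (ba (t', s')) (ba p) < d"
    using h by (auto intro!: r)
  then have "dist (ab p) (ba p) < d + d"
    using dist_triangle_less_add[of "ab p" "ab (s, t)" d "ba p" d] eq by (simp add: dist_commute)
  then show False by (simp add: d_def dist_real_def)
qed

lemma mixed_partials_commute:
  fixes f :: "real \<times> real \<Rightarrow> 'a::euclidean_space"
  assumes "open S" "p \<in> S" and f: "\<And>q. q \<in> S \<Longrightarrow> has_partials f (a q) (b q) q"
    and a: "\<And>q. q \<in> S \<Longrightarrow> has_partials a (aa q) (ab q) q"
    and b: "\<And>q. q \<in> S \<Longrightarrow> has_partials b (ba q) (bb q) q"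
    and cont: "continuous_on S ab" "continuous_on S ba"
  shows "ab p = ba p"
proof (rule euclidean_eqI)
  fix c :: 'a
  note lin = has_partials_linear[OF bounded_linear_inner_left[of c]]
  show "ab p \<bullet> c = ba p \<bullet> c"
    by (rule mixed_partials_commute_real[OF assms(1,2) lin[OF f] lin[OF a] lin[OF b]])
      (auto intro!: continuous_intros cont)
qed

lemma smooth_on_mixed_partials:
  fixes f :: "real \<times> real \<Rightarrow> 'a::euclidean_space"
  assumes "open S" "smooth_on S f" "p \<in> S"
  shows "partial_v (partial_u f) p = partial_u (partial_v f) p"
  by (rule mixed_partials_commute[OF assms(1,3) smooth_on_has_partials[OF assms(1,2)]
        smooth_on_has_partials[OF assms(1) smooth_on_partial(1)[OF assms(2)]]
        smooth_on_has_partials[OF assms(1) smooth_on_partial(2)[OF assms(2)]]])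
    (assumption | intro smooth_on_imp_continuous_on smooth_on_partial assms)+

section \<open>Flat linear systems on a star-shaped domain\<close>

lemma has_partials_continuous_on:
  assumes "\<And>p. p \<in> S \<Longrightarrow> has_partials f (a p) (b p) p"
  shows "continuous_on S f"
proof (rule continuous_at_imp_continuous_on, rule ballI)
  show "isCont f p" if "p \<in> S" for p
    using assms[OF that] has_derivative_continuous unfolding has_partials_def by blast
qed

text \<open>Source of the factor 1/(m + 1) gained in every Picard step; these factors accumulate to
  the factorials in the estimates below.\<close>

lemma norm_integral_le_power:
  fixes f :: "real \<Rightarrow> 'a::banach"
  assumes "continuous_on {0..1} f" "\<And>t. t \<in> {0..1} \<Longrightarrow> norm (f t) \<le> K * t ^ m"
  shows "norm (integral {0..1} f) \<le> K / Suc m"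
proof -
  have "((\<lambda>t. K * t ^ m) has_integral (K * 1 ^ Suc m / Suc m - K * 0 ^ Suc m / Suc m)) {0..1}"
  proof (rule fundamental_theorem_of_calculus)
    fix x :: real
    show "((\<lambda>t. K * t ^ Suc m / real (Suc m)) has_vector_derivative K * x ^ m) (at x within {0..1})"
      using DERIV_cdivide[OF DERIV_cmult[OF DERIV_pow[of "Suc m" x]], of K "real (Suc m)"]
      by (simp add: has_real_derivative_iff_has_vector_derivative has_vector_derivative_at_within
          del: power_Suc of_nat_Suc)
  qed simp
  then have I: "((\<lambda>t. K * t ^ m) has_integral (K / Suc m)) {0..1}" by simp
  have "norm (integral {0..1} f) \<le> integral {0..1} (\<lambda>t. K * t ^ m)"
    by (rule integral_norm_bound_integral)
       (use assms I in \<open>auto intro: integrable_continuous_interval\<close>)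
  then show ?thesis by (simp only: integral_unique[OF I])
qed

lemma star_scaleR_mem:
  assumes "convex S" "(0::'a::real_normed_vector) \<in> S" "p \<in> S" "t \<in> {0..1::real}"
  shows "t *\<^sub>R p \<in> S"
  using assms convexD[of S 0 p "1 - t" t] by auto

lemma continuous_on_ray:
  assumes "convex S" "(0::'a::real_normed_vector) \<in> S" "continuous_on S f"
  shows "continuous_on (S \<times> {0..1::real}) (\<lambda>x. f (snd x *\<^sub>R fst x))"
  by (rule continuous_on_compose2[OF assms(3)])
     (auto intro!: continuous_intros star_scaleR_mem[OF assms(1,2)])

lemma continuous_on_ray_slice:
  assumes "convex S" "(0::'a::real_normed_vector) \<in> S" "continuous_on S f" "p \<in> S"
  shows "continuous_on {0..1::real} (\<lambda>t. f (t *\<^sub>R p))"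
  by (rule continuous_on_compose2[OF assms(3)])
     (use assms in \<open>auto intro!: continuous_intros star_scaleR_mem[OF assms(1,2)]\<close>)

lemma continuous_on_ray_integral:
  fixes f :: "'a::real_normed_vector \<Rightarrow> 'b::banach"
  assumes "convex S" "0 \<in> S" "continuous_on S f"
  shows "continuous_on S (\<lambda>p. integral {0..1::real} (\<lambda>t. t *\<^sub>R f (t *\<^sub>R p)))"
proof -
  have "continuous_on (S \<times> cbox 0 1) (\<lambda>(p, t). t *\<^sub>R f (t *\<^sub>R p))"
    using continuous_on_ray[OF assms] by (auto simp: case_prod_unfold intro!: continuous_intros)
  then show ?thesis using integral_continuous_on_param[of S "0::real" 1] by auto
qed

text \<open>The integral of the one-form g du + h dv along the segment from 0 to p.\<close>

definition radial_integral ::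
    "(real \<times> real \<Rightarrow> 'b::banach) \<Rightarrow> (real \<times> real \<Rightarrow> 'b) \<Rightarrow> real \<times> real \<Rightarrow> 'b" where
  "radial_integral g h p =
     integral {0..1} (\<lambda>t. fst p *\<^sub>R g (t *\<^sub>R p) + snd p *\<^sub>R h (t *\<^sub>R p))"

lemma has_partials_ray:
  assumes "has_partials g a b (t *\<^sub>R p)"
  shows "has_partials (\<lambda>q. g (t *\<^sub>R q)) (t *\<^sub>R a) (t *\<^sub>R b) p"
proof -
  have "((\<lambda>q. t *\<^sub>R q) has_derivative (\<lambda>h. t *\<^sub>R h)) (at p)"
    by (auto intro!: derivative_eq_intros)
  from has_derivative_compose[OF this] assms show ?thesis
    unfolding has_partials_def by (force simp: algebra_simps)
qed

lemma has_partials_fst: "has_partials fst 1 0 p" and has_partials_snd: "has_partials snd 0 1 p"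
  unfolding has_partials_def by (auto intro!: derivative_eq_intros)

text \<open>The homotopy formula of the Poincare lemma for the one-form \<open>g du + h dv\<close>.\<close>

lemma has_partials_radial_integral:
  fixes g h :: "real \<times> real \<Rightarrow> 'b::banach"
  assumes S: "open S" "convex S" "0 \<in> S" "p \<in> S"
    and g: "\<And>q. q \<in> S \<Longrightarrow> has_partials g (gu q) (gv q) q"
    and h: "\<And>q. q \<in> S \<Longrightarrow> has_partials h (hu q) (hv q) q"
    and cont: "continuous_on S gu" "continuous_on S gv" "continuous_on S hu" "continuous_on S hv"
  defines "w \<equiv> \<lambda>p. integral {0..1::real} (\<lambda>t. t *\<^sub>R (hu (t *\<^sub>R p) - gv (t *\<^sub>R p)))"
  shows "has_partials (radial_integral g h) (g p + snd p *\<^sub>R w p) (h p - fst p *\<^sub>R w p) p"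
proof -
  have contg: "continuous_on S g" "continuous_on S h"
    by (rule has_partials_continuous_on; rule g h; assumption)+
  note ray = continuous_on_ray[OF S(2,3)]
  note slice = continuous_on_ray_slice[OF S(2,3) _ S(4)]
  \<comment> \<open>A and B are the two partial derivatives, with respect to the endpoint q, of the
    integrand F at parameter t.\<close>
  define A where "A q t = g (t *\<^sub>R q) + (fst q *\<^sub>R (t *\<^sub>R gu (t *\<^sub>R q)) + snd q *\<^sub>R (t *\<^sub>R hu (t *\<^sub>R q)))" for q t
  define B where "B q t = h (t *\<^sub>R q) + (fst q *\<^sub>R (t *\<^sub>R gv (t *\<^sub>R q)) + snd q *\<^sub>R (t *\<^sub>R hv (t *\<^sub>R q)))" for q t
  define F where "F q t = fst q *\<^sub>R g (t *\<^sub>R q) + snd q *\<^sub>R h (t *\<^sub>R q)" for q t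
  \<comment> \<open>Leibniz' rule takes the derivative of the integrand as a function into bounded
    linear maps, so the pair (A, B) is packed into one.\<close>
  define F' where "F' q t = (blinfun_scaleR_left (A q t) o\<^sub>L fst_blinfun)
      + (blinfun_scaleR_left (B q t) o\<^sub>L snd_blinfun)" for q t
  have F'_apply: "blinfun_apply (F' q t) = (\<lambda>h. fst h *\<^sub>R A q t + snd h *\<^sub>R B q t)" for q t
    by (auto simp: F'_def blinfun.bilinear_simps)
  have contAB: "continuous_on (S \<times> {0..1}) (\<lambda>x. A (fst x) (snd x))"
    "continuous_on (S \<times> {0..1}) (\<lambda>x. B (fst x) (snd x))"
    unfolding A_def B_def by (intro continuous_intros ray cont contg)+
  have contF': "continuous_on (S \<times> cbox 0 1) (\<lambda>(q, t). F' q t)"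
    unfolding F'_def case_prod_unfold using contAB
    by (auto intro!: continuous_intros
        bounded_linear.continuous_on[OF bounded_linear_blinfun_scaleR_left])
  have "((\<lambda>q. integral (cbox 0 1) (F q)) has_derivative integral (cbox 0 1) (F' p)) (at p)"
    unfolding at_within_open[OF S(4,1), symmetric]
  proof (rule leibniz_rule[OF _ _ contF' S(4,2)])
    fix q t assume q: "q \<in> S" "(t::real) \<in> cbox 0 1"
    then have tq: "t *\<^sub>R q \<in> S" using star_scaleR_mem[OF S(2,3)] by simp
    note gh = has_partials_ray[OF g[OF tq]] has_partials_ray[OF h[OF tq]]
    have "has_partials (\<lambda>q. F q t) (A q t) (B q t) q"
      using has_partials_add[OF has_partials_scaleR[OF has_partials_fst gh(1)]
          has_partials_scaleR[OF has_partials_snd gh(2)]]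
      by (simp add: A_def B_def F_def algebra_simps)
    then show "((\<lambda>q. F q t) has_derivative blinfun_apply (F' q t)) (at q within S)"
      unfolding F'_apply has_partials_def by (rule has_derivative_at_withinI)
  next
    fix q assume q: "q \<in> S"
    have "continuous_on {0..1} (F q)" unfolding F_def
      by (intro continuous_intros continuous_on_ray_slice[OF S(2,3) _ q] contg)
    then show "F q integrable_on cbox 0 1" by (simp add: integrable_continuous_interval)
  qed
  moreover have "blinfun_apply (integral (cbox 0 1) (F' p))
      = (\<lambda>h. fst h *\<^sub>R integral {0..1} (A p) + snd h *\<^sub>R integral {0..1} (B p))"
  proof -
    have *: "blinfun_apply (integral (cbox 0 1) (F' p)) x
        = integral {0..1} (\<lambda>t. blinfun_apply (F' p t) x)" for x
    proof -
      have "continuous_on (cbox 0 1) (\<lambda>t. case (p, t) of (q, t) \<Rightarrow> F' q t)"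
        by (rule continuous_on_compose2[OF contF']) (use S(4) in \<open>auto intro!: continuous_intros\<close>)
      then have "continuous_on (cbox 0 1) (F' p)" by simp
      then show ?thesis
        using blinfun_apply_integral[OF integrable_continuous, of 0 1 "F' p" x] by simp
    qed
    have i: "A p integrable_on {0..1}" "B p integrable_on {0..1}"
      unfolding A_def B_def
      by (intro integrable_continuous_interval continuous_intros slice cont contg)+
    show ?thesis
      by (rule ext, subst *) (use i in \<open>simp add: F'_apply integral_add integrable_cmul\<close>)
  qed
  ultimately have P: "has_partials (radial_integral g h) (integral {0..1} (A p)) (integral {0..1} (B p)) p"
    unfolding has_partials_def radial_integral_def F_def cbox_interval by simp
  \<comment> \<open>The derivative of t f(t p) is f(t p) plus t times the derivative of f in
    direction p, so the integral is f(p). A differs from this expression for g, and B from that for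
    h, only by a multiple of the curl \<open>hu - gv\<close>, which produces
    \<open>w\<close>.\<close>
  have ftc: "((\<lambda>t. f (t *\<^sub>R p) + t *\<^sub>R (fst p *\<^sub>R a (t *\<^sub>R p) + snd p *\<^sub>R b (t *\<^sub>R p)))
       has_integral f p) {0..1}"
    if f: "\<And>q. q \<in> S \<Longrightarrow> has_partials f (a q) (b q) q" for f :: "real \<times> real \<Rightarrow> 'b" and a b
  proof -
    have "((\<lambda>t. f (t *\<^sub>R p) + t *\<^sub>R (fst p *\<^sub>R a (t *\<^sub>R p) + snd p *\<^sub>R b (t *\<^sub>R p)))
       has_integral (1 *\<^sub>R f (1 *\<^sub>R p) - 0 *\<^sub>R f (0 *\<^sub>R p))) {0..1}"
    proof (rule fundamental_theorem_of_calculus)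
      fix t :: real assume t: "t \<in> {0..1}"
      then have tp: "t *\<^sub>R p \<in> S" using star_scaleR_mem[OF S(2,3)] S(4) by simp
      have "((\<lambda>t. t *\<^sub>R p) has_derivative (\<lambda>s. s *\<^sub>R p)) (at t)"
        by (auto intro!: derivative_eq_intros)
      from has_derivative_compose[OF this f[OF tp, unfolded has_partials_def]]
      have "((\<lambda>t. f (t *\<^sub>R p)) has_vector_derivative
          (fst p *\<^sub>R a (t *\<^sub>R p) + snd p *\<^sub>R b (t *\<^sub>R p))) (at t)"
        by (simp add: has_vector_derivative_def algebra_simps)
      then have "((\<lambda>t. t *\<^sub>R f (t *\<^sub>R p)) has_vector_derivative
          (t *\<^sub>R (fst p *\<^sub>R a (t *\<^sub>R p) + snd p *\<^sub>R b (t *\<^sub>R p)) + 1 *\<^sub>R f (t *\<^sub>R p))) (at t)"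
        by (intro has_vector_derivative_scaleR) (auto intro: derivative_intros)
      then show "((\<lambda>t. t *\<^sub>R f (t *\<^sub>R p)) has_vector_derivative
          f (t *\<^sub>R p) + t *\<^sub>R (fst p *\<^sub>R a (t *\<^sub>R p) + snd p *\<^sub>R b (t *\<^sub>R p))) (at t within {0..1})"
        by (simp add: has_vector_derivative_at_within add.commute)
    qed simp
    then show ?thesis by simp
  qed
  have w: "((\<lambda>t. t *\<^sub>R (hu (t *\<^sub>R p) - gv (t *\<^sub>R p))) has_integral w p) {0..1}"
    unfolding w_def
    by (intro integrable_integral integrable_continuous_interval continuous_intros slice cont)
  have "((\<lambda>t. (g (t *\<^sub>R p) + t *\<^sub>R (fst p *\<^sub>R gu (t *\<^sub>R p) + snd p *\<^sub>R gv (t *\<^sub>R p)))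
      + snd p *\<^sub>R (t *\<^sub>R (hu (t *\<^sub>R p) - gv (t *\<^sub>R p)))) has_integral g p + snd p *\<^sub>R w p) {0..1}"
    by (intro has_integral_add has_integral_cmul ftc[OF g] w)
  then have "integral {0..1} (A p) = g p + snd p *\<^sub>R w p"
    unfolding A_def by (intro integral_unique) (simp add: algebra_simps)
  moreover have "((\<lambda>t. (h (t *\<^sub>R p) + t *\<^sub>R (fst p *\<^sub>R hu (t *\<^sub>R p) + snd p *\<^sub>R hv (t *\<^sub>R p)))
      - fst p *\<^sub>R (t *\<^sub>R (hu (t *\<^sub>R p) - gv (t *\<^sub>R p)))) has_integral h p - fst p *\<^sub>R w p) {0..1}"
    by (intro has_integral_diff has_integral_cmul ftc[OF h] w)
  then have "integral {0..1} (B p) = h p - fst p *\<^sub>R w p"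
    unfolding B_def by (intro integral_unique) (simp add: algebra_simps)
  ultimately show ?thesis using P by simp
qed

lemma abs_coordinate_le_norm:
  fixes p :: "real \<times> real"
  shows "\<bar>fst p\<bar> \<le> norm p" "\<bar>snd p\<bar> \<le> norm p"
  using norm_fst_le[of "fst p" "snd p"] norm_snd_le[of "snd p" "fst p"] by auto

section \<open>Linear systems with zero curvature\<close>

lemma C_k_on_sum:
  assumes "open S" "\<And>i. i \<in> I \<Longrightarrow> C_k_on k S (f i)"
  shows "C_k_on k S (\<lambda>p. \<Sum>i\<in>I. f i p)"
  using assms(2)
  by (induction I rule: infinite_finite_induct)
     (auto intro: C_k_on_add[OF assms(1)] simp: C_k_on_const[OF assms(1)])

definition lin_comb ::
    "nat \<Rightarrow> (nat \<Rightarrow> nat \<Rightarrow> real \<times> real \<Rightarrow> real) \<Rightarrow> (nat \<Rightarrow> real \<times> real \<Rightarrow> 'b::real_vector)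
     \<Rightarrow> nat \<Rightarrow> real \<times> real \<Rightarrow> 'b" where
  "lin_comb n P X i p = (\<Sum>j<n. P i j p *\<^sub>R X j p)"

text \<open>The zero-curvature condition \<open>P\<^sub>v + P Q = Q\<^sub>u + Q P\<close>, which is
  the equality of the mixed derivatives forced by \<open>X\<^sub>u = P X\<close> and
  \<open>X\<^sub>v = Q X\<close>. Class C^1 of the coefficients is what one differentiation requires
  and is preserved by holomorphic pullback.\<close>

definition flat_system ::
    "nat \<Rightarrow> (real \<times> real) set \<Rightarrow> (nat \<Rightarrow> nat \<Rightarrow> real \<times> real \<Rightarrow> real)
     \<Rightarrow> (nat \<Rightarrow> nat \<Rightarrow> real \<times> real \<Rightarrow> real) \<Rightarrow> bool" where
  "flat_system n S P Q \<longleftrightarrow>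
     (\<forall>i<n. \<forall>j<n. C_k_on 1 S (P i j) \<and> C_k_on 1 S (Q i j)) \<and>
     (\<forall>i<n. \<forall>k<n. \<forall>p\<in>S.
        partial_v (P i k) p + (\<Sum>j<n. P i j p * Q j k p)
        = partial_u (Q i k) p + (\<Sum>j<n. Q i j p * P j k p))"

definition solves_system ::
    "nat \<Rightarrow> (real \<times> real) set \<Rightarrow> (nat \<Rightarrow> nat \<Rightarrow> real \<times> real \<Rightarrow> real)
     \<Rightarrow> (nat \<Rightarrow> nat \<Rightarrow> real \<times> real \<Rightarrow> real) \<Rightarrow> (nat \<Rightarrow> real \<times> real \<Rightarrow> 'b::real_normed_vector) \<Rightarrow> bool" where
  "solves_system n S P Q X \<longleftrightarrow>
     (\<forall>i<n. \<forall>p\<in>S. has_partials (X i) (lin_comb n P X i p) (lin_comb n Q X i p) p)"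

text \<open>Holds for every C^1 family, not only for solutions: after subtracting the defects, what
  remains is linear in X with the zero-curvature expression as coefficient, and flatness cancels
  it.\<close>

lemma lin_comb_curl:
  fixes X :: "nat \<Rightarrow> real \<times> real \<Rightarrow> 'b::real_normed_vector"
  assumes "open S" "flat_system n S P Q" "p \<in> S" "i < n"
    and X: "\<And>j. j < n \<Longrightarrow> C_k_on 1 S (X j)"
  shows "partial_u (lin_comb n Q X i) p - partial_v (lin_comb n P X i) p
    = (\<Sum>j<n. Q i j p *\<^sub>R (partial_u (X j) p - lin_comb n P X j p))
      - (\<Sum>j<n. P i j p *\<^sub>R (partial_v (X j) p - lin_comb n Q X j p))"
proof -
  note hp = C_k_on_has_partials[of S 0, OF assms(1) _ assms(3), unfolded One_nat_def[symmetric]]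
  have "has_partials (lin_comb n M X i)
      (\<Sum>j<n. partial_u (M i j) p *\<^sub>R X j p + M i j p *\<^sub>R partial_u (X j) p)
      (\<Sum>j<n. partial_v (M i j) p *\<^sub>R X j p + M i j p *\<^sub>R partial_v (X j) p) p"
    if "\<And>j. j < n \<Longrightarrow> C_k_on 1 S (M i j)" for M
    unfolding lin_comb_def
    by (intro has_partials_sum has_partials_scaleR hp that X) auto
  from has_partials_imp[OF this[of Q]] has_partials_imp[OF this[of P]]
  have d: "partial_u (lin_comb n Q X i) p
      = (\<Sum>j<n. partial_u (Q i j) p *\<^sub>R X j p) + (\<Sum>j<n. Q i j p *\<^sub>R partial_u (X j) p)"
    "partial_v (lin_comb n P X i) p
      = (\<Sum>j<n. partial_v (P i j) p *\<^sub>R X j p) + (\<Sum>j<n. P i j p *\<^sub>R partial_v (X j) p)"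
    using assms(2,4) by (auto simp: flat_system_def sum.distrib)
  have swap: "(\<Sum>j<n. M i j p *\<^sub>R lin_comb n N X j p)
      = (\<Sum>k<n. (\<Sum>j<n. M i j p * N j k p) *\<^sub>R X k p)" for M N
    unfolding lin_comb_def scaleR_sum_right scaleR_sum_left scaleR_scaleR
    by (rule sum.swap)
  have flat: "(\<Sum>k<n. (partial_v (P i k) p + (\<Sum>j<n. P i j p * Q j k p)) *\<^sub>R X k p)
      = (\<Sum>k<n. (partial_u (Q i k) p + (\<Sum>j<n. Q i j p * P j k p)) *\<^sub>R X k p)"
    using assms(2-4) by (intro sum.cong) (auto simp: flat_system_def)
  show ?thesis
    using flat unfolding d scaleR_add_left sum.distrib scaleR_diff_right sum_subtractf swap
    by (simp add: algebra_simps)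
qed

text \<open>\<open>exhaust\<close> puts every point inside a disc about the origin whose closure
  lies in S. The coefficients are bounded on that compact disc, so convergence can be proved there
  even if they are unbounded on S.\<close>

locale star_flat_system =
  fixes n :: nat and S :: "(real \<times> real) set" and P Q :: "nat \<Rightarrow> nat \<Rightarrow> real \<times> real \<Rightarrow> real"
    and c :: "nat \<Rightarrow> 'b::euclidean_space"
  assumes S: "open S" "convex S" "0 \<in> S"
    and exhaust: "\<And>p. p \<in> S \<Longrightarrow> \<exists>\<rho>>0. p \<in> ball 0 \<rho> \<and> cball 0 \<rho> \<subseteq> S"
    and flat: "flat_system n S P Q"
begin

lemma C1: "i < n \<Longrightarrow> j < n \<Longrightarrow> C_k_on 1 S (P i j)" "i < n \<Longrightarrow> j < n \<Longrightarrow> C_k_on 1 S (Q i j)"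
  using flat by (auto simp: flat_system_def)

lemma C0: "i < n \<Longrightarrow> j < n \<Longrightarrow> continuous_on S (P i j)"
    "i < n \<Longrightarrow> j < n \<Longrightarrow> continuous_on S (Q i j)"
  using C1 C_k_on_Suc_D[of 0] by (metis C_k_on.simps(1) One_nat_def)+

definition step :: "(nat \<Rightarrow> real \<times> real \<Rightarrow> 'b) \<Rightarrow> nat \<Rightarrow> real \<times> real \<Rightarrow> 'b" where
  "step X i = radial_integral (lin_comb n P X i) (lin_comb n Q X i)"

primrec iterate :: "nat \<Rightarrow> nat \<Rightarrow> real \<times> real \<Rightarrow> 'b" where
  "iterate 0 = (\<lambda>i p. c i)"
| "iterate (Suc m) = (\<lambda>i p. c i + step (iterate m) i p)"

text \<open>The curl of the integrand of \<^term>\<open>step\<close>. By flatness it is linear in the defects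
  \<open>X\<^sub>u - P X\<close> and \<open>X\<^sub>v - Q X\<close>, which is why the defects of the iterates tend to zero.\<close>

definition residue where
  "residue m i p = (\<Sum>j<n. Q i j p *\<^sub>R (partial_u (iterate m j) p - lin_comb n P (iterate m) j p))
      - (\<Sum>j<n. P i j p *\<^sub>R (partial_v (iterate m j) p - lin_comb n Q (iterate m) j p))"

definition residue_integral where
  "residue_integral m i p = integral {0..1::real} (\<lambda>t. t *\<^sub>R residue m i (t *\<^sub>R p))"

lemma C_k_on_lin_comb:
  fixes X :: "nat \<Rightarrow> real \<times> real \<Rightarrow> 'b"
  assumes "\<And>j. j < n \<Longrightarrow> C_k_on k S (M i j)" "\<And>j. j < n \<Longrightarrow> C_k_on k S (X j)"
  shows "C_k_on k S (lin_comb n M X i)"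
  unfolding lin_comb_def
  by (intro C_k_on_sum C_k_on_bilinear[OF _ bounded_bilinear_scaleR] S(1)) (use assms in auto)

text \<open>The homotopy formula gives the integrand plus a multiple of the ray integral of its
  curl, and \<open>lin_comb_curl\<close> identifies that curl with \<open>residue\<close>.
  Regularity is part of the conclusion because the formula for the next iterate needs the present
  one to be C^1.\<close>

lemma iterate_step:
  assumes X: "\<And>j. j < n \<Longrightarrow> C_k_on 1 S (iterate m j)" and i: "i < n"
  shows "C_k_on 1 S (iterate (Suc m) i)"
    and "\<And>p. p \<in> S \<Longrightarrow> partial_u (iterate (Suc m) i) p
      = lin_comb n P (iterate m) i p + snd p *\<^sub>R residue_integral m i p"
    and "\<And>p. p \<in> S \<Longrightarrow> partial_v (iterate (Suc m) i) p
      = lin_comb n Q (iterate m) i p - fst p *\<^sub>R residue_integral m i p"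
    and "continuous_on S (residue m i)"
proof -
  let ?g = "lin_comb n P (iterate m) i" and ?h = "lin_comb n Q (iterate m) i"
  have gh: "C_k_on 1 S ?g" "C_k_on 1 S ?h"
    by (intro C_k_on_lin_comb C1 X i; assumption)+
  note hp = C_k_on_has_partials[of S 0, OF S(1), unfolded One_nat_def[symmetric]]
  have cont: "continuous_on S (partial_u ?g)" "continuous_on S (partial_v ?g)"
    "continuous_on S (partial_u ?h)" "continuous_on S (partial_v ?h)"
    using gh by (simp_all add: One_nat_def)
  have res: "residue m i p = partial_u ?h p - partial_v ?g p" if "p \<in> S" for p
    unfolding residue_def using lin_comb_curl[OF S(1) flat that i, of "iterate m"] X by simp
  show cres: "continuous_on S (residue m i)"
    using res cont by (simp cong: continuous_on_cong add: continuous_on_diff)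
  have P': "has_partials (iterate (Suc m) i) (?g p + snd p *\<^sub>R residue_integral m i p)
      (?h p - fst p *\<^sub>R residue_integral m i p) p" if p: "p \<in> S" for p
  proof -
    have "residue_integral m i p
        = integral {0..1::real} (\<lambda>t. t *\<^sub>R (partial_u ?h (t *\<^sub>R p) - partial_v ?g (t *\<^sub>R p)))"
      unfolding residue_integral_def
      by (intro integral_cong) (use res star_scaleR_mem[OF S(2,3) p] in auto)
    then show ?thesis
      using has_partials_add[OF has_partials_const[of "c i"]
          has_partials_radial_integral[OF S p hp[OF gh(1)] hp[OF gh(2)] cont]]
      by (simp add: step_def)
  qed
  show "\<And>p. p \<in> S \<Longrightarrow> partial_u (iterate (Suc m) i) p = ?g p + snd p *\<^sub>R residue_integral m i p"
    "\<And>p. p \<in> S \<Longrightarrow> partial_v (iterate (Suc m) i) p = ?h p - fst p *\<^sub>R residue_integral m i p"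
    using P' by (auto dest: has_partials_imp)
  have cri: "continuous_on S (residue_integral m i)"
    unfolding residue_integral_def by (rule continuous_on_ray_integral[OF S(2,3) cres])
  have c0: "continuous_on S ?g" "continuous_on S ?h"
    using gh C_k_on_Suc_D[of 0 S ?g] C_k_on_Suc_D[of 0 S ?h] by (simp_all add: One_nat_def)
  show "C_k_on 1 S (iterate (Suc m) i)" unfolding One_nat_def
    by (rule C_k_on_SucI[OF S(1) P']) (auto intro!: continuous_intros c0 cri)
qed

lemma C1_iterate: "i < n \<Longrightarrow> C_k_on 1 S (iterate m i)"
proof (induction m arbitrary: i)
  case 0
  show ?case unfolding iterate.simps by (rule C_k_on_const[OF S(1)])
next
  case (Suc m)
  show ?case by (rule iterate_step(1)[OF Suc.IH Suc.prems])
qed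

lemma C0_iterate: "i < n \<Longrightarrow> continuous_on S (iterate m i)"
  using C1_iterate[of i m] C_k_on_Suc_D[of 0 S "iterate m i"] by (simp add: One_nat_def)

lemma continuous_on_residue: "i < n \<Longrightarrow> continuous_on S (residue m i)"
  using iterate_step(4) C1_iterate by blast

lemma partial_iterate_Suc:
  assumes "i < n" "p \<in> S"
  shows "partial_u (iterate (Suc m) i) p
      = lin_comb n P (iterate m) i p + snd p *\<^sub>R residue_integral m i p"
    and "partial_v (iterate (Suc m) i) p
      = lin_comb n Q (iterate m) i p - fst p *\<^sub>R residue_integral m i p"
  by (rule iterate_step(2)[OF C1_iterate assms]; assumption)
     (rule iterate_step(3)[OF C1_iterate assms]; assumption)

section \<open>Picard estimates on a closed disc\<close>

context
  fixes \<rho> M C :: real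
  assumes \<rho>: "\<rho> > 0" "cball 0 \<rho> \<subseteq> S"
    and M: "M \<ge> 0" "\<And>i p. i < n \<Longrightarrow> p \<in> cball 0 \<rho> \<Longrightarrow> (\<Sum>j<n. \<bar>P i j p\<bar>) \<le> M"
      "\<And>i p. i < n \<Longrightarrow> p \<in> cball 0 \<rho> \<Longrightarrow> (\<Sum>j<n. \<bar>Q i j p\<bar>) \<le> M"
    and C: "\<And>i. i < n \<Longrightarrow> norm (c i) \<le> C"
begin

lemma norm_sum_scaleR_le:
  fixes X :: "nat \<Rightarrow> 'b"
  assumes "(\<Sum>j<n. \<bar>a j\<bar>) \<le> M" "\<And>j. j < n \<Longrightarrow> norm (X j) \<le> K" "K \<ge> 0"
  shows "norm (\<Sum>j<n. a j *\<^sub>R X j) \<le> M * K"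
proof -
  have "norm (\<Sum>j<n. a j *\<^sub>R X j) \<le> (\<Sum>j<n. \<bar>a j\<bar> * K)"
    by (rule sum_norm_le) (use assms in \<open>auto intro: mult_left_mono\<close>)
  also have "\<dots> \<le> M * K" unfolding sum_distrib_right[symmetric]
    using assms by (intro mult_right_mono) auto
  finally show ?thesis .
qed

text \<open>Each of the two coordinate terms of the integrand contributes at most M |p| times the
  bound for X, whence 2 M |p|; along the ray that bound scales like t^m, and integration divides by
  m + 1.\<close>

lemma norm_step_le:
  assumes X: "\<And>j. j < n \<Longrightarrow> continuous_on S (X j)"
    and K: "\<And>j q. j < n \<Longrightarrow> q \<in> cball 0 \<rho> \<Longrightarrow> norm (X j q) \<le> K * norm q ^ m" "K \<ge> 0"
    and i: "i < n" and p: "p \<in> cball 0 \<rho>"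
  shows "norm (step X i p) \<le> 2 * M * K / Suc m * norm p ^ Suc m"
proof -
  have pS: "p \<in> S" using p \<rho> by auto
  have cl: "continuous_on S (lin_comb n P X i)" "continuous_on S (lin_comb n Q X i)"
    using C_k_on_lin_comb[of 0 P i X] C_k_on_lin_comb[of 0 Q i X] X C0 i by auto
  have "norm (step X i p) \<le> (2 * M * K * norm p ^ Suc m) / Suc m"
    unfolding step_def radial_integral_def
  proof (rule norm_integral_le_power)
    show "continuous_on {0..1} (\<lambda>t. fst p *\<^sub>R lin_comb n P X i (t *\<^sub>R p)
        + snd p *\<^sub>R lin_comb n Q X i (t *\<^sub>R p))"
      by (intro continuous_intros continuous_on_ray_slice[OF S(2,3) _ pS] cl)
    fix t :: real assume t: "t \<in> {0..1}"
    have tp: "t *\<^sub>R p \<in> cball 0 \<rho>"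
      using t p mult_left_le_one_le[of "norm p" t] by auto
    have b: "norm (X j (t *\<^sub>R p)) \<le> K * (t ^ m * norm p ^ m)" if "j < n" for j
      using K(1)[OF that tp] t by (simp add: power_mult_distrib)
    have nn: "0 \<le> K * (t ^ m * norm p ^ m)" using t K(2) by auto
    have l: "norm (lin_comb n P X i (t *\<^sub>R p)) \<le> M * (K * (t ^ m * norm p ^ m))"
      "norm (lin_comb n Q X i (t *\<^sub>R p)) \<le> M * (K * (t ^ m * norm p ^ m))"
      unfolding lin_comb_def using M(2,3)[OF i tp] b nn by (auto intro!: norm_sum_scaleR_le)
    have "norm (fst p *\<^sub>R lin_comb n P X i (t *\<^sub>R p) + snd p *\<^sub>R lin_comb n Q X i (t *\<^sub>R p))
        \<le> \<bar>fst p\<bar> * norm (lin_comb n P X i (t *\<^sub>R p)) + \<bar>snd p\<bar> * norm (lin_comb n Q X i (t *\<^sub>R p))"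
      by (rule order_trans[OF norm_triangle_ineq]) simp
    also have "\<dots> \<le> norm p * (M * (K * (t ^ m * norm p ^ m))) + norm p * (M * (K * (t ^ m * norm p ^ m)))"
      using l abs_coordinate_le_norm[of p] by (intro add_mono mult_mono) auto
    also have "\<dots> = 2 * M * K * norm p ^ Suc m * t ^ m" by (simp add: algebra_simps)
    finally show "norm (fst p *\<^sub>R lin_comb n P X i (t *\<^sub>R p) + snd p *\<^sub>R lin_comb n Q X i (t *\<^sub>R p))
        \<le> 2 * M * K * norm p ^ Suc m * t ^ m" .
  qed
  then show ?thesis by (simp add: field_simps)
qed

lemma step_diff:
  assumes "\<And>j. j < n \<Longrightarrow> continuous_on S (X j)" "\<And>j. j < n \<Longrightarrow> continuous_on S (Y j)"
    and i: "i < n" and p: "p \<in> S"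
  shows "step (\<lambda>j q. X j q - Y j q) i p = step X i p - step Y i p"
proof -
  have l: "lin_comb n R (\<lambda>j q. X j q - Y j q) i q = lin_comb n R X i q - lin_comb n R Y i q" for R q
    by (simp add: lin_comb_def scaleR_diff_right sum_subtractf)
  have cl: "continuous_on S (lin_comb n R Z i)"
    if "R = P \<or> R = Q" "Z = X \<or> Z = Y" for R Z
    using C_k_on_lin_comb[of 0 R i Z] C0 i assms that by auto
  have "(\<lambda>t. fst p *\<^sub>R lin_comb n P Z i (t *\<^sub>R p) + snd p *\<^sub>R lin_comb n Q Z i (t *\<^sub>R p))
      integrable_on {0..1}" if "Z = X \<or> Z = Y" for Z
    by (intro integrable_continuous_interval continuous_intros
        continuous_on_ray_slice[OF S(2,3) _ p] cl) (use that in auto)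
  from integral_diff[OF this[of X] this[of Y]] show ?thesis
    by (simp add: step_def radial_integral_def l algebra_simps)
qed

lemma C_nonneg: "i < n \<Longrightarrow> C \<ge> 0"
  using C[of i] norm_ge_zero order_trans by blast

text \<open>The step operator is linear, so consecutive differences are its iterates applied to the
  first difference; each application contributes 2 M |p| and one more factor of the
  factorial.\<close>

lemma iterate_diff_le:
  assumes "i < n" "p \<in> cball 0 \<rho>"
  shows "norm (iterate (Suc m) i p - iterate m i p) \<le> C * (2 * M) ^ Suc m / fact (Suc m) * norm p ^ Suc m"
  using assms
proof (induction m arbitrary: i p)
  case 0
  have "norm (step (\<lambda>i p. c i) i p) \<le> 2 * M * C / Suc 0 * norm p ^ Suc 0"
    by (rule norm_step_le) (use C C_nonneg 0 in auto)
  then show ?case by (simp add: mult_ac)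
next
  case (Suc m)
  have pS: "p \<in> S" using Suc \<rho> by auto
  have "iterate (Suc (Suc m)) i p - iterate (Suc m) i p
      = step (iterate (Suc m)) i p - step (iterate m) i p" by simp
  also have "\<dots> = step (\<lambda>j q. iterate (Suc m) j q - iterate m j q) i p"
    by (rule step_diff[OF C0_iterate C0_iterate Suc.prems(1) pS, symmetric])
  finally have eq: "iterate (Suc (Suc m)) i p - iterate (Suc m) i p
      = step (\<lambda>j q. iterate (Suc m) j q - iterate m j q) i p" .
  have "norm (step (\<lambda>j q. iterate (Suc m) j q - iterate m j q) i p)
      \<le> 2 * M * (C * (2 * M) ^ Suc m / fact (Suc m)) / Suc (Suc m) * norm p ^ Suc (Suc m)"
  proof (rule norm_step_le)
    show "continuous_on S (\<lambda>q. iterate (Suc m) j q - iterate m j q)" if "j < n" for j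
      by (intro continuous_on_diff C0_iterate that)
    show "0 \<le> C * (2 * M) ^ Suc m / fact (Suc m)"
      using C_nonneg[OF Suc.prems(1)] M(1) by (auto intro!: divide_nonneg_nonneg mult_nonneg_nonneg)
  qed (use Suc in auto)
  also have "2 * M * (C * (2 * M) ^ Suc m / fact (Suc m)) / Suc (Suc m)
      = C * (2 * M) ^ Suc (Suc m) / fact (Suc (Suc m))"
    by (simp add: fact_Suc[of "Suc m"] mult_ac del: fact_Suc)
  finally show ?case unfolding eq .
qed

text \<open>The new u-defect is P applied to the last difference of iterates plus v times the
  residue integral, and similarly for v. The first term is bounded by
  \<open>iterate_diff_le\<close>, the second by both defects of the previous step, so the two bounds
  need a joint induction. The residue integral carries m + 1 earlier contributions of equal size and
  the difference adds one: this is the factor \<open>Suc m\<close>.\<close>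

lemma residue_le:
  assumes "i < n" "p \<in> cball 0 \<rho>"
  shows "norm (partial_u (iterate m i) p - lin_comb n P (iterate m) i p)
      \<le> M * C * Suc m * (2 * M) ^ m / fact m * norm p ^ m"
    and "norm (partial_v (iterate m i) p - lin_comb n Q (iterate m) i p)
      \<le> M * C * Suc m * (2 * M) ^ m / fact m * norm p ^ m"
  using assms
proof (induction m arbitrary: i p)
  case 0
  {
    case 1
    have "norm (lin_comb n P (\<lambda>i p. c i) i p) \<le> M * C"
      unfolding lin_comb_def by (rule norm_sum_scaleR_le) (use 1 M C C_nonneg in auto)
    then show ?case using has_partials_imp[OF has_partials_const[of "c i" p]] by simp
  next
    case 2
    have "norm (lin_comb n Q (\<lambda>i p. c i) i p) \<le> M * C"
      unfolding lin_comb_def by (rule norm_sum_scaleR_le) (use 2 M C C_nonneg in auto)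
    then show ?case using has_partials_imp[OF has_partials_const[of "c i" p]] by simp
  }
next
  case (Suc m)
  define D where "D = M * C * Suc m * (2 * M) ^ m / fact m"
  have main: "norm (lin_comb n R (iterate m) i p - lin_comb n R (iterate (Suc m)) i p)
        + norm p * norm (residue_integral m i p)
      \<le> M * C * Suc (Suc m) * (2 * M) ^ Suc m / fact (Suc m) * norm p ^ Suc m"
    if i: "i < n" and p: "p \<in> cball 0 \<rho>" and R: "R = P \<or> R = Q" for R i p
  proof -
    have pS: "p \<in> S" using p \<rho> by auto
    have C': "C \<ge> 0" using C_nonneg[OF i] .
    have D: "D \<ge> 0" unfolding D_def using C' M(1) by auto
    have "lin_comb n R (iterate m) i p - lin_comb n R (iterate (Suc m)) i p
        = (\<Sum>j<n. R i j p *\<^sub>R (iterate m j p - iterate (Suc m) j p))"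
      unfolding lin_comb_def by (simp only: scaleR_diff_right sum_subtractf)
    also have "norm \<dots> \<le> M * (C * (2 * M) ^ Suc m / fact (Suc m) * norm p ^ Suc m)"
    proof (rule norm_sum_scaleR_le)
      show "(\<Sum>j<n. \<bar>R i j p\<bar>) \<le> M" using M(2,3)[OF i p] R by auto
      show "norm (iterate m j p - iterate (Suc m) j p)
          \<le> C * (2 * M) ^ Suc m / fact (Suc m) * norm p ^ Suc m" if "j < n" for j
        using iterate_diff_le[OF that p, of m] by (simp only: norm_minus_commute)
      show "0 \<le> C * (2 * M) ^ Suc m / fact (Suc m) * norm p ^ Suc m"
        using C' M(1) by auto
    qed
    finally have 1: "norm (lin_comb n R (iterate m) i p - lin_comb n R (iterate (Suc m)) i p)
        \<le> M * (C * (2 * M) ^ Suc m / fact (Suc m) * norm p ^ Suc m)" .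
    have "norm (residue_integral m i p) \<le> (2 * M * D * norm p ^ m) / Suc m"
      unfolding residue_integral_def
    proof (rule norm_integral_le_power)
      show "continuous_on {0..1} (\<lambda>t. t *\<^sub>R residue m i (t *\<^sub>R p))"
        by (intro continuous_intros continuous_on_ray_slice[OF S(2,3) _ pS] continuous_on_residue i)
      fix t :: real assume t: "t \<in> {0..1}"
      have tp: "t *\<^sub>R p \<in> cball 0 \<rho>"
        using t p mult_left_le_one_le[of "norm p" t] by auto
      have nn: "0 \<le> D * norm (t *\<^sub>R p) ^ m" using D by simp
      have "norm (residue m i (t *\<^sub>R p)) \<le> M * (D * norm (t *\<^sub>R p) ^ m) + M * (D * norm (t *\<^sub>R p) ^ m)"
        unfolding residue_def
        by (rule order_trans[OF norm_triangle_ineq4])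
          (rule add_mono[OF norm_sum_scaleR_le[OF M(3)[OF i tp] Suc.IH(1)[OF _ tp, folded D_def] nn]
            norm_sum_scaleR_le[OF M(2)[OF i tp] Suc.IH(2)[OF _ tp, folded D_def] nn]])
      also have "\<dots> = 2 * M * D * norm p ^ m * t ^ m"
        using t by (simp add: power_mult_distrib algebra_simps)
      finally have "norm (residue m i (t *\<^sub>R p)) \<le> 2 * M * D * norm p ^ m * t ^ m" .
      moreover have "t * norm (residue m i (t *\<^sub>R p)) \<le> norm (residue m i (t *\<^sub>R p))"
        using t by (intro mult_left_le_one_le) auto
      ultimately show "norm (t *\<^sub>R residue m i (t *\<^sub>R p)) \<le> 2 * M * D * norm p ^ m * t ^ m"
        using t by simp
    qed
    then have "norm p * norm (residue_integral m i p) \<le> norm p * ((2 * M * D * norm p ^ m) / Suc m)"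
      by (rule mult_left_mono) simp
    also have "\<dots> = M * C * (2 * M) ^ Suc m / fact m * norm p ^ Suc m"
      unfolding D_def by simp
    also have "\<dots> = M * C * Suc m * (2 * M) ^ Suc m / fact (Suc m) * norm p ^ Suc m"
      unfolding fact_Suc by simp
    finally have 2: "norm p * norm (residue_integral m i p)
        \<le> M * C * Suc m * (2 * M) ^ Suc m / fact (Suc m) * norm p ^ Suc m" .
    \<comment> \<open>The count: one new contribution and m + 1 inherited ones make m + 2.\<close>
    have "M * (C * (2 * M) ^ Suc m / fact (Suc m) * norm p ^ Suc m)
        + M * C * Suc m * (2 * M) ^ Suc m / fact (Suc m) * norm p ^ Suc m
        = M * C * Suc (Suc m) * (2 * M) ^ Suc m / fact (Suc m) * norm p ^ Suc m"
      by (simp only: of_nat_Suc) (simp add: field_simps del: fact_Suc)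
    then show ?thesis using 1 2 by linarith
  qed
  have coord: "\<bar>fst p\<bar> * norm (residue_integral m i p) \<le> norm p * norm (residue_integral m i p)"
    "\<bar>snd p\<bar> * norm (residue_integral m i p) \<le> norm p * norm (residue_integral m i p)" for i p
    using abs_coordinate_le_norm[of p] by (auto intro: mult_right_mono)
  {
    case 1
    then have pS: "p \<in> S" using \<rho> by auto
    have "partial_u (iterate (Suc m) i) p - lin_comb n P (iterate (Suc m)) i p
       = (lin_comb n P (iterate m) i p - lin_comb n P (iterate (Suc m)) i p)
         + snd p *\<^sub>R residue_integral m i p"
      unfolding partial_iterate_Suc(1)[OF 1(1) pS] by (simp del: iterate.simps)
    moreover have "norm ((lin_comb n P (iterate m) i p - lin_comb n P (iterate (Suc m)) i p)
         + snd p *\<^sub>R residue_integral m i p)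
      \<le> norm (lin_comb n P (iterate m) i p - lin_comb n P (iterate (Suc m)) i p)
        + norm p * norm (residue_integral m i p)"
      using coord(2)[of p i] by (intro norm_triangle_le add_left_mono) (simp del: iterate.simps)
    ultimately show ?case
      using order_trans[OF _ main[OF 1 disjI1[OF refl]]] by (simp only:)
  next
    case 2
    then have pS: "p \<in> S" using \<rho> by auto
    have "partial_v (iterate (Suc m) i) p - lin_comb n Q (iterate (Suc m)) i p
       = (lin_comb n Q (iterate m) i p - lin_comb n Q (iterate (Suc m)) i p)
         - fst p *\<^sub>R residue_integral m i p"
      unfolding partial_iterate_Suc(2)[OF 2(1) pS] by (simp del: iterate.simps)
    moreover have "norm ((lin_comb n Q (iterate m) i p - lin_comb n Q (iterate (Suc m)) i p)
         - fst p *\<^sub>R residue_integral m i p)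
      \<le> norm (lin_comb n Q (iterate m) i p - lin_comb n Q (iterate (Suc m)) i p)
        + norm p * norm (residue_integral m i p)"
      using coord(1)[of p i] by (intro norm_triangle_le_diff add_left_mono) (simp del: iterate.simps)
    ultimately show ?case
      using order_trans[OF _ main[OF 2 disjI2[OF refl]]] by (simp only:)
  }
qed

end

end

text \<open>Since m + 1 \<le> 2^m, the sequence is dominated by the terms of the exponential series
  at 2 a. This is the decay of the defects.\<close>

lemma Suc_power_over_fact_tendsto_0:
  fixes a :: real
  assumes "a \<ge> 0"
  shows "(\<lambda>m. Suc m * a ^ m / fact m) \<longlonglongrightarrow> 0"
proof (rule tendsto_sandwich[of "\<lambda>_. 0"])
  have "summable (\<lambda>m. (2 * a) ^ m / fact m)"
    using summable_exp[of "2 * a"] by (simp add: divide_inverse mult.commute)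
  then show "(\<lambda>m. (2 * a) ^ m / fact m) \<longlonglongrightarrow> 0" by (rule summable_LIMSEQ_zero)
  have "real (Suc m) * a ^ m / fact m \<le> (2 * a) ^ m / fact m" for m
  proof -
    have "real (Suc m) \<le> 2 ^ m"
      using of_nat_mono[OF Suc_leI[OF less_exp[of m]], where 'a = real] by simp
    then show ?thesis
      using assms by (intro divide_right_mono) (auto simp: power_mult_distrib intro!: mult_right_mono)
  qed
  then show "\<forall>\<^sub>F m in sequentially. Suc m * a ^ m / fact m \<le> (2 * a) ^ m / fact m"
    by simp
qed (use assms in auto)

section \<open>Convergence of the Picard iterates to a solution\<close>

context star_flat_system
begin

definition solution :: "nat \<Rightarrow> real \<times> real \<Rightarrow> 'b" where
  "solution i p = lim (\<lambda>m. iterate m i p)"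

lemma iterate_0: "iterate m i 0 = c i"
  by (induction m) (auto simp: step_def radial_integral_def)

lemma coefficients_bounded:
  assumes "cball 0 \<rho> \<subseteq> S"
  obtains M where "M \<ge> 0"
    "\<And>i p. i < n \<Longrightarrow> p \<in> cball 0 \<rho> \<Longrightarrow> (\<Sum>j<n. \<bar>P i j p\<bar>) \<le> M"
    "\<And>i p. i < n \<Longrightarrow> p \<in> cball 0 \<rho> \<Longrightarrow> (\<Sum>j<n. \<bar>Q i j p\<bar>) \<le> M"
proof -
  \<comment> \<open>One continuous function that dominates every row sum of both matrices, so a
    single compactness argument bounds all of them.\<close>
  define T where "T p = (\<Sum>i<n. (\<Sum>j<n. \<bar>P i j p\<bar>) + (\<Sum>j<n. \<bar>Q i j p\<bar>))" for p
  have "continuous_on (cball 0 \<rho>) T" unfolding T_def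
    by (intro continuous_intros continuous_on_subset[OF C0(1) assms]
        continuous_on_subset[OF C0(2) assms]) auto
  then have "bounded (T ` cball 0 \<rho>)"
    by (intro compact_imp_bounded compact_continuous_image) auto
  then obtain M where M: "M > 0" "\<And>p. p \<in> cball 0 \<rho> \<Longrightarrow> norm (T p) \<le> M"
    unfolding bounded_pos by auto
  have bnd: "(\<Sum>j<n. \<bar>P i j p\<bar>) + (\<Sum>j<n. \<bar>Q i j p\<bar>) \<le> M" if "i < n" "p \<in> cball 0 \<rho>" for i p
  proof -
    have "(\<Sum>j<n. \<bar>P i j p\<bar>) + (\<Sum>j<n. \<bar>Q i j p\<bar>) \<le> T p" unfolding T_def
      using that(1) by (intro member_le_sum) (auto intro!: add_nonneg_nonneg sum_nonneg)
    then show ?thesis using M(2)[OF that(2)] by simp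
  qed
  have nn: "(\<Sum>j<n. \<bar>R i j p\<bar>) \<ge> 0" for R :: "nat \<Rightarrow> nat \<Rightarrow> real \<times> real \<Rightarrow> real" and i p
    by (intro sum_nonneg) simp
  show ?thesis
  proof (rule that[of M])
    fix i and p :: "real \<times> real" assume ip: "i < n" "p \<in> cball 0 \<rho>"
    show "(\<Sum>j<n. \<bar>P i j p\<bar>) \<le> M" using bnd[OF ip] nn[of Q i p] by linarith
    show "(\<Sum>j<n. \<bar>Q i j p\<bar>) \<le> M" using bnd[OF ip] nn[of P i p] by linarith
  qed (use M(1) in simp)
qed

text \<open>The iterates converge uniformly by comparison with an exponential series, and their
  partials converge uniformly to P and Q applied to the limit because the defects vanish. Uniform
  convergence of the derivatives then lets the limit be differentiated.\<close>

lemma has_partials_solution_ball: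
  assumes \<rho>: "\<rho> > 0" "cball 0 \<rho> \<subseteq> S" and i: "i < n" and p: "p \<in> ball 0 \<rho>"
  shows "has_partials (solution i) (lin_comb n P solution i p) (lin_comb n Q solution i p) p"
proof -
  obtain M where M: "M \<ge> 0"
    "\<And>i p. i < n \<Longrightarrow> p \<in> cball 0 \<rho> \<Longrightarrow> (\<Sum>j<n. \<bar>P i j p\<bar>) \<le> M"
    "\<And>i p. i < n \<Longrightarrow> p \<in> cball 0 \<rho> \<Longrightarrow> (\<Sum>j<n. \<bar>Q i j p\<bar>) \<le> M"
    using coefficients_bounded[OF \<rho>(2)] by blast
  define C where "C = (\<Sum>i<n. norm (c i))"
  have C: "norm (c i) \<le> C" if "i < n" for i
    unfolding C_def using that by (intro member_le_sum) auto
  have C0: "C \<ge> 0" unfolding C_def by (intro sum_nonneg) auto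
  define a where "a = 2 * M * \<rho>"
  have a: "a \<ge> 0" using M \<rho> by (simp add: a_def)
  note bounds = \<rho> M C
  have lim: "uniform_limit (cball 0 \<rho>) (\<lambda>m. iterate m j) (solution j) sequentially" if j: "j < n" for j
  proof -
    define d where "d m p = iterate (Suc m) j p - iterate m j p" for m p
    have "norm (d m p) \<le> C * (inverse (fact (Suc m)) * a ^ Suc m)" if "p \<in> cball 0 \<rho>" for m p
    proof -
      have "norm (d m p) \<le> C * (2 * M) ^ Suc m / fact (Suc m) * norm p ^ Suc m"
        unfolding d_def by (rule iterate_diff_le[OF bounds j that])
      also have "\<dots> \<le> C * (2 * M) ^ Suc m / fact (Suc m) * \<rho> ^ Suc m"
        using that C0 M(1) by (intro mult_left_mono power_mono) auto
      finally show ?thesis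
        by (simp add: a_def power_mult_distrib divide_inverse mult_ac del: power_Suc fact_Suc)
    qed
    moreover have "summable (\<lambda>m. C * (inverse (fact (Suc m)) * a ^ Suc m))"
      by (intro summable_mult summable_Suc_iff[THEN iffD2, OF summable_exp])
    ultimately have "uniform_limit (cball 0 \<rho>) (\<lambda>m p. \<Sum>k<m. d k p) (\<lambda>p. suminf (\<lambda>k. d k p)) sequentially"
      by (rule Weierstrass_m_test)
    then have "uniform_limit (cball 0 \<rho>) (\<lambda>m p. c j + (\<Sum>k<m. d k p))
        (\<lambda>p. c j + suminf (\<lambda>k. d k p)) sequentially"
      by (intro uniform_limit_add uniform_limit_const)
    moreover have "c j + (\<Sum>k<m. d k p) = iterate m j p" for m p
      unfolding d_def sum_lessThan_telescope[of "\<lambda>k. iterate k j p"] by simp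
    ultimately have u: "uniform_limit (cball 0 \<rho>) (\<lambda>m. iterate m j)
        (\<lambda>p. c j + suminf (\<lambda>k. d k p)) sequentially" by simp
    then have "c j + suminf (\<lambda>k. d k p) = solution j p" if "p \<in> cball 0 \<rho>" for p
      unfolding solution_def using tendsto_uniform_limitI[OF u that] by (simp add: limI)
    then show ?thesis
      by (intro uniform_limit_cong'[THEN iffD1, OF _ _ u]) auto
  qed
  \<comment> \<open>The distance splits into the defect of the m-th iterate and P or Q applied to
    its distance from the limit; each part gets half of e.\<close>
  have conv: "\<forall>\<^sub>F m in sequentially. \<forall>q\<in>ball 0 \<rho>.
      norm (partial_u (iterate m i) q - lin_comb n P solution i q) \<le> e \<and>
      norm (partial_v (iterate m i) q - lin_comb n Q solution i q) \<le> e" if e: "e > 0" for e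
  proof -
    define b where "b m = M * C * (Suc m * a ^ m / fact m)" for m
    have "b \<longlonglongrightarrow> M * C * 0" unfolding b_def
      by (intro tendsto_mult tendsto_const Suc_power_over_fact_tendsto_0 a)
    then have 1: "\<forall>\<^sub>F m in sequentially. b m < e / 2" using e by (intro order_tendstoD) auto
    \<comment> \<open>The summand 1 keeps the denominator positive when M = 0, and still M e' \<le>
      e / 2.\<close>
    define e' where "e' = e / (2 * (M + 1))"
    have e': "e' > 0" "M * e' \<le> e / 2" using e M(1) by (auto simp: e'_def field_simps)
    have "\<forall>j\<in>{..<n}. \<forall>\<^sub>F m in sequentially. \<forall>q\<in>cball 0 \<rho>. dist (iterate m j q) (solution j q) < e'"
      using lim uniform_limitD[OF _ e'(1)] by blast
    then have 2: "\<forall>\<^sub>F m in sequentially. \<forall>j\<in>{..<n}. \<forall>q\<in>cball 0 \<rho>. dist (iterate m j q) (solution j q) < e'"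
      by (intro eventually_ball_finite) auto
    show ?thesis using 1 2
    proof eventually_elim
      case (elim m)
      show ?case
      proof
        fix q assume "q \<in> ball (0::real \<times> real) \<rho>"
        then have q: "q \<in> cball 0 \<rho>" by auto
        have "M * C * Suc m * (2 * M) ^ m / fact m * norm q ^ m
            \<le> M * C * Suc m * (2 * M) ^ m / fact m * \<rho> ^ m"
          using q M(1) C0 by (intro mult_left_mono power_mono) auto
        also have "\<dots> = b m" by (simp add: b_def a_def power_mult_distrib)
        finally have r: "norm (partial_u (iterate m i) q - lin_comb n P (iterate m) i q) \<le> b m"
            "norm (partial_v (iterate m i) q - lin_comb n Q (iterate m) i q) \<le> b m"
          using residue_le[OF bounds i q, of m] by linarith+
        have l: "norm (lin_comb n R (iterate m) i q - lin_comb n R solution i q) \<le> e / 2"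
          if R: "R = P \<or> R = Q" for R
        proof -
          have "lin_comb n R (iterate m) i q - lin_comb n R solution i q
              = (\<Sum>j<n. R i j q *\<^sub>R (iterate m j q - solution j q))"
            unfolding lin_comb_def by (simp only: scaleR_diff_right sum_subtractf)
          moreover have "norm (\<Sum>j<n. R i j q *\<^sub>R (iterate m j q - solution j q)) \<le> M * e'"
          proof (rule norm_sum_scaleR_le[OF bounds])
            show "(\<Sum>j<n. \<bar>R i j q\<bar>) \<le> M" using M(2,3)[OF i q] R by auto
            show "norm (iterate m j q - solution j q) \<le> e'" if "j < n" for j
              using elim(2) that q by (auto simp: dist_norm less_imp_le)
          qed (use e' in auto)
          ultimately show ?thesis using e'(2) by simp
        qed
        show "norm (partial_u (iterate m i) q - lin_comb n P solution i q) \<le> e \<and>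
            norm (partial_v (iterate m i) q - lin_comb n Q solution i q) \<le> e"
          using r l[of P] l[of Q] elim(1)
            norm_triangle_le[of "partial_u (iterate m i) q - lin_comb n P (iterate m) i q"
              "lin_comb n P (iterate m) i q - lin_comb n P solution i q" e]
            norm_triangle_le[of "partial_v (iterate m i) q - lin_comb n Q (iterate m) i q"
              "lin_comb n Q (iterate m) i q - lin_comb n Q solution i q" e]
          by simp
      qed
    qed
  qed
  have sub: "ball 0 \<rho> \<subseteq> S" using \<rho>(2) by auto
  define f' where "f' m q h = fst h *\<^sub>R partial_u (iterate m i) q + snd h *\<^sub>R partial_v (iterate m i) q" for m q h
  define g' where "g' q h = fst h *\<^sub>R lin_comb n P solution i q + snd h *\<^sub>R lin_comb n Q solution i q" for q h
  \<comment> \<open>Besides the uniform convergence of the derivatives on the convex disc,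
    convergence at a single point suffices; at the centre all iterates have the constant value
    \<open>c i\<close>.\<close>
  have "\<exists>g. \<forall>x\<in>ball 0 \<rho>. (\<lambda>m. iterate m i x) \<longlonglongrightarrow> g x \<and> (g has_derivative g' x) (at x within ball 0 \<rho>)"
  proof (rule has_derivative_sequence[where f' = f' and ?x0.0 = 0])
    fix m and x :: "real \<times> real" assume "x \<in> ball 0 \<rho>"
    then have "x \<in> S" using sub by auto
    from C_k_on_has_partials[OF S(1) C1_iterate[OF i, unfolded One_nat_def] this]
    show "(iterate m i has_derivative f' m x) (at x within ball 0 \<rho>)"
      unfolding has_partials_def f'_def by (rule has_derivative_at_withinI)
  next
    fix e :: real assume e: "e > 0"
    from conv[OF half_gt_zero[OF e]]
    show "\<forall>\<^sub>F m in sequentially. \<forall>x\<in>ball 0 \<rho>. \<forall>h. norm (f' m x h - g' x h) \<le> e * norm h"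
    proof eventually_elim
      case (elim m)
      show ?case
      proof (intro ballI allI)
        fix q h :: "real \<times> real" assume q: "q \<in> ball 0 \<rho>"
        define A where "A = partial_u (iterate m i) q - lin_comb n P solution i q"
        define B where "B = partial_v (iterate m i) q - lin_comb n Q solution i q"
        have AB: "norm A \<le> e / 2" "norm B \<le> e / 2" using elim q by (auto simp: A_def B_def)
        have "f' m q h - g' q h = fst h *\<^sub>R A + snd h *\<^sub>R B"
          by (simp add: f'_def g'_def A_def B_def algebra_simps)
        moreover have "\<bar>fst h\<bar> * norm A \<le> norm h * (e / 2)" "\<bar>snd h\<bar> * norm B \<le> norm h * (e / 2)"
          by (rule mult_mono[OF abs_coordinate_le_norm(1) AB(1)] mult_mono[OF abs_coordinate_le_norm(2) AB(2)]; simp)+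
        then have "norm (fst h *\<^sub>R A + snd h *\<^sub>R B) \<le> norm h * (e / 2) + norm h * (e / 2)"
          unfolding norm_scaleR[symmetric] by (rule norm_triangle_mono)
        ultimately show "norm (f' m q h - g' q h) \<le> e * norm h" by (simp add: mult.commute)
      qed
    qed
  next
    show "(\<lambda>m. iterate m i 0) \<longlonglongrightarrow> c i" by (simp add: iterate_0)
  qed (use \<rho> in auto)
  then obtain g where g: "\<And>x. x \<in> ball 0 \<rho> \<Longrightarrow> (\<lambda>m. iterate m i x) \<longlonglongrightarrow> g x"
      "\<And>x. x \<in> ball 0 \<rho> \<Longrightarrow> (g has_derivative g' x) (at x within ball 0 \<rho>)" by blast
  have eq: "g x = solution i x" if "x \<in> ball 0 \<rho>" for x
    using limI[OF g(1)[OF that]] by (simp add: solution_def)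
  have "has_partials g (lin_comb n P solution i p) (lin_comb n Q solution i p) p"
    using g(2)[OF p] unfolding has_partials_def g'_def at_within_open[OF p open_ball] .
  from has_partials_cong[OF this open_ball p eq] show ?thesis .
qed

lemma solves_system_solution: "solves_system n S P Q solution"
  unfolding solves_system_def using exhaust has_partials_solution_ball by meson

lemma solution_0: "solution i 0 = c i"
  by (simp add: solution_def iterate_0 limI)

end

lemma star_flat_system_solvable:
  fixes c :: "nat \<Rightarrow> 'b::euclidean_space"
  assumes "S = ball 0 1 \<or> S = UNIV" "flat_system n S P Q"
  shows "\<exists>X. solves_system n S P Q X \<and> (\<forall>i<n. X i 0 = c i)"
proof -
  have "\<exists>\<rho>>0. p \<in> ball 0 \<rho> \<and> cball 0 \<rho> \<subseteq> S" if p: "p \<in> S" for p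
  \<comment> \<open>In the unit disc the radius is halfway between |p| and 1; in the plane any
    radius larger than |p| serves.\<close>
  proof (intro exI[of _ "if S = UNIV then norm p + 1 else (norm p + 1) / 2"] conjI)
    show "0 < (if S = UNIV then norm p + 1 else (norm p + 1) / 2)"
      using norm_ge_zero[of p] by (simp del: norm_ge_zero)
  qed (use assms(1) p in \<open>auto simp: field_simps split: if_splits\<close>)
  then interpret star_flat_system n S P Q c
    using assms by unfold_locales auto
  show ?thesis using solves_system_solution solution_0 by blast
qed

section \<open>Flat linear systems on a simply connected domain\<close>

abbreviation "to_complex \<equiv> \<lambda>p :: real \<times> real. Complex (fst p) (snd p)"
abbreviation "from_complex \<equiv> \<lambda>z. (Re z, Im z)"

lemma bounded_linear_to_complex: "bounded_linear to_complex"
proof (rule bounded_linearI')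
qed (auto simp: complex_eq_iff)

lemma continuous_on_to_complex [continuous_intros]: "continuous_on S to_complex"
  by (rule bounded_linear.continuous_on[OF bounded_linear_to_complex continuous_on_id, simplified])

lemma has_partials_compose:
  assumes "has_partials f a b (g p, h p)" "has_partials g gu gv p" "has_partials h hu hv p"
  shows "has_partials (\<lambda>q. f (g q, h q)) (gu *\<^sub>R a + hu *\<^sub>R b) (gv *\<^sub>R a + hv *\<^sub>R b) p"
proof -
  have "((\<lambda>q. (g q, h q)) has_derivative (\<lambda>x. (fst x *\<^sub>R gu + snd x *\<^sub>R gv, fst x *\<^sub>R hu + snd x *\<^sub>R hv))) (at p)"
    using assms(2,3) unfolding has_partials_def by (intro has_derivative_Pair)
  from has_derivative_compose[OF this assms(1)[unfolded has_partials_def]]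
  show ?thesis unfolding has_partials_def by (simp add: algebra_simps)
qed

lemma has_partials_complex:
  assumes "(f has_field_derivative d) (at (to_complex p))"
  shows "has_partials (\<lambda>q. Re (f (to_complex q))) (Re d) (- Im d) p"
    and "has_partials (\<lambda>q. Im (f (to_complex q))) (Im d) (Re d) p"
proof -
  have "(to_complex has_derivative to_complex) (at p)"
    by (rule bounded_linear_imp_has_derivative[OF bounded_linear_to_complex])
  from has_derivative_compose[OF this assms[unfolded has_field_derivative_def]]
  have D: "((\<lambda>q. f (to_complex q)) has_derivative (\<lambda>h. d * to_complex h)) (at p)" by simp
  show "has_partials (\<lambda>q. Re (f (to_complex q))) (Re d) (- Im d) p"
    "has_partials (\<lambda>q. Im (f (to_complex q))) (Im d) (Re d) p"
    unfolding has_partials_def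
    using has_derivative_Re[OF D] has_derivative_Im[OF D]
    by (simp_all add: algebra_simps)
qed

lemma lin_comb_combination:
  assumes "\<And>j. j < n \<Longrightarrow> R i j p = a * P i j q + b * Q i j q" "\<And>j. j < n \<Longrightarrow> X j p = Y j q"
  shows "lin_comb n R X i p = a *\<^sub>R lin_comb n P Y i q + b *\<^sub>R lin_comb n Q Y i q"
  unfolding lin_comb_def using assms
  by (simp add: scaleR_add_left sum.distrib scaleR_sum_right)

text \<open>Pulling a flat system back along a holomorphic map \<open>g\<close> with \<open>g' = a + i b\<close> gives
  the one-form \<open>(a P + b Q) du + (- b P + a Q) dv\<close>, which is flat by the Cauchy-Riemann equations.\<close>

lemma flat_system_pullback:
  assumes D: "open D" and flat: "flat_system n D P Q"
    and g: "g holomorphic_on ball 0 1" "\<And>z. z \<in> ball 0 1 \<Longrightarrow> from_complex (g z) \<in> D"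
  defines "G \<equiv> \<lambda>p. from_complex (g (to_complex p))"
    and "a \<equiv> \<lambda>p. Re (deriv g (to_complex p))" and "b \<equiv> \<lambda>p. Im (deriv g (to_complex p))"
  shows "flat_system n (ball 0 1) (\<lambda>i j p. a p * P i j (G p) + b p * Q i j (G p))
    (\<lambda>i j p. - b p * P i j (G p) + a p * Q i j (G p))"
proof -
  let ?B = "ball 0 1 :: (real \<times> real) set"
  have mem: "to_complex p \<in> ball 0 1" if "p \<in> ?B" for p
    using that by (cases p) (simp add: cmod_def norm_Pair)
  have GD: "G p \<in> D" if "p \<in> ?B" for p
    unfolding G_def using g(2)[OF mem[OF that]] .
  have dg: "deriv g holomorphic_on ball 0 1" and ddg: "deriv (deriv g) holomorphic_on ball 0 1"
    using g(1) by (auto intro!: holomorphic_deriv)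
  have der: "(h has_field_derivative deriv h z) (at z)" if "h holomorphic_on ball 0 1" "z \<in> ball 0 1" for h z
    using holomorphic_derivI[OF that(1) open_ball that(2)] .
  \<comment> \<open>Real and imaginary part of g''. By the Cauchy-Riemann equations for g' they
    supply all four partials of a and b.\<close>
  define a1 where "a1 p = Re (deriv (deriv g) (to_complex p))" for p
  define b1 where "b1 p = Im (deriv (deriv g) (to_complex p))" for p
  have ab: "has_partials a (a1 p) (- b1 p) p" "has_partials b (b1 p) (a1 p) p" if "p \<in> ?B" for p
    using has_partials_complex[OF der[OF dg mem[OF that]]]
    by (simp_all add: a_def b_def a1_def b1_def)
  have G: "has_partials (\<lambda>p. fst (G p)) (a p) (- b p) p" "has_partials (\<lambda>p. snd (G p)) (b p) (a p) p"
    if "p \<in> ?B" for p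
    using has_partials_complex[OF der[OF g(1) mem[OF that]]]
    by (simp_all add: a_def b_def G_def)
  have cont1: "continuous_on ?B a1" "continuous_on ?B b1"
    unfolding a1_def b1_def using mem
    by (intro continuous_intros continuous_on_compose2[OF holomorphic_on_imp_continuous_on[OF ddg]]; auto)+
  have contab: "continuous_on ?B a" "continuous_on ?B b"
    by (rule has_partials_continuous_on[OF ab(1)], assumption)
      (rule has_partials_continuous_on[OF ab(2)], assumption)
  have contG: "continuous_on ?B G"
  proof -
    have "continuous_on ?B (\<lambda>p. (fst (G p), snd (G p)))"
      using has_partials_continuous_on[OF G(1)] has_partials_continuous_on[OF G(2)]
      by (intro continuous_on_Pair)
    then show ?thesis by simp
  qed
  have comp: "has_partials (\<lambda>p. f (G p)) (a p * partial_u f (G p) + b p * partial_v f (G p))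
      (- b p * partial_u f (G p) + a p * partial_v f (G p)) p"
    if "C_k_on 1 D f" "p \<in> ?B" for f :: "real \<times> real \<Rightarrow> real" and p
  proof -
    have "has_partials f (partial_u f (G p)) (partial_v f (G p)) (fst (G p), snd (G p))"
      using C_k_on_has_partials[OF D that(1)[unfolded One_nat_def] GD[OF that(2)]] by simp
    from has_partials_compose[OF this G[OF that(2)]] show ?thesis by simp
  qed
  have contcomp: "continuous_on ?B (\<lambda>p. f (G p))" if "continuous_on D f" for f :: "real \<times> real \<Rightarrow> real"
    using GD by (intro continuous_on_compose2[OF that contG] image_subsetI)
  have C1: "C_k_on 1 ?B (\<lambda>p. f (G p))" if f: "C_k_on 1 D f" for f :: "real \<times> real \<Rightarrow> real"
    unfolding One_nat_def
    by (rule C_k_on_SucI[OF open_ball comp[OF f]])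
       (use f in \<open>auto simp: One_nat_def intro!: continuous_intros contab contcomp\<close>)
  have C1ab: "C_k_on 1 ?B a" "C_k_on 1 ?B b"
    unfolding One_nat_def
    by (rule C_k_on_SucI[OF open_ball ab(1)] C_k_on_SucI[OF open_ball ab(2)];
        simp add: cont1 continuous_on_minus)+
  have C1nb: "C_k_on 1 ?B (\<lambda>p. - b p)"
    using C_k_on_bilinear[OF open_ball bounded_bilinear_mult C_k_on_const[OF open_ball, where c = "-1"] C1ab(2)]
    by simp
  have PQ: "C_k_on 1 D (P i j)" "C_k_on 1 D (Q i j)" if "i < n" "j < n" for i j
    using flat that by (auto simp: flat_system_def)
  show ?thesis unfolding flat_system_def
  proof (intro conjI allI impI ballI)
    fix i j assume ij: "i < n" "j < n"
    show "C_k_on 1 ?B (\<lambda>p. a p * P i j (G p) + b p * Q i j (G p))"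
      "C_k_on 1 ?B (\<lambda>p. - b p * P i j (G p) + a p * Q i j (G p))"
      by (intro C_k_on_add C_k_on_bilinear[OF _ bounded_bilinear_mult] open_ball C1ab C1nb C1 PQ ij)+
  next
    fix i k p assume i: "i < n" and k: "k < n" and p: "p \<in> ?B"
    define Pu where "Pu = partial_u (P i k) (G p)"
    define Pv where "Pv = partial_v (P i k) (G p)"
    define Qu where "Qu = partial_u (Q i k) (G p)"
    define Qv where "Qv = partial_v (Q i k) (G p)"
    note cP = comp[OF PQ(1)[OF i k] p, folded Pu_def Pv_def]
    note cQ = comp[OF PQ(2)[OF i k] p, folded Qu_def Qv_def]
    have 1: "partial_v (\<lambda>p. a p * P i k (G p) + b p * Q i k (G p)) p
        = (- b1 p * P i k (G p) + a p * (- b p * Pu + a p * Pv)) + (a1 p * Q i k (G p) + b p * (- b p * Qu + a p * Qv))"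
      by (rule has_partials_imp(2)[OF has_partials_add[OF has_partials_mult[OF ab(1)[OF p] cP]
            has_partials_mult[OF ab(2)[OF p] cQ]]])
    have 2: "partial_u (\<lambda>p. - b p * P i k (G p) + a p * Q i k (G p)) p
        = (- b1 p * P i k (G p) + - b p * (a p * Pu + b p * Pv)) + (a1 p * Q i k (G p) + a p * (a p * Qu + b p * Qv))"
      by (rule has_partials_imp(1)[OF has_partials_add[OF has_partials_mult[OF has_partials_minus[OF ab(2)[OF p]] cP]
            has_partials_mult[OF ab(1)[OF p] cQ]]])
    define S where "S M N = (\<Sum>j<n. M i j (G p) * N j k (G p))" for M N :: "nat \<Rightarrow> nat \<Rightarrow> real \<times> real \<Rightarrow> real"
    have fl: "Pv + S P Q = Qu + S Q P"
      using flat i k GD[OF p] by (auto simp: flat_system_def S_def Pv_def Qu_def)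
    have S1: "(\<Sum>j<n. (a p * P i j (G p) + b p * Q i j (G p)) * (- b p * P j k (G p) + a p * Q j k (G p)))
        = - a p * b p * S P P + (a p)\<^sup>2 * S P Q - (b p)\<^sup>2 * S Q P + a p * b p * S Q Q"
      unfolding S_def sum_distrib_left sum.distrib[symmetric] sum_subtractf[symmetric]
      by (intro sum.cong) (auto simp: algebra_simps power2_eq_square)
    have S2: "(\<Sum>j<n. (- b p * P i j (G p) + a p * Q i j (G p)) * (a p * P j k (G p) + b p * Q j k (G p)))
        = - a p * b p * S P P - (b p)\<^sup>2 * S P Q + (a p)\<^sup>2 * S Q P + a p * b p * S Q Q"
      unfolding S_def sum_distrib_left sum.distrib[symmetric] sum_subtractf[symmetric]
      by (intro sum.cong) (auto simp: algebra_simps power2_eq_square)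
    \<comment> \<open>The curvature of the pulled-back form is |g'|^2 times that of the original
      one: the terms with g'' agree on both sides, and so do those with \<open>Pu\<close>,
      \<open>Qv\<close>, P P and Q Q.\<close>
    have "((a p)\<^sup>2 + (b p)\<^sup>2) * (Pv + S P Q) = ((a p)\<^sup>2 + (b p)\<^sup>2) * (Qu + S Q P)"
      using fl by simp
    then show "partial_v (\<lambda>p. a p * P i k (G p) + b p * Q i k (G p)) p
        + (\<Sum>j<n. (a p * P i j (G p) + b p * Q i j (G p)) * (- b p * P j k (G p) + a p * Q j k (G p)))
      = partial_u (\<lambda>p. - b p * P i k (G p) + a p * Q i k (G p)) p
        + (\<Sum>j<n. (- b p * P i j (G p) + a p * Q i j (G p)) * (a p * P j k (G p) + b p * Q j k (G p)))"
      unfolding 1 2 S1 S2 by (simp add: algebra_simps power2_eq_square)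
  qed
qed

text \<open>The base point is found rather than prescribed: it is the image of the centre of the
  disc, or the origin if the domain is the plane. One point with given initial values is all that
  the orthonormality argument asks for.\<close>

theorem flat_system_solvable:
  fixes c :: "nat \<Rightarrow> 'b::euclidean_space"
  assumes D: "open D" "connected D" "simply_connected D" "D \<noteq> {}" and flat: "flat_system n D P Q"
  shows "\<exists>X. \<exists>p\<in>D. solves_system n D P Q X \<and> (\<forall>i<n. X i p = c i)"
proof -
  define S where "S = to_complex ` D"
  have "homeomorphism D S to_complex from_complex"
    unfolding S_def homeomorphism_def
    by (auto intro!: continuous_intros simp: image_iff) (metis fst_conv snd_conv)
  then have "D homeomorphic S" by (auto simp: homeomorphic_def)
  then have sc: "simply_connected S"
    using D(3) homeomorphic_simply_connected_eq by blast
  have S_eq: "S = from_complex -` D" by (auto simp: S_def image_iff complex_eq_iff) (metis fst_conv snd_conv)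
  have "open S" unfolding S_eq by (intro open_vimage D continuous_intros)
  with sc have "open S \<and> simply_connected S" by simp
  then consider "S = {}" | "S = UNIV"
    | f g where "f holomorphic_on S" "g holomorphic_on ball 0 1"
      "\<forall>z\<in>S. f z \<in> ball 0 1 \<and> g (f z) = z" "\<forall>z\<in>ball 0 1. g z \<in> S \<and> f (g z) = z"
    unfolding Riemann_mapping_theorem by blast
  then show ?thesis
  proof cases
    case 1
    then show ?thesis using D(4) by (simp add: S_def)
  next
    case 2
    have "p \<in> D" for p
    proof -
      have "to_complex p \<in> S" using 2 by simp
      then show ?thesis by (simp add: S_eq)
    qed
    then have "D = UNIV" by auto
    moreover obtain X where "solves_system n D P Q X" "\<forall>i<n. X i 0 = c i"
      using star_flat_system_solvable[of D n P Q c] flat calculation by blast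
    ultimately show ?thesis by (intro exI[of _ X] bexI[of _ 0]) auto
  next
    case (3 f g)
    let ?B = "ball 0 1 :: (real \<times> real) set"
    define G where "G p = from_complex (g (to_complex p))" for p
    define F where "F p = from_complex (f (to_complex p))" for p
    define a where "a p = Re (deriv g (to_complex p))" for p
    define b where "b p = Im (deriv g (to_complex p))" for p
    define P' where "P' i j p = a p * P i j (G p) + b p * Q i j (G p)" for i j p
    define Q' where "Q' i j p = - b p * P i j (G p) + a p * Q i j (G p)" for i j p
    have "flat_system n ?B P' Q'"
      using flat_system_pullback[OF D(1) flat 3(2)] 3(4)
      by (simp add: P'_def[abs_def] Q'_def[abs_def] a_def b_def G_def S_eq)
    then obtain X where X: "solves_system n ?B P' Q' X" "\<And>i. i < n \<Longrightarrow> X i 0 = c i"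
      using star_flat_system_solvable[of ?B n P' Q' c] by auto
    have FB: "F p \<in> ?B" "G (F p) = p" if "p \<in> D" for p
    proof -
      have "to_complex p \<in> S" using that by (simp add: S_def)
      then have "f (to_complex p) \<in> ball 0 1" "g (f (to_complex p)) = to_complex p" using 3(3) by auto
      then show "F p \<in> ?B" "G (F p) = p"
        by (auto simp: F_def G_def cmod_def norm_Pair)
    qed
    have GD: "G p \<in> D" "F (G p) = p" if "p \<in> ?B" for p
    proof -
      have "to_complex p \<in> ball 0 1" using that by (cases p) (simp add: cmod_def norm_Pair)
      then have "g (to_complex p) \<in> S" "f (g (to_complex p)) = to_complex p" using 3(4) by auto
      then show "G p \<in> D" "F (G p) = p" by (auto simp: F_def G_def S_eq)
    qed
    have sol: "solves_system n D P Q (\<lambda>i p. X i (F p))"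
      unfolding solves_system_def
    proof (intro allI impI ballI)
      fix i p assume i: "i < n" and p: "p \<in> D"
      have pS: "to_complex p \<in> S" using p by (simp add: S_def)
      define d where "d = deriv f (to_complex p)"
      have f: "(f has_field_derivative d) (at (to_complex p))"
        unfolding d_def using holomorphic_derivI[OF 3(1) \<open>open S\<close> pS] .
      have g: "(g has_field_derivative deriv g (f (to_complex p))) (at (f (to_complex p)))"
        using holomorphic_derivI[OF 3(2) open_ball] 3(3) pS by blast
      \<comment> \<open>Differentiating g(f(z)) = z gives g'(f) f' = 1. These two real relations
        undo the factor g' in \<open>P'\<close> and \<open>Q'\<close>, so that composing with F
        returns to the original system.\<close>
      have "((\<lambda>z. g (f z)) has_field_derivative deriv g (f (to_complex p)) * d) (at (to_complex p))"
        by (rule DERIV_chain2[OF g f])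
      then have "((\<lambda>z. z) has_field_derivative deriv g (f (to_complex p)) * d) (at (to_complex p))"
        by (rule has_field_derivative_transform_within_open[OF _ \<open>open S\<close> pS]) (use 3(3) in auto)
      then have "deriv g (f (to_complex p)) * d = 1"
        using DERIV_unique DERIV_ident by blast
      then have gd: "a (F p) * Re d - b (F p) * Im d = 1" "a (F p) * Im d + b (F p) * Re d = 0"
        by (auto simp: complex_eq_iff a_def b_def F_def)
      have "has_partials (X i) (lin_comb n P' X i (F p)) (lin_comb n Q' X i (F p)) (Re (f (to_complex p)), Im (f (to_complex p)))"
        using X(1) i FB(1)[OF p] by (auto simp: solves_system_def F_def)
      from has_partials_compose[OF this has_partials_complex[OF f]]
      have 1: "has_partials (\<lambda>p. X i (F p))
          (Re d *\<^sub>R lin_comb n P' X i (F p) + Im d *\<^sub>R lin_comb n Q' X i (F p))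
          (- Im d *\<^sub>R lin_comb n P' X i (F p) + Re d *\<^sub>R lin_comb n Q' X i (F p)) p"
        by (simp add: F_def)
      define Y where "Y = (\<lambda>j p. X j (F p))"
      have P': "lin_comb n P' X i (F p) = a (F p) *\<^sub>R lin_comb n P Y i p + b (F p) *\<^sub>R lin_comb n Q Y i p"
        by (rule lin_comb_combination) (simp_all add: P'_def Y_def FB[OF p])
      have Q': "lin_comb n Q' X i (F p) = - b (F p) *\<^sub>R lin_comb n P Y i p + a (F p) *\<^sub>R lin_comb n Q Y i p"
        by (rule lin_comb_combination) (simp_all add: Q'_def Y_def FB[OF p])
      have "Re d *\<^sub>R lin_comb n P' X i (F p) + Im d *\<^sub>R lin_comb n Q' X i (F p)
          = (a (F p) * Re d - b (F p) * Im d) *\<^sub>R lin_comb n P Y i p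
            + (a (F p) * Im d + b (F p) * Re d) *\<^sub>R lin_comb n Q Y i p"
        unfolding P' Q' by (simp add: algebra_simps)
      moreover have "- Im d *\<^sub>R lin_comb n P' X i (F p) + Re d *\<^sub>R lin_comb n Q' X i (F p)
          = - (a (F p) * Im d + b (F p) * Re d) *\<^sub>R lin_comb n P Y i p
            + (a (F p) * Re d - b (F p) * Im d) *\<^sub>R lin_comb n Q Y i p"
        unfolding P' Q' by (simp add: algebra_simps)
      ultimately show "has_partials (\<lambda>p. X i (F p)) (lin_comb n P (\<lambda>i p. X i (F p)) i p)
          (lin_comb n Q (\<lambda>i p. X i (F p)) i p) p"
        using 1 unfolding gd Y_def by simp
    qed
    have "X i (F (G 0)) = c i" if "i < n" for i
      using X(2)[OF that] GD(2)[of 0] by simp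
    with sol show ?thesis using GD(1)[of 0] by (intro exI[of _ "\<lambda>i p. X i (F p)"] bexI[of _ "G 0"]) auto
  qed
qed

section \<open>Orthonormal frames of the pseudo-Euclidean space\<close>

lemma has_partials_eq_rhs:
  "has_partials f a b p \<Longrightarrow> a = c \<Longrightarrow> b = d \<Longrightarrow> has_partials f c d p"
  by simp

lemma ip_sym: "ip a b = ip b a"
  by (simp add: ip_def mult.commute)

lemma bounded_bilinear_ip: "bounded_bilinear ip"
proof -
  have "bilinear ip" unfolding bilinear_def
    by (auto intro!: linearI simp: ip_def algebra_simps)
  then show ?thesis by (simp add: bilinear_conv_bounded_bilinear)
qed

interpretation ip: bounded_bilinear ip by (rule bounded_bilinear_ip)

lemmas ip_simps = ip.add_left ip.add_right ip.diff_left ip.diff_right ip.minus_left ip.minus_right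
  ip.scaleR_left ip.scaleR_right ip.zero_left ip.zero_right

lemmas has_partials_ip = has_partials_bilinear[OF bounded_bilinear_ip]
lemmas smooth_on_ip = smooth_on_bilinear[OF bounded_bilinear_ip]

definition orthonormal_basis4 :: "real \<Rightarrow> real^4 \<Rightarrow> real^4 \<Rightarrow> real^4 \<Rightarrow> real^4 \<Rightarrow> bool" where
  "orthonormal_basis4 e x y n m \<longleftrightarrow> e \<in> {1, - 1} \<and>
     ip x x = 1 \<and> ip y y = - 1 \<and> ip n n = e \<and> ip m m = - e \<and>
     ip x y = 0 \<and> ip x n = 0 \<and> ip x m = 0 \<and> ip y n = 0 \<and> ip y m = 0 \<and> ip n m = 0"

lemma orthonormal_basis4_ip:
  assumes "orthonormal_basis4 e x y n m"
  shows "e * e = 1" "ip x x = 1" "ip y y = - 1" "ip n n = e" "ip m m = - e"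
    "ip x y = 0" "ip x n = 0" "ip x m = 0" "ip y n = 0" "ip y m = 0" "ip n m = 0"
    "ip y x = 0" "ip n x = 0" "ip m x = 0" "ip n y = 0" "ip m y = 0" "ip m n = 0"
  using assms by (auto simp: orthonormal_basis4_def ip_sym[of y x] ip_sym[of n x] ip_sym[of m x]
      ip_sym[of n y] ip_sym[of m y] ip_sym[of m n])

text \<open>The linear map that carries the first frame to the second. The coefficients are the
  metric-dual coordinates, with signs 1, -1, e, -e from the squares of x, y, n, m. For two equal
  frames it is the expansion of w in the frame.\<close>

definition frame_transport ::
    "real \<Rightarrow> real^4 \<Rightarrow> real^4 \<Rightarrow> real^4 \<Rightarrow> real^4 \<Rightarrow> real^4 \<Rightarrow> real^4 \<Rightarrow> real^4 \<Rightarrow> real^4 \<Rightarrow> real^4 \<Rightarrow> real^4" where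
  "frame_transport e x y n m x' y' n' m' w =
     ip w x *\<^sub>R x' - ip w y *\<^sub>R y' + (e * ip w n) *\<^sub>R n' - (e * ip w m) *\<^sub>R m'"

definition frame_comb :: "real^4 \<Rightarrow> real^4 \<Rightarrow> real^4 \<Rightarrow> real^4 \<Rightarrow> real^4 \<Rightarrow> real^4" where
  "frame_comb x y n m c = c$1 *\<^sub>R x + c$2 *\<^sub>R y + c$3 *\<^sub>R n + c$4 *\<^sub>R m"

lemma linear_frame_comb: "linear (frame_comb x y n m)"
  by (intro linearI) (auto simp: frame_comb_def algebra_simps)

text \<open>Pairing with the frame recovers the four coefficients of a combination, so
  \<open>frame_comb\<close> is injective, hence surjective on a space of the same dimension; every w
  is then a combination with the expected coefficients.\<close>

lemma orthonormal_basis4_expand: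
  assumes "orthonormal_basis4 e x y n m"
  shows "frame_transport e x y n m x y n m w = w"
proof -
  note ips = orthonormal_basis4_ip[OF assms]
  let ?T = "frame_comb x y n m"
  have T: "ip (?T c) x = c$1" "ip (?T c) y = - c$2" "e * ip (?T c) n = c$3" "e * ip (?T c) m = - c$4" for c
    using ips(1) by (simp_all add: frame_comb_def ip_simps ips)
  have "inj ?T"
  proof (rule injI)
    fix c d assume eq: "?T c = ?T d"
    have "c$1 = d$1 \<and> c$2 = d$2 \<and> c$3 = d$3 \<and> c$4 = d$4"
      using T[of c] T[of d] unfolding eq by simp
    then show "c = d" by (simp add: vec_eq_iff forall_4)
  qed
  then have "surj ?T" by (rule linear_injective_imp_surjective[OF linear_frame_comb _ refl])
  then obtain c where c: "w = ?T c" by (metis surjD)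
  have "frame_transport e x y n m x y n m (?T c) = ?T c"
    unfolding frame_transport_def T by (simp add: frame_comb_def)
  then show ?thesis using c by simp
qed

text \<open>The expansion makes \<open>frame_comb\<close> surjective, hence bijective with inverse
  the coordinate map; the coordinates of the frame vectors themselves are then unit vectors, which
  are the orthonormality relations. This converse turns a constant expansion operator into
  orthonormality along a whole solution.\<close>

lemma orthonormal_basis4_if_expand:
  assumes e: "e \<in> {1, - 1}" and ex: "\<And>w. frame_transport e x y n m x y n m w = w"
  shows "orthonormal_basis4 e x y n m"
proof -
  let ?T = "frame_comb x y n m"
  define c where "c w = ((\<chi> i. if i = 1 then ip w x else if i = 2 then - ip w y
      else if i = 3 then e * ip w n else - (e * ip w m)) :: real^4)" for w
  have Tc: "?T (c w) = w" for w
    using ex[of w] by (simp add: frame_comb_def c_def frame_transport_def)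
  then have "surj ?T" by (metis surjI)
  then have "inj ?T" by (rule linear_surjective_imp_injective[OF linear_frame_comb _ refl])
  then have cT: "c (?T d) = d" for d using Tc[of "?T d"] by (simp add: inj_eq)
  have T: "?T (axis 1 1) = x" "?T (axis 2 1) = y" "?T (axis 3 1) = n" "?T (axis 4 1) = m"
    by (simp_all add: frame_comb_def axis_def)
  show ?thesis
    using cT[of "axis 1 1"] cT[of "axis 2 1"] cT[of "axis 3 1"] cT[of "axis 4 1"] e unfolding T
    by (auto simp: orthonormal_basis4_def vec_eq_iff forall_4 c_def axis_def ip_sym)
qed

lemma ip_frame_transport:
  assumes b: "orthonormal_basis4 e x y n m" and b': "orthonormal_basis4 e x' y' n' m'"
  shows "ip (frame_transport e x y n m x' y' n' m' v) (frame_transport e x y n m x' y' n' m' w) = ip v w"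
proof -
  have *: "ip (frame_transport e x y n m X Y N M v) (frame_transport e x y n m X Y N M w)
    = ip v x * ip w x - ip v y * ip w y + e * (ip v n * ip w n) - e * (ip v m * ip w m)"
    if "orthonormal_basis4 e X Y N M" for X Y N M
    using orthonormal_basis4_ip[OF that] that
    by (auto simp: frame_transport_def ip_simps orthonormal_basis4_def algebra_simps)
  show ?thesis using *[OF b'] *[OF b] by (simp add: orthonormal_basis4_expand[OF b])
qed

lemma frame_transport_basis:
  assumes "orthonormal_basis4 e x y n m"
  shows "frame_transport e x y n m x' y' n' m' x = x'" "frame_transport e x y n m x' y' n' m' y = y'"
    "frame_transport e x y n m x' y' n' m' n = n'" "frame_transport e x y n m x' y' n' m' m = m'"
  using orthonormal_basis4_ip[OF assms] by (simp_all add: frame_transport_def)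

lemma linear_frame_transport: "linear (frame_transport e x y n m x' y' n' m')"
  by (intro linearI) (auto simp: frame_transport_def ip_simps algebra_simps)

section \<open>Moving frames in isothermal parameters\<close>

text \<open>Here \<open>f\<^sup>2\<close> is the conformal factor, \<open>p\<close> and \<open>q\<close> are the logarithmic derivatives of \<open>f\<close>,
  and \<open>\<alpha> = f \<nu>\<close>, \<open>\<beta> = f \<mu>\<close> in the notation of geometric frames; \<open>b\<close> and \<open>c\<close> are the
  coefficients of the normal connection.\<close>

definition moving_frame where
  "moving_frame D e f p q \<alpha> \<beta> b c z x y n m \<longleftrightarrow> (\<forall>r\<in>D.
     has_partials z (f r *\<^sub>R x r) (f r *\<^sub>R y r) r \<and>
     has_partials x (q r *\<^sub>R y r + \<alpha> r *\<^sub>R n r) (p r *\<^sub>R y r + \<beta> r *\<^sub>R m r) r \<and>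
     has_partials y (q r *\<^sub>R x r + \<beta> r *\<^sub>R m r) (p r *\<^sub>R x r + \<alpha> r *\<^sub>R n r) r \<and>
     has_partials n (- (e * \<alpha> r) *\<^sub>R x r + b r *\<^sub>R m r) ((e * \<alpha> r) *\<^sub>R y r + c r *\<^sub>R m r) r \<and>
     has_partials m (- (e * \<beta> r) *\<^sub>R y r + b r *\<^sub>R n r) ((e * \<beta> r) *\<^sub>R x r + c r *\<^sub>R n r) r)"
  for z x y n m :: "real \<times> real \<Rightarrow> real^4" and f p q \<alpha> \<beta> b c :: "real \<times> real \<Rightarrow> real"

lemma moving_frame_partials:
  assumes "moving_frame D e f p q \<alpha> \<beta> b c z x y n m" "r \<in> D"
  shows "has_partials z (f r *\<^sub>R x r) (f r *\<^sub>R y r) r"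
    "has_partials x (q r *\<^sub>R y r + \<alpha> r *\<^sub>R n r) (p r *\<^sub>R y r + \<beta> r *\<^sub>R m r) r"
    "has_partials y (q r *\<^sub>R x r + \<beta> r *\<^sub>R m r) (p r *\<^sub>R x r + \<alpha> r *\<^sub>R n r) r"
    "has_partials n (- (e * \<alpha> r) *\<^sub>R x r + b r *\<^sub>R m r) ((e * \<alpha> r) *\<^sub>R y r + c r *\<^sub>R m r) r"
    "has_partials m (- (e * \<beta> r) *\<^sub>R y r + b r *\<^sub>R n r) ((e * \<beta> r) *\<^sub>R x r + c r *\<^sub>R n r) r"
  using assms by (auto simp: moving_frame_def)

text \<open>The coefficient matrices of the frame equations are skew with respect to the signs 1,
  -1, e, -e, so the derivatives of the two frames cancel. Orthonormality is not assumed: the lemma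
  serves both to propagate it, with one frame taken twice, and to compare two orthonormal
  solutions.\<close>

lemma has_partials_frame_transport:
  assumes e: "e * e = 1"
    and F: "moving_frame D e f p q \<alpha> \<beta> b c z x y n m"
    and F': "moving_frame D e f' p q \<alpha> \<beta> b c z' x' y' n' m'" and r: "r \<in> D"
  shows "has_partials (\<lambda>s. frame_transport e (x s) (y s) (n s) (m s) (x' s) (y' s) (n' s) (m' s) w) 0 0 r"
proof -
  note d = moving_frame_partials[OF F r] and d' = moving_frame_partials[OF F' r]
  note ipw = has_partials_ip[OF has_partials_const]
  note ipe = has_partials_mult[OF has_partials_const ipw]
  have ee: "e * (e * t) = t" for t using e by (simp add: mult.assoc[symmetric])
  show ?thesis unfolding frame_transport_def
    by (rule has_partials_diff[OF has_partials_add[OF has_partials_diff[OF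
        has_partials_scaleR[OF ipw[OF d(2)] d'(2)] has_partials_scaleR[OF ipw[OF d(3)] d'(3)]]
        has_partials_scaleR[OF ipe[OF d(4)] d'(4)]] has_partials_scaleR[OF ipe[OF d(5)] d'(5)],
      THEN has_partials_eq_rhs]) (simp_all add: ip_simps algebra_simps ee)
qed

lemma moving_frame_unique:
  assumes D: "open D" "connected D" "D \<noteq> {}"
    and F: "moving_frame D e f p q \<alpha> \<beta> b c z x y n m"
    and F': "moving_frame D e f p q \<alpha> \<beta> b c z' x' y' n' m'"
    and o: "\<And>r. r \<in> D \<Longrightarrow> orthonormal_basis4 e (x r) (y r) (n r) (m r)"
    and o': "\<And>r. r \<in> D \<Longrightarrow> orthonormal_basis4 e (x' r) (y' r) (n' r) (m' r)"
  shows "\<exists>g. rigid_motion g \<and> (\<forall>r\<in>D. z' r = g (z r))"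
proof -
  obtain r0 where r0: "r0 \<in> D" using D by auto
  define T where "T r = frame_transport e (x r) (y r) (n r) (m r) (x' r) (y' r) (n' r) (m' r)" for r
  have T: "T r w = T r0 w" if "r \<in> D" for r w
    unfolding T_def
    by (rule has_partials_0_constant[OF D(1,2) has_partials_frame_transport[OF
            orthonormal_basis4_ip(1)[OF o] F F'] that r0])
  have lin: "linear (T r0)" unfolding T_def by (rule linear_frame_transport)
  have Txy: "T r0 (x r) = x' r" "T r0 (y r) = y' r" if "r \<in> D" for r
    unfolding T[OF that, symmetric] using frame_transport_basis(1,2)[OF o[OF that]]
    by (simp_all add: T_def)
  \<comment> \<open>The constant map \<open>T r0\<close> sends x and y to x' and y', and both
    surfaces have the same f; the remaining constant is the translation.\<close>
  have "has_partials (\<lambda>s. z' s - T r0 (z s)) 0 0 r" if r: "r \<in> D" for r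
    using has_partials_diff[OF moving_frame_partials(1)[OF F' r]
        has_partials_linear[OF linear_conv_bounded_linear[THEN iffD1, OF lin] moving_frame_partials(1)[OF F r]]]
    by (simp add: linear_scale[OF lin] Txy[OF r])
  from has_partials_0_constant[OF D(1,2) this _ r0]
  have "z' r - T r0 (z r) = z' r0 - T r0 (z r0)" if "r \<in> D" for r using that by blast
  then have "z' r = T r0 (z r) + (z' r0 - T r0 (z r0))" if "r \<in> D" for r
    using that by (metis diff_add_cancel add.commute)
  moreover have "rigid_motion (\<lambda>v. T r0 v + (z' r0 - T r0 (z r0)))"
    unfolding rigid_motion_def using lin ip_frame_transport[OF o[OF r0] o'[OF r0]]
    by (intro exI[of _ "T r0"] exI[of _ "z' r0 - T r0 (z r0)"]) (auto simp: T_def)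
  ultimately show ?thesis by blast
qed

section \<open>Pointwise geometry of a frame in isothermal parameters\<close>

context
  fixes z :: "real \<times> real \<Rightarrow> real^4" and r :: "real \<times> real" and f e :: real and x y n m :: "real^4"
  assumes zu: "partial_u z r = f *\<^sub>R x" and zv: "partial_v z r = f *\<^sub>R y" and f: "f > 0"
    and basis: "orthonormal_basis4 e x y n m"
begin

lemmas ips = orthonormal_basis4_ip[OF basis]

lemma tangent_space_frame: "tangent_space z r = span {x, y}"
proof -
  have "span {f *\<^sub>R x, f *\<^sub>R y} = span {x, y}"
  proof (rule span_eq[THEN iffD2, OF conjI])
    show "{f *\<^sub>R x, f *\<^sub>R y} \<subseteq> span {x, y}"
      by (auto intro: span_scale span_base)
    have "x = (1 / f) *\<^sub>R (f *\<^sub>R x)" "y = (1 / f) *\<^sub>R (f *\<^sub>R y)" using f by auto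
    then show "{x, y} \<subseteq> span {f *\<^sub>R x, f *\<^sub>R y}"
      by (metis (no_types, lifting) empty_subsetI insertCI insert_subset span_base span_scale)
  qed
  then show ?thesis by (simp add: tangent_space_def zu zv)
qed

lemma mem_tangent_space_frame: "w \<in> tangent_space z r \<longleftrightarrow> (\<exists>a b. w = a *\<^sub>R x + b *\<^sub>R y)"
  unfolding tangent_space_frame span_insert by (auto simp: span_singleton) (metis add_diff_cancel_left' diff_add_cancel)+

lemma mem_normal_space_frame: "w \<in> normal_space z r \<longleftrightarrow> ip w x = 0 \<and> ip w y = 0"
proof
  assume "w \<in> normal_space z r"
  moreover have "x \<in> tangent_space z r" "y \<in> tangent_space z r"
    unfolding tangent_space_frame by (auto intro: span_base)
  ultimately show "ip w x = 0 \<and> ip w y = 0" by (auto simp: normal_space_def)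
next
  assume "ip w x = 0 \<and> ip w y = 0"
  then show "w \<in> normal_space z r"
    by (auto simp: normal_space_def mem_tangent_space_frame ip_simps)
qed

text \<open>The frame expansion splits w into a tangential and a normal half. Uniqueness, which
  settles the definite description, holds because a normal vector expands in n and m alone and
  tangent vectors are orthogonal to both.\<close>

lemma normal_part_frame: "normal_part z r w = (e * ip w n) *\<^sub>R n - (e * ip w m) *\<^sub>R m"
  unfolding normal_part_def
proof (rule the_equality)
  let ?N = "(e * ip w n) *\<^sub>R n - (e * ip w m) *\<^sub>R m"
  have "w - ?N = ip w x *\<^sub>R x + (- ip w y) *\<^sub>R y"
    using orthonormal_basis4_expand[OF basis, of w] by (simp add: frame_transport_def algebra_simps)
  then show "?N \<in> normal_space z r \<and> w - ?N \<in> tangent_space z r"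
    unfolding mem_tangent_space_frame mem_normal_space_frame
    by (intro conjI exI[of _ "ip w x"] exI[of _ "- ip w y"]) (auto simp: ip_simps ips)
  fix k assume k: "k \<in> normal_space z r \<and> w - k \<in> tangent_space z r"
  then obtain a b where ab: "w = k + a *\<^sub>R x + b *\<^sub>R y"
    unfolding mem_tangent_space_frame by (metis add.assoc add_diff_cancel_left' diff_add_cancel add.commute)
  have "frame_transport e x y n m x y n m k = k" by (rule orthonormal_basis4_expand[OF basis])
  then have "k = (e * ip k n) *\<^sub>R n - (e * ip k m) *\<^sub>R m"
    using k by (simp add: frame_transport_def mem_normal_space_frame)
  moreover have "ip w n = ip k n" "ip w m = ip k m" using ab by (simp_all add: ip_simps ips)
  ultimately show "k = ?N" by simp
qed

lemma tangent_coords_frame: "tangent_coords z r (a *\<^sub>R x + b *\<^sub>R y) = (a / f, b / f)"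
  unfolding tangent_coords_def zu zv
proof (rule the_equality)
  show "a *\<^sub>R x + b *\<^sub>R y = fst (a / f, b / f) *\<^sub>R f *\<^sub>R x + snd (a / f, b / f) *\<^sub>R f *\<^sub>R y"
    using f by simp
  fix c :: "real \<times> real"
  assume c: "a *\<^sub>R x + b *\<^sub>R y = fst c *\<^sub>R f *\<^sub>R x + snd c *\<^sub>R f *\<^sub>R y"
  have "a = fst c * f" using arg_cong[OF c, of "\<lambda>w. ip w x"] by (simp add: ip_simps ips)
  moreover have "b = snd c * f" using arg_cong[OF c, of "\<lambda>w. ip w y"] by (simp add: ip_simps ips)
  ultimately show "c = (a / f, b / f)" using f by (cases c) simp
qed

lemma tangent_coords_x: "tangent_coords z r x = (1 / f, 0)"
  and tangent_coords_y: "tangent_coords z r y = (0, 1 / f)"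
  using tangent_coords_frame[of 1 0] tangent_coords_frame[of 0 1] by simp_all

lemma second_fund_form_frame:
  "second_fund_form z r (a *\<^sub>R x + b *\<^sub>R y) (c *\<^sub>R x + d *\<^sub>R y) =
     (1 / f\<^sup>2) *\<^sub>R normal_part z r ((a * c) *\<^sub>R partial_u (partial_u z) r
       + (a * d + b * c) *\<^sub>R partial_u (partial_v z) r + (b * d) *\<^sub>R partial_v (partial_v z) r)"
  unfolding second_fund_form_def tangent_coords_frame
  by (simp add: normal_part_frame ip_simps algebra_simps power2_eq_square add_divide_distrib)

lemma second_fund_form_xy:
  "second_fund_form z r x x = (1 / f\<^sup>2) *\<^sub>R normal_part z r (partial_u (partial_u z) r)"
  "second_fund_form z r x y = (1 / f\<^sup>2) *\<^sub>R normal_part z r (partial_u (partial_v z) r)"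
  "second_fund_form z r y y = (1 / f\<^sup>2) *\<^sub>R normal_part z r (partial_v (partial_v z) r)"
  using second_fund_form_frame[of 1 0 1 0] second_fund_form_frame[of 1 0 0 1]
    second_fund_form_frame[of 0 1 0 1] by simp_all

end

section \<open>Integration of the frame equations\<close>

text \<open>Bootstrapping: components of class C^k have partials that are smooth combinations of
  them, hence of class C^k. The induction treats all components together because the equations
  couple them.\<close>

lemma solves_system_smooth:
  fixes X :: "nat \<Rightarrow> real \<times> real \<Rightarrow> 'b::real_normed_vector"
  assumes D: "open D" and X: "solves_system n D P Q X"
    and PQ: "\<And>i j. i < n \<Longrightarrow> j < n \<Longrightarrow> smooth_on D (P i j)"
      "\<And>i j. i < n \<Longrightarrow> j < n \<Longrightarrow> smooth_on D (Q i j)"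
    and i: "i < n"
  shows "smooth_on D (X i)"
proof -
  have hp: "has_partials (X i) (lin_comb n P X i p) (lin_comb n Q X i p) p" if "i < n" "p \<in> D" for i p
    using X that by (auto simp: solves_system_def)
  have "\<forall>i<n. C_k_on k D (X i)" for k
  proof (induction k)
    case 0
    have "continuous_on D (X i)" if "i < n" for i
      using hp[OF that] by (rule has_partials_continuous_on)
    then show ?case by simp
  next
    case (Suc k)
    show ?case
    proof (intro allI impI)
      fix i assume i: "i < n"
      have l: "C_k_on k D (lin_comb n R X i)" if "\<And>j. j < n \<Longrightarrow> C_k_on k D (R i j)" for R
        unfolding lin_comb_def
        by (intro C_k_on_sum C_k_on_bilinear[OF _ bounded_bilinear_scaleR] D that)
           (use Suc in auto)
      show "C_k_on (Suc k) D (X i)"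
        by (rule C_k_on_SucI[OF D hp[OF i] l l]) (use PQ i in \<open>auto simp: smooth_on_def\<close>)
    qed
  qed
  then show ?thesis using i by (simp add: smooth_on_def)
qed

lemma all_less_5: "(\<forall>i<5. R i) \<longleftrightarrow> R 0 \<and> R 1 \<and> R 2 \<and> R 3 \<and> R (4::nat)"
  by (auto simp: numeral_eq_Suc less_Suc_eq)

lemma sum_less_5: "(\<Sum>j<5. g j) = g 0 + g 1 + g 2 + g 3 + g (4::nat)"
  for g :: "nat \<Rightarrow> 'a::comm_monoid_add"
  by (simp add: numeral_eq_Suc)

text \<open>The hypotheses on derivatives are the entries of the zero-curvature condition: the first
  two come from the position vector and say that p and q are the logarithmic derivatives of f; then
  follow the Gauss equation, four Codazzi equations and the Ricci equation.\<close>

lemma moving_frame_exists: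
  assumes D: "open D" "connected D" "simply_connected D" "D \<noteq> {}" and e: "e \<in> {1, - 1}"
    and smooth: "smooth_on D f" "smooth_on D p" "smooth_on D q" "smooth_on D \<alpha>" "smooth_on D \<beta>"
      "smooth_on D b" "smooth_on D c"
    and compat: "\<And>r. r \<in> D \<Longrightarrow> partial_u f r = f r * p r" "\<And>r. r \<in> D \<Longrightarrow> partial_v f r = f r * q r"
      "\<And>r. r \<in> D \<Longrightarrow> partial_u p r - partial_v q r = e * ((\<alpha> r)\<^sup>2 + (\<beta> r)\<^sup>2)"
      "\<And>r. r \<in> D \<Longrightarrow> partial_v \<alpha> r + q r * \<alpha> r = \<beta> r * b r"
      "\<And>r. r \<in> D \<Longrightarrow> partial_u \<alpha> r + p r * \<alpha> r = \<beta> r * c r"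
      "\<And>r. r \<in> D \<Longrightarrow> partial_v \<beta> r + q r * \<beta> r = \<alpha> r * b r"
      "\<And>r. r \<in> D \<Longrightarrow> partial_u \<beta> r + p r * \<beta> r = \<alpha> r * c r"
      "\<And>r. r \<in> D \<Longrightarrow> partial_v b r - partial_u c r = 2 * e * \<alpha> r * \<beta> r"
  shows "\<exists>z x y n m. moving_frame D e f p q \<alpha> \<beta> b c z x y n m
    \<and> (\<forall>r\<in>D. orthonormal_basis4 e (x r) (y r) (n r) (m r))
    \<and> smooth_on D z \<and> smooth_on D x \<and> smooth_on D y \<and> smooth_on D n \<and> smooth_on D m"
proof -
  \<comment> \<open>Rows and columns are ordered as z, x, y, n, m. Including z as row 0 integrates
    the surface together with its frame; column 0 vanishes because no equation involves z
    itself.\<close>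
  define P :: "nat \<Rightarrow> nat \<Rightarrow> real \<times> real \<Rightarrow> real" where
    "P = (\<lambda>i j. [[\<lambda>_. 0, f, \<lambda>_. 0, \<lambda>_. 0, \<lambda>_. 0],
        [\<lambda>_. 0, \<lambda>_. 0, q, \<alpha>, \<lambda>_. 0],
        [\<lambda>_. 0, q, \<lambda>_. 0, \<lambda>_. 0, \<beta>],
        [\<lambda>_. 0, \<lambda>r. - (e * \<alpha> r), \<lambda>_. 0, \<lambda>_. 0, b],
        [\<lambda>_. 0, \<lambda>_. 0, \<lambda>r. - (e * \<beta> r), b, \<lambda>_. 0]] ! i ! j)"
  define Q :: "nat \<Rightarrow> nat \<Rightarrow> real \<times> real \<Rightarrow> real" where
    "Q = (\<lambda>i j. [[\<lambda>_. 0, \<lambda>_. 0, f, \<lambda>_. 0, \<lambda>_. 0],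
        [\<lambda>_. 0, \<lambda>_. 0, p, \<lambda>_. 0, \<beta>],
        [\<lambda>_. 0, p, \<lambda>_. 0, \<alpha>, \<lambda>_. 0],
        [\<lambda>_. 0, \<lambda>_. 0, \<lambda>r. e * \<alpha> r, \<lambda>_. 0, c],
        [\<lambda>_. 0, \<lambda>r. e * \<beta> r, \<lambda>_. 0, c, \<lambda>_. 0]] ! i ! j)"
  have sm: "smooth_on D (\<lambda>_. 0 :: real)" "smooth_on D (\<lambda>r. e * \<alpha> r)" "smooth_on D (\<lambda>r. e * \<beta> r)"
    "smooth_on D (\<lambda>r. - (e * \<alpha> r))" "smooth_on D (\<lambda>r. - (e * \<beta> r))"
    by (intro smooth_on_minus smooth_on_mult smooth_on_const smooth D(1))+
  have PQ: "\<forall>i<5. \<forall>j<5. smooth_on D (P i j) \<and> smooth_on D (Q i j)"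
    unfolding all_less_5 by (simp add: P_def Q_def sm smooth)
  have pd0: "partial_u (\<lambda>_. 0 :: real) r = 0" "partial_v (\<lambda>_. 0 :: real) r = 0" for r
    using has_partials_imp[OF has_partials_const[of "0 :: real" r]] by auto
  have pde: "partial_v (\<lambda>r. - (e * g r)) r = - (e * partial_v g r)"
      "partial_u (\<lambda>r. e * g r) r = e * partial_u g r" if "smooth_on D g" "r \<in> D" for g r
    using has_partials_imp[OF has_partials_minus[OF has_partials_mult[OF has_partials_const[of e]
          smooth_on_has_partials[OF D(1) that]]]]
      has_partials_imp[OF has_partials_mult[OF has_partials_const[of e]
          smooth_on_has_partials[OF D(1) that]]] by simp_all
  have ee: "e * (e * t) = t" for t using e by auto
  have "flat_system 5 D P Q" unfolding flat_system_def
  proof (intro conjI)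
    show "\<forall>i<5. \<forall>j<5. C_k_on 1 D (P i j) \<and> C_k_on 1 D (Q i j)"
      using PQ unfolding smooth_on_def by blast
    have "partial_v (P i k) r + (\<Sum>j<5. P i j r * Q j k r)
        = partial_u (Q i k) r + (\<Sum>j<5. Q i j r * P j k r)" if r: "r \<in> D" and i: "i < 5" and k: "k < 5" for r i k
    proof -
      have "\<forall>i<5. \<forall>k<5. partial_v (P i k) r + (\<Sum>j<5. P i j r * Q j k r)
        = partial_u (Q i k) r + (\<Sum>j<5. Q i j r * P j k r)"
        unfolding all_less_5 sum_less_5
        using compat[OF r]
        by (simp add: P_def Q_def pd0 pde[OF smooth(4) r] pde[OF smooth(5) r] ee
            power2_eq_square algebra_simps)
           (simp flip: distrib_left)
      then show ?thesis using i k by blast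
    qed
    then show "\<forall>i<5. \<forall>k<5. \<forall>r\<in>D. partial_v (P i k) r + (\<Sum>j<5. P i j r * Q j k r)
        = partial_u (Q i k) r + (\<Sum>j<5. Q i j r * P j k r)" by blast
  qed
  define x0 y0 :: "real^4" where "x0 = axis 1 1" and "y0 = axis 3 1"
  \<comment> \<open>Coordinates 1 and 2 are spacelike, 3 and 4 timelike; the roles of 2 and 4 are
    exchanged so that n has square e.\<close>
  define n0 m0 :: "real^4" where "n0 = (if e = 1 then axis 2 1 else axis 4 1)"
    and "m0 = (if e = 1 then axis 4 1 else axis 2 1)"
  have b0: "orthonormal_basis4 e x0 y0 n0 m0"
    using e by (auto simp: orthonormal_basis4_def ip_def x0_def y0_def n0_def m0_def axis_def)
  obtain X r0 where r0: "r0 \<in> D" and X: "solves_system 5 D P Q X"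
      and X0: "\<forall>i<5. X i r0 = [0, x0, y0, n0, m0] ! i"
    using flat_system_solvable[OF D \<open>flat_system 5 D P Q\<close>, of "\<lambda>i. [0, x0, y0, n0, m0] ! i"] by blast
  have F: "moving_frame D e f p q \<alpha> \<beta> b c (X 0) (X 1) (X 2) (X 3) (X 4)"
    using X unfolding solves_system_def all_less_5 lin_comb_def sum_less_5 moving_frame_def
    by (simp add: P_def Q_def add_ac)
  have init: "X 1 r0 = x0" "X 2 r0 = y0" "X 3 r0 = n0" "X 4 r0 = m0"
    using X0 unfolding all_less_5 by simp_all
  \<comment> \<open>The expansion operator of the solution has zero derivative and is the identity
    at the initial point.\<close>
  have "orthonormal_basis4 e (X 1 r) (X 2 r) (X 3 r) (X 4 r)" if r: "r \<in> D" for r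
  proof (rule orthonormal_basis4_if_expand[OF e])
    fix w
    have "frame_transport e (X 1 r) (X 2 r) (X 3 r) (X 4 r) (X 1 r) (X 2 r) (X 3 r) (X 4 r) w
        = frame_transport e (X 1 r0) (X 2 r0) (X 3 r0) (X 4 r0) (X 1 r0) (X 2 r0) (X 3 r0) (X 4 r0) w"
      by (rule has_partials_0_constant[OF D(1,2) has_partials_frame_transport[OF _ F F] r r0])
         (use e in auto)
    then show "frame_transport e (X 1 r) (X 2 r) (X 3 r) (X 4 r) (X 1 r) (X 2 r) (X 3 r) (X 4 r) w = w"
      unfolding init orthonormal_basis4_expand[OF b0] .
  qed
  moreover have "\<forall>i<5. smooth_on D (X i)"
    using solves_system_smooth[OF D(1) X] PQ by blast
  then have "smooth_on D (X 0) \<and> smooth_on D (X 1) \<and> smooth_on D (X 2) \<and> smooth_on D (X 3) \<and> smooth_on D (X 4)"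
    unfolding all_less_5 .
  ultimately show ?thesis using F by blast
qed

section \<open>Curvatures in terms of the frame coefficients\<close>

text \<open>Equality of mixed derivatives, read in one component each: for x and y paired with n it
  gives two Codazzi equations, for n paired with m the Ricci equation.\<close>

lemma moving_frame_compat:
  assumes D: "open D" and F: "moving_frame D e f p q \<alpha> \<beta> b c z x y n m"
    and o: "\<And>r. r \<in> D \<Longrightarrow> orthonormal_basis4 e (x r) (y r) (n r) (m r)"
    and smooth: "smooth_on D x" "smooth_on D y" "smooth_on D n"
      "smooth_on D p" "smooth_on D q" "smooth_on D \<alpha>" "smooth_on D \<beta>" "smooth_on D b" "smooth_on D c"
    and r: "r \<in> D"
  shows "partial_v \<alpha> r + q r * \<alpha> r = \<beta> r * b r"
    and "partial_u \<alpha> r + p r * \<alpha> r = \<beta> r * c r"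
    and "partial_v b r - partial_u c r = 2 * e * \<alpha> r * \<beta> r"
proof -
  note d = moving_frame_partials[OF F]
  note ips = orthonormal_basis4_ip[OF o[OF r]]
  have e: "e \<in> {1, - 1}" using o[OF r] by (simp add: orthonormal_basis4_def)
  note hp = smooth_on_has_partials[OF D _ r]
  note comb = has_partials_add[OF has_partials_scaleR has_partials_scaleR]
  have mixed: "partial_v gu r = partial_u gv r"
    if g: "smooth_on D g" and gg: "\<And>s. s \<in> D \<Longrightarrow> has_partials g (gu s) (gv s) s" for g gu gv :: "real \<times> real \<Rightarrow> real^4"
  proof -
    have "partial_v (partial_u g) r = partial_v gu r"
      by (rule partial_cong[OF D r]) (use has_partials_imp(1)[OF gg] in simp)
    moreover have "partial_u (partial_v g) r = partial_u gv r"
      by (rule partial_cong[OF D r]) (use has_partials_imp(2)[OF gg] in simp)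
    ultimately show ?thesis using smooth_on_mixed_partials[OF D g r] by simp
  qed
  have "ip (partial_v (\<lambda>r. q r *\<^sub>R y r + \<alpha> r *\<^sub>R n r) r) (n r)
      = ip (partial_u (\<lambda>r. p r *\<^sub>R y r + \<beta> r *\<^sub>R m r) r) (n r)"
    using mixed[OF smooth(1) d(2)] by simp
  then show "partial_v \<alpha> r + q r * \<alpha> r = \<beta> r * b r"
    unfolding has_partials_imp(2)[OF comb[OF hp[OF smooth(5)] d(3)[OF r] hp[OF smooth(6)] d(4)[OF r]]]
      has_partials_imp(1)[OF comb[OF hp[OF smooth(4)] d(3)[OF r] hp[OF smooth(7)] d(5)[OF r]]]
    using e by (auto simp: ip_simps ips)
  have "ip (partial_v (\<lambda>r. q r *\<^sub>R x r + \<beta> r *\<^sub>R m r) r) (n r)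
      = ip (partial_u (\<lambda>r. p r *\<^sub>R x r + \<alpha> r *\<^sub>R n r) r) (n r)"
    using mixed[OF smooth(2) d(3)] by simp
  then show "partial_u \<alpha> r + p r * \<alpha> r = \<beta> r * c r"
    unfolding has_partials_imp(2)[OF comb[OF hp[OF smooth(5)] d(2)[OF r] hp[OF smooth(7)] d(5)[OF r]]]
      has_partials_imp(1)[OF comb[OF hp[OF smooth(4)] d(2)[OF r] hp[OF smooth(6)] d(4)[OF r]]]
    using e by (auto simp: ip_simps ips)
  have se: "smooth_on D (\<lambda>r. e * \<alpha> r)" "smooth_on D (\<lambda>r. - (e * \<alpha> r))"
    by (intro smooth_on_minus smooth_on_mult smooth_on_const smooth D)+
  have "ip (partial_v (\<lambda>r. - (e * \<alpha> r) *\<^sub>R x r + b r *\<^sub>R m r) r) (m r)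
      = ip (partial_u (\<lambda>r. (e * \<alpha> r) *\<^sub>R y r + c r *\<^sub>R m r) r) (m r)"
    using mixed[OF smooth(3) d(4)] by simp
  then show "partial_v b r - partial_u c r = 2 * e * \<alpha> r * \<beta> r"
    unfolding has_partials_imp(2)[OF comb[OF hp[OF se(2)] d(2)[OF r] hp[OF smooth(8)] d(5)[OF r]]]
      has_partials_imp(1)[OF comb[OF hp[OF se(1)] d(3)[OF r] hp[OF smooth(9)] d(5)[OF r]]]
    using e by (auto simp: ip_simps ips)
qed

context
  fixes D and e :: real and f p q \<alpha> \<beta> b c :: "real \<times> real \<Rightarrow> real" and z x y n m :: "real \<times> real \<Rightarrow> real^4"
  assumes D: "open D" and F: "moving_frame D e f p q \<alpha> \<beta> b c z x y n m"
    and o: "\<And>r. r \<in> D \<Longrightarrow> orthonormal_basis4 e (x r) (y r) (n r) (m r)"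
    and f: "\<And>r. r \<in> D \<Longrightarrow> f r > 0"
    and df: "\<And>r. r \<in> D \<Longrightarrow> has_partials f (f r * p r) (f r * q r) r"
begin

lemma partial_moving_frame:
  assumes "r \<in> D"
  shows "partial_u z r = f r *\<^sub>R x r" "partial_v z r = f r *\<^sub>R y r"
  using has_partials_imp[OF moving_frame_partials(1)[OF F assms]] by auto

lemma second_partials_moving_frame:
  assumes r: "r \<in> D"
  shows "partial_u (partial_u z) r = (f r * p r) *\<^sub>R x r + f r *\<^sub>R (q r *\<^sub>R y r + \<alpha> r *\<^sub>R n r)"
    "partial_u (partial_v z) r = (f r * p r) *\<^sub>R y r + f r *\<^sub>R (q r *\<^sub>R x r + \<beta> r *\<^sub>R m r)"
    "partial_v (partial_v z) r = (f r * q r) *\<^sub>R y r + f r *\<^sub>R (p r *\<^sub>R x r + \<alpha> r *\<^sub>R n r)"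
  by (rule trans[OF partial_cong(1)[OF D r partial_moving_frame(1)]
          has_partials_imp(1)[OF has_partials_scaleR[OF df[OF r] moving_frame_partials(2)[OF F r]]]]
        trans[OF partial_cong(1)[OF D r partial_moving_frame(2)]
          has_partials_imp(1)[OF has_partials_scaleR[OF df[OF r] moving_frame_partials(3)[OF F r]]]]
        trans[OF partial_cong(2)[OF D r partial_moving_frame(2)]
          has_partials_imp(2)[OF has_partials_scaleR[OF df[OF r] moving_frame_partials(3)[OF F r]]]];
      assumption)+

lemma normal_parts_moving_frame:
  assumes r: "r \<in> D"
  shows "normal_part z r (partial_u (partial_u z) r) = (f r * \<alpha> r) *\<^sub>R n r"
    "normal_part z r (partial_u (partial_v z) r) = (f r * \<beta> r) *\<^sub>R m r"
    "normal_part z r (partial_v (partial_v z) r) = (f r * \<alpha> r) *\<^sub>R n r"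
proof -
  note N = normal_part_frame[OF partial_moving_frame[OF r] f[OF r] o[OF r]]
  note ips = orthonormal_basis4_ip[OF o[OF r]]
  have e: "e \<in> {1, - 1}" using o[OF r] by (simp add: orthonormal_basis4_def)
  show "normal_part z r (partial_u (partial_u z) r) = (f r * \<alpha> r) *\<^sub>R n r"
    "normal_part z r (partial_u (partial_v z) r) = (f r * \<beta> r) *\<^sub>R m r"
    "normal_part z r (partial_v (partial_v z) r) = (f r * \<alpha> r) *\<^sub>R n r"
    unfolding N second_partials_moving_frame[OF r] using e by (auto simp: ip_simps ips)
qed

lemma second_fund_form_moving_frame:
  assumes r: "r \<in> D"
  shows "second_fund_form z r (x r) (x r) = (\<alpha> r / f r) *\<^sub>R n r"
    "second_fund_form z r (x r) (y r) = (\<beta> r / f r) *\<^sub>R m r"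
    "second_fund_form z r (y r) (y r) = (\<alpha> r / f r) *\<^sub>R n r"
  unfolding second_fund_form_xy[OF partial_moving_frame[OF r] f[OF r] o[OF r]]
    normal_parts_moving_frame[OF r]
  using f[OF r] by (simp_all add: power2_eq_square)

lemma gauss_curvature_moving_frame:
  assumes r: "r \<in> D"
  shows "gauss_curvature z x y r = - e * ((\<alpha> r)\<^sup>2 + (\<beta> r)\<^sup>2) / (f r)\<^sup>2"
  unfolding gauss_curvature_def second_fund_form_moving_frame[OF r]
  using orthonormal_basis4_ip[OF o[OF r]] f[OF r]
  by (simp add: ip_simps power2_eq_square field_simps)

text \<open>In isothermal parameters F = 0 and G = -E, so the trace is a multiple of the difference
  of the second fundamental forms of the two coordinate vectors, and these coincide.\<close>

lemma mean_curvature_moving_frame: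
  assumes r: "r \<in> D"
  shows "mean_curvature_vector z r = 0"
proof -
  have "tangent_coords z r (f r *\<^sub>R x r) = (1, 0)" "tangent_coords z r (f r *\<^sub>R y r) = (0, 1)"
    using tangent_coords_frame[OF partial_moving_frame[OF r] f[OF r] o[OF r], of "f r" 0]
      tangent_coords_frame[OF partial_moving_frame[OF r] f[OF r] o[OF r], of 0 "f r"] f[OF r]
    by simp_all
  then have "second_fund_form z r (f r *\<^sub>R x r) (f r *\<^sub>R x r) = (f r * \<alpha> r) *\<^sub>R n r"
    "second_fund_form z r (f r *\<^sub>R y r) (f r *\<^sub>R y r) = (f r * \<alpha> r) *\<^sub>R n r"
    by (simp_all add: second_fund_form_def normal_parts_moving_frame[OF r])
  then show ?thesis
    by (simp add: mean_curvature_vector_def Let_def coeff_E_def coeff_F_def coeff_G_def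
        partial_moving_frame[OF r] ip_simps orthonormal_basis4_ip[OF o[OF r]])
qed

lemma normal_connection_moving_frame:
  assumes s: "s \<in> D"
  shows "normal_connection z x n s = (b s / f s) *\<^sub>R m s"
    "normal_connection z y n s = (c s / f s) *\<^sub>R m s"
proof -
  note pm = partial_moving_frame[OF s] f[OF s] o[OF s]
  note ips = orthonormal_basis4_ip[OF o[OF s]]
  have e: "e \<in> {1, - 1}" using o[OF s] by (simp add: orthonormal_basis4_def)
  show "normal_connection z x n s = (b s / f s) *\<^sub>R m s"
    "normal_connection z y n s = (c s / f s) *\<^sub>R m s"
    unfolding normal_connection_def normal_part_frame[OF pm] deriv_along_def
      tangent_coords_x[OF pm] tangent_coords_y[OF pm]
      has_partials_imp[OF moving_frame_partials(4)[OF F s]]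
    using e by (auto simp: ip_simps ips)
qed

text \<open>Here \<open>D\<^sub>x n = (b / f) m\<close>, \<open>D\<^sub>y n = (c / f) m\<close> and
  [x, y] = (q x - p y) / f. The terms with p and q that come from differentiating 1 / f cancel
  against the bracket term, which leaves the left side of the Ricci equation over f^2; the metric
  denominator is -1.\<close>

lemma normal_curvature_moving_frame:
  assumes bc: "smooth_on D b" "smooth_on D c"
    and ricci: "\<And>r. r \<in> D \<Longrightarrow> partial_v b r - partial_u c r = 2 * e * \<alpha> r * \<beta> r"
    and r: "r \<in> D"
  shows "normal_curvature z x y n m r = - 2 * \<alpha> r * \<beta> r / (f r)\<^sup>2"
proof -
  note pm = partial_moving_frame[OF r] f[OF r] o[OF r]
  note ips = orthonormal_basis4_ip[OF o[OF r]]
  note d = moving_frame_partials[OF F r]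
  have e: "e \<in> {1, - 1}" using o[OF r] by (simp add: orthonormal_basis4_def)
  have f0: "f r \<noteq> 0" using f[OF r] by simp
  have "has_partials (\<lambda>s. inverse (f s)) (- (inverse (f r) ^ Suc (Suc 0)) * (f r * p r))
      (- (inverse (f r) ^ Suc (Suc 0)) * (f r * q r)) r"
    by (rule has_partials_compose_real[OF df[OF r] DERIV_inverse[OF f0]])
  then have inv: "has_partials (\<lambda>s. inverse (f s)) (- (p r / f r)) (- (q r / f r)) r"
    using f0 by (simp add: power2_eq_square field_simps)
  have quot: "has_partials (\<lambda>s. (g s / f s) *\<^sub>R m s)
      ((partial_u g r * inverse (f r) + g r * - (p r / f r)) *\<^sub>R m r + (g r * inverse (f r)) *\<^sub>R (- (e * \<beta> r) *\<^sub>R y r + b r *\<^sub>R n r))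
      ((partial_v g r * inverse (f r) + g r * - (q r / f r)) *\<^sub>R m r + (g r * inverse (f r)) *\<^sub>R ((e * \<beta> r) *\<^sub>R x r + c r *\<^sub>R n r)) r"
    if "smooth_on D g" for g
    using has_partials_scaleR[OF has_partials_mult[OF smooth_on_has_partials[OF D that r] inv] d(5)]
    by (simp add: divide_inverse)
  have 1: "partial_u (normal_connection z y n) r = partial_u (\<lambda>s. (c s / f s) *\<^sub>R m s) r"
    "partial_v (normal_connection z x n) r = partial_v (\<lambda>s. (b s / f s) *\<^sub>R m s) r"
    using normal_connection_moving_frame by (auto intro!: partial_cong[OF D r])
  have 2: "ip (normal_connection z x (normal_connection z y n) r) (m r)
      = - e * (partial_u c r - c r * p r) / (f r)\<^sup>2"
    unfolding normal_connection_def[of z x "normal_connection z y n"] deriv_along_def tangent_coords_x[OF pm]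
      normal_part_frame[OF pm]
    using e f0 by (auto simp: 1 has_partials_imp[OF quot[OF bc(2)]] ip_simps ips power2_eq_square field_simps)
  have 3: "ip (normal_connection z y (normal_connection z x n) r) (m r)
      = - e * (partial_v b r - b r * q r) / (f r)\<^sup>2"
    unfolding normal_connection_def[of z y "normal_connection z x n"] deriv_along_def tangent_coords_y[OF pm]
      normal_part_frame[OF pm]
    using e f0 by (auto simp: 1 has_partials_imp[OF quot[OF bc(1)]] ip_simps ips power2_eq_square field_simps)
  have bracket: "tangent_bracket z x y r = (q r / f r) *\<^sub>R x r + (- (p r / f r)) *\<^sub>R y r"
    unfolding tangent_bracket_def deriv_along_def tangent_coords_x[OF pm] tangent_coords_y[OF pm]
    by (simp add: has_partials_imp[OF d(2)] has_partials_imp[OF d(3)] algebra_simps)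
  have coords: "tangent_coords z r (tangent_bracket z x y r) = (q r / f r / f r, - (p r / f r) / f r)"
    unfolding bracket by (rule tangent_coords_frame[OF pm])
  have 4: "ip (normal_connection z (tangent_bracket z x y) n r) (m r)
      = - e * (q r * b r - p r * c r) / (f r)\<^sup>2"
    unfolding normal_connection_def deriv_along_def normal_part_frame[OF pm]
    using e f0 by (auto simp: coords has_partials_imp[OF d(4)] ip_simps ips
        power2_eq_square field_simps)
  have "ip (normal_curvature_tensor z x y n r) (m r) = e * (partial_v b r - partial_u c r) / (f r)\<^sup>2"
    unfolding normal_curvature_tensor_def ip_simps 2 3 4
    using f0 by (simp add: field_simps)
  also have "\<dots> = 2 * \<alpha> r * \<beta> r / (f r)\<^sup>2"
    using e by (auto simp: ricci[OF r])
  finally show ?thesis unfolding normal_curvature_def by (simp add: ips)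
qed

end

section \<open>Surfaces with a geometric frame\<close>

lemma orthonormal_frame_field_basis:
  assumes "orthonormal_frame_field W z e x y n m" "r \<in> W"
  shows "orthonormal_basis4 e (x r) (y r) (n r) (m r)"
proof -
  have t: "x r \<in> tangent_space z r" "y r \<in> tangent_space z r"
    and nm: "n r \<in> normal_space z r" "m r \<in> normal_space z r"
    using assms by (auto simp: orthonormal_frame_field_def)
  have "ip (n r) (x r) = 0" "ip (n r) (y r) = 0" "ip (m r) (x r) = 0" "ip (m r) (y r) = 0"
    using t nm by (auto simp: normal_space_def)
  then show ?thesis
    using assms by (auto simp: orthonormal_frame_field_def orthonormal_basis4_def
        ip_sym[of "x r" "n r"] ip_sym[of "x r" "m r"] ip_sym[of "y r" "n r"] ip_sym[of "y r" "m r"])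
qed

lemma partials_ip_constant:
  assumes D: "open D" "r \<in> D" and g: "has_partials g gu gv r" and h: "has_partials h hu hv r"
    and const: "\<And>s. s \<in> D \<Longrightarrow> ip (g s) (h s) = k"
  shows "ip gu (h r) + ip (g r) hu = 0" "ip gv (h r) + ip (g r) hv = 0"
proof -
  have "has_partials (\<lambda>_. k) (ip gu (h r) + ip (g r) hu) (ip gv (h r) + ip (g r) hv) r"
    by (rule has_partials_cong[OF has_partials_ip[OF g h] D const])
  from has_partials_unique[OF this has_partials_const]
  show "ip gu (h r) + ip (g r) hu = 0" "ip gv (h r) + ip (g r) hv = 0" .
qed

text \<open>Constancy of the inner products makes the frame equations skew, equality of the mixed
  derivatives of z gives the tangential connection in terms of p and q, and the second fundamental
  form gives the normal components of the derivatives of x and y. Expanding in the frame yields the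
  stated equations.\<close>

lemma geometric_frame_imp_moving_frame:
  assumes D: "open D" and z: "smooth_on D z"
    and G: "geometric_frame_field D z e x y n m \<mu> \<nu>" and C: "canonical_parameters D z x y \<mu> \<nu>"
  obtains f p q \<alpha> \<beta> b c where
    "smooth_on D f" "smooth_on D p" "smooth_on D q" "smooth_on D \<alpha>" "smooth_on D \<beta>"
    "smooth_on D b" "smooth_on D c"
    "\<And>r. r \<in> D \<Longrightarrow> f r > 0" "\<And>r. r \<in> D \<Longrightarrow> has_partials f (f r * p r) (f r * q r) r"
    "\<And>r. r \<in> D \<Longrightarrow> (f r)\<^sup>2 = 1 / sqrt \<bar>(\<mu> r)\<^sup>2 - (\<nu> r)\<^sup>2\<bar>"
    "\<And>r. r \<in> D \<Longrightarrow> \<alpha> r = f r * \<nu> r" "\<And>r. r \<in> D \<Longrightarrow> \<beta> r = f r * \<mu> r"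
    "moving_frame D e f p q \<alpha> \<beta> b c z x y n m"
proof -
  have fr: "orthonormal_frame_field D z e x y n m" using G by (simp add: geometric_frame_field_def)
  have sm: "smooth_on D x" "smooth_on D y" "smooth_on D n" "smooth_on D m"
    using fr by (auto simp: orthonormal_frame_field_def)
  note basis = orthonormal_frame_field_basis[OF fr]
  define f where "f r = sqrt (coeff_E z r)" for r
  have cp: "partial_u z r = f r *\<^sub>R x r" "partial_v z r = sqrt (- coeff_G z r) *\<^sub>R y r"
    "coeff_E z r = 1 / sqrt \<bar>(\<mu> r)\<^sup>2 - (\<nu> r)\<^sup>2\<bar>" "coeff_G z r = - 1 / sqrt \<bar>(\<mu> r)\<^sup>2 - (\<nu> r)\<^sup>2\<bar>"
    if "r \<in> D" for r using C that unfolding canonical_parameters_def f_def by blast+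
  have zu: "partial_u z r = f r *\<^sub>R x r" and zv: "partial_v z r = f r *\<^sub>R y r" if "r \<in> D" for r
    using cp[OF that] by (auto simp: f_def)
  \<comment> \<open>With division by zero equal to 0, the formulas for E and G alone would allow E =
    G = 0. Then both coordinate vectors vanish, which contradicts the unit vector x in the tangent
    space.\<close>
  have Epos: "coeff_E z r > 0" if r: "r \<in> D" for r
  proof (rule ccontr)
    assume "\<not> coeff_E z r > 0"
    then have "coeff_E z r = 0" using cp(3)[OF r] by (simp add: order_less_le)
    then have "partial_u z r = 0" "partial_v z r = 0" using zu[OF r] zv[OF r] by (simp_all add: f_def)
    then have "x r = 0" using fr r by (auto simp: orthonormal_frame_field_def tangent_space_def)
    then show False using orthonormal_basis4_ip(2)[OF basis[OF r]] by (simp add: ip_simps)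
  qed
  have f: "f r > 0" if "r \<in> D" for r using Epos[OF that] by (simp add: f_def)
  have fsq: "(f r)\<^sup>2 = coeff_E z r" if "r \<in> D" for r using Epos[OF that] by (simp add: f_def)
  have Esm: "smooth_on D (coeff_E z)"
    unfolding coeff_E_def[abs_def] by (intro smooth_on_ip D smooth_on_partial z)
  \<comment> \<open>The square root of E > 0 is written as exp(ln E / 2), to which the smoothness
    rules apply.\<close>
  have fsm: "smooth_on D f"
  proof (rule smooth_on_cong)
    show "smooth_on D (\<lambda>r. exp (1 / 2 * ln (coeff_E z r)))"
      by (intro smooth_on_exp smooth_on_mult smooth_on_const smooth_on_ln D Esm Epos)
    fix r assume r: "r \<in> D"
    have "exp (1 / 2 * ln (coeff_E z r)) = coeff_E z r powr (1 / 2)"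
      using Epos[OF r] by (simp add: powr_def)
    then show "exp (1 / 2 * ln (coeff_E z r)) = f r"
      using Epos[OF r] by (simp add: f_def powr_half_sqrt)
  qed (rule D)
  define p where "p r = partial_u f r / f r" for r
  define q where "q r = partial_v f r / f r" for r
  have f0: "f r \<noteq> 0" if "r \<in> D" for r using f[OF that] by simp
  have psm: "smooth_on D p" "smooth_on D q"
    unfolding p_def[abs_def] q_def[abs_def]
    by (intro smooth_on_divide D smooth_on_partial fsm f0; assumption)+
  have df: "has_partials f (f r * p r) (f r * q r) r" if "r \<in> D" for r
    using smooth_on_has_partials[OF D fsm that] f0[OF that] by (simp add: p_def q_def)
  \<comment> \<open>\<open>geometric_frame_field\<close> states no regularity of \<mu> and \<nu>.
    Defining the coefficients through derivatives of the smooth frame makes them smooth; their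
    values f \<nu> and f \<mu> follow afterwards.\<close>
  define \<alpha> where "\<alpha> r = e * ip (partial_u x r) (n r)" for r
  define \<beta> where "\<beta> r = - e * ip (partial_v x r) (m r)" for r
  define b where "b r = - e * ip (partial_u n r) (m r)" for r
  define c where "c r = - e * ip (partial_v n r) (m r)" for r
  have asm: "smooth_on D \<alpha>" "smooth_on D \<beta>" "smooth_on D b" "smooth_on D c"
    unfolding \<alpha>_def[abs_def] \<beta>_def[abs_def] b_def[abs_def] c_def[abs_def]
    by (intro smooth_on_mult smooth_on_const smooth_on_ip smooth_on_partial D sm)+
  have main: "\<alpha> r = f r * \<nu> r \<and> \<beta> r = f r * \<mu> r \<and>
     has_partials x (q r *\<^sub>R y r + \<alpha> r *\<^sub>R n r) (p r *\<^sub>R y r + \<beta> r *\<^sub>R m r) r \<and>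
     has_partials y (q r *\<^sub>R x r + \<beta> r *\<^sub>R m r) (p r *\<^sub>R x r + \<alpha> r *\<^sub>R n r) r \<and>
     has_partials n (- (e * \<alpha> r) *\<^sub>R x r + b r *\<^sub>R m r) ((e * \<alpha> r) *\<^sub>R y r + c r *\<^sub>R m r) r \<and>
     has_partials m (- (e * \<beta> r) *\<^sub>R y r + b r *\<^sub>R n r) ((e * \<beta> r) *\<^sub>R x r + c r *\<^sub>R n r) r"
    if r: "r \<in> D" for r
  proof -
    have e: "e \<in> {1, - 1}" using basis[OF r] by (simp add: orthonormal_basis4_def)
    then have ee: "e * e = 1" by auto
    note ips = orthonormal_basis4_ip[OF basis[OF r]]
    note hp = smooth_on_has_partials[OF D _ r]
    define xu xv yu yv nu nv mu mv where "xu = partial_u x r" "xv = partial_v x r" "yu = partial_u y r"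
      "yv = partial_v y r" "nu = partial_u n r" "nv = partial_v n r" "mu = partial_u m r" "mv = partial_v m r"
    note defs = this
    note hx = hp[OF sm(1), folded defs] and hy = hp[OF sm(2), folded defs]
      and hn = hp[OF sm(3), folded defs] and hm = hp[OF sm(4), folded defs]
    note K = partials_ip_constant[OF D r]
    note ob = orthonormal_basis4_ip[OF basis]
    have k1: "ip xu (x r) = 0" "ip xv (x r) = 0" "ip yu (y r) = 0" "ip yv (y r) = 0"
      "ip nu (n r) = 0" "ip nv (n r) = 0" "ip mu (m r) = 0" "ip mv (m r) = 0"
      using K[OF hx hx ob(2)] K[OF hy hy ob(3)] K[OF hn hn ob(4)] K[OF hm hm ob(5)]
      by (simp_all add: ip_sym[of _ xu] ip_sym[of _ xv] ip_sym[of _ yu] ip_sym[of _ yv]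
          ip_sym[of _ nu] ip_sym[of _ nv] ip_sym[of _ mu] ip_sym[of _ mv])
    have k2: "ip yu (x r) = - ip xu (y r)" "ip yv (x r) = - ip xv (y r)"
      "ip nu (x r) = - ip xu (n r)" "ip nv (x r) = - ip xv (n r)"
      "ip mu (x r) = - ip xu (m r)" "ip mv (x r) = - ip xv (m r)"
      "ip nu (y r) = - ip yu (n r)" "ip nv (y r) = - ip yv (n r)"
      "ip mu (y r) = - ip yu (m r)" "ip mv (y r) = - ip yv (m r)"
      "ip mu (n r) = - ip nu (m r)" "ip mv (n r) = - ip nv (m r)"
      using K[OF hx hy ob(6)] K[OF hx hn ob(7)] K[OF hx hm ob(8)] K[OF hy hn ob(9)]
        K[OF hy hm ob(10)] K[OF hn hm ob(11)]
      by (simp_all add: ip_sym[of "x r"] ip_sym[of "y r"] ip_sym[of "n r"])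
    have zz: "partial_u (partial_u z) r = (f r * p r) *\<^sub>R x r + f r *\<^sub>R xu"
      "partial_v (partial_u z) r = (f r * q r) *\<^sub>R x r + f r *\<^sub>R xv"
      "partial_u (partial_v z) r = (f r * p r) *\<^sub>R y r + f r *\<^sub>R yu"
      "partial_v (partial_v z) r = (f r * q r) *\<^sub>R y r + f r *\<^sub>R yv"
      by (rule trans[OF partial_cong(1)[OF D r zu] has_partials_imp(1)[OF has_partials_scaleR[OF df[OF r] hx]]]
            trans[OF partial_cong(2)[OF D r zu] has_partials_imp(2)[OF has_partials_scaleR[OF df[OF r] hx]]]
            trans[OF partial_cong(1)[OF D r zv] has_partials_imp(1)[OF has_partials_scaleR[OF df[OF r] hy]]]
            trans[OF partial_cong(2)[OF D r zv] has_partials_imp(2)[OF has_partials_scaleR[OF df[OF r] hy]]];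
          assumption)+
    \<comment> \<open>Its components along x and y determine the rotation of the tangent frame, and
      those along n and m carry the normal part of \<open>yu\<close> over to
      \<open>xv\<close>.\<close>
    have mixed: "(f r * q r) *\<^sub>R x r + f r *\<^sub>R xv = (f r * p r) *\<^sub>R y r + f r *\<^sub>R yu"
      using smooth_on_mixed_partials[OF D z r] zz by simp
    note pm = zu[OF r] zv[OF r] f[OF r] basis[OF r]
    have sff: "\<nu> r *\<^sub>R n r = (1 / (f r)\<^sup>2) *\<^sub>R ((e * ip (f r *\<^sub>R xu) (n r)) *\<^sub>R n r - (e * ip (f r *\<^sub>R xu) (m r)) *\<^sub>R m r)"
      "\<mu> r *\<^sub>R m r = (1 / (f r)\<^sup>2) *\<^sub>R ((e * ip (f r *\<^sub>R yu) (n r)) *\<^sub>R n r - (e * ip (f r *\<^sub>R yu) (m r)) *\<^sub>R m r)"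
      "\<nu> r *\<^sub>R n r = (1 / (f r)\<^sup>2) *\<^sub>R ((e * ip (f r *\<^sub>R yv) (n r)) *\<^sub>R n r - (e * ip (f r *\<^sub>R yv) (m r)) *\<^sub>R m r)"
      using G r second_fund_form_xy[OF pm] unfolding normal_part_frame[OF pm] zz
      by (simp_all add: geometric_frame_field_def ip_simps ips)
    have s1: "ip xu (n r) = e * (f r * \<nu> r)" "ip xu (m r) = 0"
      using arg_cong[OF sff(1), of "\<lambda>w. ip w (n r)"] arg_cong[OF sff(1), of "\<lambda>w. ip w (m r)"] f0[OF r] e
      by (auto simp: ip_simps ips field_simps power2_eq_square)
    have s2: "ip yu (n r) = 0" "ip yu (m r) = - e * (f r * \<mu> r)"
      using arg_cong[OF sff(2), of "\<lambda>w. ip w (n r)"] arg_cong[OF sff(2), of "\<lambda>w. ip w (m r)"] f0[OF r] e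
      by (auto simp: ip_simps ips field_simps power2_eq_square)
    have s3: "ip yv (n r) = e * (f r * \<nu> r)" "ip yv (m r) = 0"
      using arg_cong[OF sff(3), of "\<lambda>w. ip w (n r)"] arg_cong[OF sff(3), of "\<lambda>w. ip w (m r)"] f0[OF r] e
      by (auto simp: ip_simps ips field_simps power2_eq_square)
    have "f r * ip xv (n r) = f r * 0" "f r * ip xv (m r) = f r * (- e * (f r * \<mu> r))"
      using arg_cong[OF mixed, of "\<lambda>w. ip w (n r)"] arg_cong[OF mixed, of "\<lambda>w. ip w (m r)"]
      by (simp_all add: ip_simps ips s2)
    then have s4: "ip xv (n r) = 0" "ip xv (m r) = - e * (f r * \<mu> r)"
      unfolding mult_left_cancel[OF f0[OF r]] .
    have "f r * ip xv (y r) = f r * (- p r)" "f r * ip xu (y r) = f r * (- q r)"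
      using arg_cong[OF mixed, of "\<lambda>w. ip w (x r)"] arg_cong[OF mixed, of "\<lambda>w. ip w (y r)"]
      by (simp_all add: ip_simps ips k1 k2)
    then have s5: "ip xv (y r) = - p r" "ip xu (y r) = - q r"
      unfolding mult_left_cancel[OF f0[OF r]] .
    have \<alpha>: "\<alpha> r = f r * \<nu> r" and \<beta>: "\<beta> r = f r * \<mu> r"
      using s1 s4 e by (auto simp: \<alpha>_def \<beta>_def defs)
    have b: "ip nu (m r) = - e * b r" "ip nv (m r) = - e * c r"
      using e by (auto simp: b_def c_def defs)
    note ex = orthonormal_basis4_expand[OF basis[OF r], symmetric, unfolded frame_transport_def]
    have "xu = q r *\<^sub>R y r + \<alpha> r *\<^sub>R n r" "xv = p r *\<^sub>R y r + \<beta> r *\<^sub>R m r"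
      "yu = q r *\<^sub>R x r + \<beta> r *\<^sub>R m r" "yv = p r *\<^sub>R x r + \<alpha> r *\<^sub>R n r"
      "nu = - (e * \<alpha> r) *\<^sub>R x r + b r *\<^sub>R m r" "nv = (e * \<alpha> r) *\<^sub>R y r + c r *\<^sub>R m r"
      "mu = - (e * \<beta> r) *\<^sub>R y r + b r *\<^sub>R n r" "mv = (e * \<beta> r) *\<^sub>R x r + c r *\<^sub>R n r"
      by (rule trans[OF ex], use e in \<open>auto simp: k1 k2 s1 s2 s3 s4 s5 b \<alpha> \<beta>\<close>)+
    then show ?thesis using \<alpha> \<beta> hx hy hn hm by simp
  qed
  have \<alpha>\<beta>: "\<alpha> r = f r * \<nu> r" "\<beta> r = f r * \<mu> r" if "r \<in> D" for r
    using main[OF that] by blast+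
  have fsq': "(f r)\<^sup>2 = 1 / sqrt \<bar>(\<mu> r)\<^sup>2 - (\<nu> r)\<^sup>2\<bar>" if "r \<in> D" for r
    using fsq[OF that] cp(3)[OF that] by (rule trans)
  have "has_partials z (f r *\<^sub>R x r) (f r *\<^sub>R y r) r" if "r \<in> D" for r
    using smooth_on_has_partials[OF D z that] unfolding zu[OF that] zv[OF that] .
  then have mf: "moving_frame D e f p q \<alpha> \<beta> b c z x y n m"
    unfolding moving_frame_def using main by blast
  show thesis
    by (rule that[of f p q \<alpha> \<beta> b c]) (fact fsm psm asm f df fsq' \<alpha>\<beta> mf)+
qed

text \<open>Non-zero \<alpha> and \<beta> put both n and m into the first normal space, which is
  therefore the whole normal plane. The curvature inequality holds everywhere, so D itself serves as
  the dense open set and the given frame as the local one.\<close>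

lemma moving_frame_general_type:
  assumes D: "open D" and F: "moving_frame D e f p q \<alpha> \<beta> b c z x y n m"
    and o: "\<And>r. r \<in> D \<Longrightarrow> orthonormal_basis4 e (x r) (y r) (n r) (m r)"
    and f: "\<And>r. r \<in> D \<Longrightarrow> f r > 0"
    and df: "\<And>r. r \<in> D \<Longrightarrow> has_partials f (f r * p r) (f r * q r) r"
    and sm: "smooth_on D z" "smooth_on D x" "smooth_on D y" "smooth_on D n" "smooth_on D m"
    and e: "e \<in> {1, - 1}" and nz: "\<And>r. r \<in> D \<Longrightarrow> \<alpha> r \<noteq> 0" "\<And>r. r \<in> D \<Longrightarrow> \<beta> r \<noteq> 0"
    and K: "\<And>r. r \<in> D \<Longrightarrow> (gauss_curvature z x y r)\<^sup>2 - (normal_curvature z x y n m r)\<^sup>2 > 0"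
  shows "orthonormal_frame_field D z e x y n m" "minimal_lorentz_general_type D z"
proof -
  have pz: "partial_u z r = f r *\<^sub>R x r" "partial_v z r = f r *\<^sub>R y r" if "r \<in> D" for r
    using has_partials_imp[OF moving_frame_partials(1)[OF F that]] by auto
  have ts: "tangent_space z r = span {x r, y r}" if "r \<in> D" for r
    using tangent_space_frame[OF pz[OF that] f[OF that] o[OF that]] .
  show fr: "orthonormal_frame_field D z e x y n m"
    unfolding orthonormal_frame_field_def
  proof (intro conjI ballI)
    fix r assume r: "r \<in> D"
    note ips = orthonormal_basis4_ip[OF o[OF r]]
    show "x r \<in> tangent_space z r" "y r \<in> tangent_space z r"
      using ts[OF r] by (auto intro: span_base)
    show "n r \<in> normal_space z r" "m r \<in> normal_space z r"
      using mem_normal_space_frame[OF pz[OF r] f[OF r] o[OF r]] ips by auto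
    show "ip (x r) (x r) = 1" "ip (y r) (y r) = - 1" "ip (x r) (y r) = 0"
      "ip (n r) (n r) = e" "ip (m r) (m r) = - e" "ip (n r) (m r) = 0" by (simp_all add: ips)
  qed (use sm e in auto)
  have "dim (first_normal_space z r) = 2" if r: "r \<in> D" for r
  proof -
    note ips = orthonormal_basis4_ip[OF o[OF r]]
    let ?S = "{second_fund_form z r X Y | X Y. X \<in> tangent_space z r \<and> Y \<in> tangent_space z r}"
    have sf: "second_fund_form z r (x r) (x r) = (\<alpha> r / f r) *\<^sub>R n r"
      "second_fund_form z r (x r) (y r) = (\<beta> r / f r) *\<^sub>R m r"
      by (rule second_fund_form_moving_frame[OF D F o f df r]; assumption)+
    have xy: "x r \<in> tangent_space z r" "y r \<in> tangent_space z r"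
      using ts[OF r] by (auto intro: span_base)
    have np: "normal_part z r w \<in> span {n r, m r}" for w
      unfolding normal_part_frame[OF pz[OF r] f[OF r] o[OF r]]
      by (intro span_diff span_scale span_base) auto
    have "?S \<subseteq> span {n r, m r}"
    proof clarify
      fix X Y
      show "second_fund_form z r X Y \<in> span {n r, m r}"
        unfolding second_fund_form_def
        by (simp add: np split: prod.split)
    qed
    moreover have "n r \<in> span ?S"
    proof -
      have "second_fund_form z r (x r) (x r) \<in> span ?S" using xy by (intro span_base) blast
      then have "(f r / \<alpha> r) *\<^sub>R ((\<alpha> r / f r) *\<^sub>R n r) \<in> span ?S" unfolding sf by (rule span_scale)
      then show ?thesis using f[OF r] nz[OF r] by simp
    qed
    moreover have "m r \<in> span ?S"
    proof -
      have "second_fund_form z r (x r) (y r) \<in> span ?S" using xy by (intro span_base) blast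
      then have "(f r / \<beta> r) *\<^sub>R ((\<beta> r / f r) *\<^sub>R m r) \<in> span ?S" unfolding sf by (rule span_scale)
      then show ?thesis using f[OF r] nz[OF r] by simp
    qed
    ultimately have eq: "first_normal_space z r = span {n r, m r}"
      unfolding first_normal_space_def by (intro span_eq[THEN iffD2] conjI) auto
    have ne: "n r \<noteq> m r"
    proof
      assume "n r = m r"
      then have "ip (n r) (n r) = ip (m r) (m r)" by simp
      then show False unfolding ips(4,5) using e by auto
    qed
    have "m r \<noteq> 0"
    proof
      assume "m r = 0"
      then have "ip (m r) (m r) = 0" by (simp add: ip_simps)
      then show False unfolding ips(5) using e by auto
    qed
    have "n r \<notin> span {m r}"
    proof
      assume "n r \<in> span {m r}"
      then obtain k where "n r = k *\<^sub>R m r" by (auto simp: span_singleton)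
      then have "ip (n r) (n r) = k * ip (n r) (m r)"
        using ip.scaleR_right[of "n r" k "m r"] by simp
      then show False unfolding ips(4,11) using e by auto
    qed
    then have "independent {n r, m r}"
      using \<open>m r \<noteq> 0\<close> ne by (simp add: independent_insert dependent_single)
    then have "dim {n r, m r} = 2" using dim_eq_card_independent[of "{n r, m r}"] ne by simp
    then show ?thesis unfolding eq by simp
  qed
  moreover have "lorentz_surface D z"
    unfolding lorentz_surface_def
  proof (intro conjI ballI)
    show "\<exists>x y. tangent_space z r = span {x, y} \<and> ip x x = 1 \<and> ip x y = 0 \<and> ip y y = - 1" if r: "r \<in> D" for r
      using ts[OF r] orthonormal_basis4_ip[OF o[OF r]] by blast
  qed (rule sm)
  moreover have "minimal_surface D z"
    unfolding minimal_surface_def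
    by (rule ballI, rule mean_curvature_moving_frame[OF D F o f df]; assumption)
  moreover have "\<forall>r\<in>D. \<exists>W \<epsilon> x y n\<^sub>1 n\<^sub>2. open W \<and> r \<in> W \<and> W \<subseteq> D \<and>
      orthonormal_frame_field W z \<epsilon> x y n\<^sub>1 n\<^sub>2 \<and>
      0 < (gauss_curvature z x y r)\<^sup>2 - (normal_curvature z x y n\<^sub>1 n\<^sub>2 r)\<^sup>2"
  proof
    fix r assume "r \<in> D"
    with D fr K[of r] show "\<exists>W \<epsilon> x y n\<^sub>1 n\<^sub>2. open W \<and> r \<in> W \<and> W \<subseteq> D \<and>
      orthonormal_frame_field W z \<epsilon> x y n\<^sub>1 n\<^sub>2 \<and>
      0 < (gauss_curvature z x y r)\<^sup>2 - (normal_curvature z x y n\<^sub>1 n\<^sub>2 r)\<^sup>2"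
      by blast
  qed
  ultimately show "minimal_lorentz_general_type D z"
    unfolding minimal_lorentz_general_type_def
    using D closure_subset[of D] by blast
qed

section \<open>Uniqueness\<close>

lemma realizes_moving_frame:
  assumes D: "open D" and R: "realizes D K \<kappa> e z \<mu> \<nu>"
  obtains f p q \<alpha> \<beta> b c x y n m where
    "smooth_on D f" "smooth_on D p" "smooth_on D q" "smooth_on D \<alpha>" "smooth_on D \<beta>"
    "smooth_on D b" "smooth_on D c" "smooth_on D x" "smooth_on D y" "smooth_on D n" "smooth_on D m"
    "\<And>r. r \<in> D \<Longrightarrow> f r > 0" "\<And>r. r \<in> D \<Longrightarrow> has_partials f (f r * p r) (f r * q r) r"
    "\<And>r. r \<in> D \<Longrightarrow> (f r)\<^sup>2 = 1 / sqrt \<bar>(\<mu> r)\<^sup>2 - (\<nu> r)\<^sup>2\<bar>"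
    "\<And>r. r \<in> D \<Longrightarrow> \<alpha> r = f r * \<nu> r" "\<And>r. r \<in> D \<Longrightarrow> \<beta> r = f r * \<mu> r"
    "moving_frame D e f p q \<alpha> \<beta> b c z x y n m"
    "\<And>r. r \<in> D \<Longrightarrow> orthonormal_basis4 e (x r) (y r) (n r) (m r)"
    "\<And>r. r \<in> D \<Longrightarrow> K r = - e * ((\<mu> r)\<^sup>2 + (\<nu> r)\<^sup>2)" "\<And>r. r \<in> D \<Longrightarrow> \<kappa> r = - 2 * \<mu> r * \<nu> r"
    "\<And>r. r \<in> D \<Longrightarrow> \<mu> r \<noteq> 0" "\<And>r. r \<in> D \<Longrightarrow> \<nu> r \<noteq> 0" "D \<noteq> {} \<Longrightarrow> e \<in> {1, - 1}"
proof -
  obtain x y n m where G: "geometric_frame_field D z e x y n m \<mu> \<nu>"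
    and C: "canonical_parameters D z x y \<mu> \<nu>"
    and K: "\<And>r. r \<in> D \<Longrightarrow> gauss_curvature z x y r = K r"
      "\<And>r. r \<in> D \<Longrightarrow> normal_curvature z x y n m r = \<kappa> r"
    using R unfolding realizes_def by blast
  have z: "smooth_on D z"
    using R by (simp add: realizes_def minimal_lorentz_general_type_def lorentz_surface_def)
  have fr: "orthonormal_frame_field D z e x y n m" using G by (simp add: geometric_frame_field_def)
  have sm: "smooth_on D x" "smooth_on D y" "smooth_on D n" "smooth_on D m" and e: "e \<in> {1, - 1}"
    using fr by (auto simp: orthonormal_frame_field_def)
  note basis = orthonormal_frame_field_basis[OF fr]
  obtain f p q \<alpha> \<beta> b c where f: "smooth_on D f" "smooth_on D p" "smooth_on D q" "smooth_on D \<alpha>"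
    "smooth_on D \<beta>" "smooth_on D b" "smooth_on D c"
    "\<And>r. r \<in> D \<Longrightarrow> f r > 0" "\<And>r. r \<in> D \<Longrightarrow> has_partials f (f r * p r) (f r * q r) r"
    "\<And>r. r \<in> D \<Longrightarrow> (f r)\<^sup>2 = 1 / sqrt \<bar>(\<mu> r)\<^sup>2 - (\<nu> r)\<^sup>2\<bar>"
    "\<And>r. r \<in> D \<Longrightarrow> \<alpha> r = f r * \<nu> r" "\<And>r. r \<in> D \<Longrightarrow> \<beta> r = f r * \<mu> r"
    and F: "moving_frame D e f p q \<alpha> \<beta> b c z x y n m"
    using geometric_frame_imp_moving_frame[OF D z G C] by metis
  have ricci: "partial_v b r - partial_u c r = 2 * e * \<alpha> r * \<beta> r" if "r \<in> D" for r
    by (rule moving_frame_compat(3)[OF D F basis sm(1-3) f(2-7) that])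
  have "gauss_curvature z x y r = - e * ((\<alpha> r)\<^sup>2 + (\<beta> r)\<^sup>2) / (f r)\<^sup>2" if "r \<in> D" for r
    by (rule gauss_curvature_moving_frame[OF D F basis f(8,9) that])
  moreover have "- e * ((f r * \<nu> r)\<^sup>2 + (f r * \<mu> r)\<^sup>2) / (f r)\<^sup>2 = - e * ((\<mu> r)\<^sup>2 + (\<nu> r)\<^sup>2)" if "r \<in> D" for r
  proof -
    have "(f r * \<nu> r)\<^sup>2 + (f r * \<mu> r)\<^sup>2 = ((\<mu> r)\<^sup>2 + (\<nu> r)\<^sup>2) * (f r)\<^sup>2"
      by (simp add: power_mult_distrib algebra_simps)
    then show ?thesis using f(8)[OF that] by simp
  qed
  ultimately have K1: "K r = - e * ((\<mu> r)\<^sup>2 + (\<nu> r)\<^sup>2)" if "r \<in> D" for r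
    using K(1)[OF that] f(11,12)[OF that] that by simp
  have "normal_curvature z x y n m r = - 2 * \<alpha> r * \<beta> r / (f r)\<^sup>2" if "r \<in> D" for r
    by (rule normal_curvature_moving_frame[OF D F basis f(8,9) f(6,7) ricci that])
  then have K2: "\<kappa> r = - 2 * \<mu> r * \<nu> r" if "r \<in> D" for r
    using K(2)[OF that] f(8)[OF that] that f(11,12)[OF that]
    by (simp add: power2_eq_square field_simps)
  have nz: "\<mu> r \<noteq> 0" "\<nu> r \<noteq> 0" if "r \<in> D" for r
    using G that by (auto simp: geometric_frame_field_def)
  show thesis
    by (rule that[of f p q \<alpha> \<beta> b c x y n m]) (fact f sm F basis K1 K2 nz e | rule e)+
qed

lemma continuous_nonzero_sgn_constant:
  fixes g :: "'a::topological_space \<Rightarrow> real"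
  assumes "connected D" "continuous_on D g" "\<And>r. r \<in> D \<Longrightarrow> g r \<noteq> 0"
  shows "\<exists>\<delta>\<in>{1, - 1}. \<forall>r\<in>D. sgn (g r) = \<delta>"
proof (rule ccontr)
  assume "\<not> ?thesis"
  then obtain r s where rs: "r \<in> D" "s \<in> D" "sgn (g r) \<noteq> 1" "sgn (g s) \<noteq> - 1" by blast
  then have "g r < 0" "g s > 0" using assms(3)[of r] assms(3)[of s]
    by (auto simp: sgn_if split: if_splits)
  then have "0 \<in> g ` D"
    using connectedD_interval[OF connected_continuous_image[OF assms(2,1)], of "g r" "g s" 0] rs by auto
  then show False using assms(3) by auto
qed

text \<open>Continuity is recovered from \<mu> = \<beta> / f and \<nu> = \<alpha> / f; it is what
  makes the signs constant on connected domains.\<close>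

lemma realizes_continuous:
  assumes D: "open D" and R: "realizes D K \<kappa> e z \<mu> \<nu>"
  shows "continuous_on D \<mu>" "continuous_on D \<nu>"
proof -
  obtain f p q \<alpha> \<beta> b c x y n m where f: "smooth_on D f" "smooth_on D \<alpha>" "smooth_on D \<beta>"
    "\<And>r. r \<in> D \<Longrightarrow> f r > 0"
    "\<And>r. r \<in> D \<Longrightarrow> \<alpha> r = f r * \<nu> r" "\<And>r. r \<in> D \<Longrightarrow> \<beta> r = f r * \<mu> r"
    by (rule realizes_moving_frame[OF D R]) blast
  have f0: "f r \<noteq> 0" if "r \<in> D" for r using f(4)[OF that] by simp
  have c: "continuous_on D (\<lambda>r. \<beta> r / f r)" "continuous_on D (\<lambda>r. \<alpha> r / f r)"
    using f0 smooth_on_imp_continuous_on f(1-3) by (auto intro!: continuous_on_divide)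
  have "\<beta> r / f r = \<mu> r" "\<alpha> r / f r = \<nu> r" if "r \<in> D" for r
    using f0[OF that] f(5,6)[OF that] by simp_all
  then show "continuous_on D \<mu>" "continuous_on D \<nu>"
    using c by (auto elim: continuous_on_eq)
qed

lemma realizes_curvatures:
  assumes D: "open D" and R: "realizes D K \<kappa> e z \<mu> \<nu>" and r: "r \<in> D"
  shows "e \<in> {1, - 1}" "K r = - e * ((\<mu> r)\<^sup>2 + (\<nu> r)\<^sup>2)" "\<kappa> r = - 2 * \<mu> r * \<nu> r" "\<mu> r \<noteq> 0" "\<nu> r \<noteq> 0"
    "(K r)\<^sup>2 - (\<kappa> r)\<^sup>2 = ((\<mu> r)\<^sup>2 - (\<nu> r)\<^sup>2)\<^sup>2"
proof -
  have "D \<noteq> {}" using r by auto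
  show *: "e \<in> {1, - 1}" "K r = - e * ((\<mu> r)\<^sup>2 + (\<nu> r)\<^sup>2)" "\<kappa> r = - 2 * \<mu> r * \<nu> r" "\<mu> r \<noteq> 0" "\<nu> r \<noteq> 0"
    by (rule realizes_moving_frame[OF D R], use r \<open>D \<noteq> {}\<close> in blast)+
  have "e\<^sup>2 = 1" using *(1) by auto
  then show "(K r)\<^sup>2 - (\<kappa> r)\<^sup>2 = ((\<mu> r)\<^sup>2 - (\<nu> r)\<^sup>2)\<^sup>2"
    unfolding *(2,3) by (simp add: power_mult_distrib) (simp add: power2_eq_square algebra_simps)
qed

text \<open>K = -e' (\<mu>^2 + \<nu>^2) ties e' to the sign of K. The continuous function \<mu>^2 -
  \<nu>^2 has square K^2 - \<kappa>^2, so it never vanishes.\<close>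

lemma realizes_sign_unique:
  assumes D: "open D" "connected D" "D \<noteq> {}"
    and K: "\<And>r. r \<in> D \<Longrightarrow> e * K r < 0" "\<And>r. r \<in> D \<Longrightarrow> (K r)\<^sup>2 - (\<kappa> r)\<^sup>2 > 0" and e: "e \<in> {1, - 1}"
    and R: "realizes D K \<kappa> e' z \<mu> \<nu>"
  shows "e' = e" "\<exists>\<delta>\<in>{1, - 1}. \<forall>r\<in>D. sgn ((\<mu> r)\<^sup>2 - (\<nu> r)\<^sup>2) = \<delta>"
proof -
  note c = realizes_curvatures[OF D(1) R]
  obtain r where r: "r \<in> D" using D(3) by auto
  have "(\<mu> r)\<^sup>2 + (\<nu> r)\<^sup>2 > 0" using c(4)[OF r] by (simp add: add_pos_nonneg)
  then show "e' = e" using K(1)[OF r] c(1)[OF r] e unfolding c(2)[OF r] by (auto simp: mult_less_0_iff)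
  show "\<exists>\<delta>\<in>{1, - 1}. \<forall>r\<in>D. sgn ((\<mu> r)\<^sup>2 - (\<nu> r)\<^sup>2) = \<delta>"
  proof (rule continuous_nonzero_sgn_constant[OF D(2)])
    show "continuous_on D (\<lambda>r. (\<mu> r)\<^sup>2 - (\<nu> r)\<^sup>2)"
      by (intro continuous_intros realizes_continuous[OF D(1) R])
    show "(\<mu> r)\<^sup>2 - (\<nu> r)\<^sup>2 \<noteq> 0" if "r \<in> D" for r
      using K(2)[OF that] c(6)[OF that] by auto
  qed
qed

text \<open>K and \<kappa> give \<mu>^2 + \<nu>^2, \<mu> \<nu> and |\<mu>^2 - \<nu>^2|; with the
  sign of the difference they determine the pair (\<mu>, \<nu>) up to a common sign, constant by
  connectedness. Reversing both normals of one surface removes it. Then all coefficients of the two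
  moving frames agree.\<close>

lemma realizes_unique:
  assumes D: "open D" "connected D" "D \<noteq> {}"
    and K: "\<And>r. r \<in> D \<Longrightarrow> (K r)\<^sup>2 - (\<kappa> r)\<^sup>2 > 0"
    and R: "realizes D K \<kappa> e z \<mu> \<nu>" and R': "realizes D K \<kappa> e z' \<mu>' \<nu>'"
    and sgn: "\<And>r. r \<in> D \<Longrightarrow> sgn ((\<mu> r)\<^sup>2 - (\<nu> r)\<^sup>2) = sgn ((\<mu>' r)\<^sup>2 - (\<nu>' r)\<^sup>2)"
  shows "\<exists>g. rigid_motion g \<and> (\<forall>r\<in>D. z' r = g (z r))"
proof -
  note k = realizes_curvatures[OF D(1) R] and k' = realizes_curvatures[OF D(1) R']
  have diff: "(\<mu> r)\<^sup>2 - (\<nu> r)\<^sup>2 = (\<mu>' r)\<^sup>2 - (\<nu>' r)\<^sup>2" if r: "r \<in> D" for r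
  proof -
    have "((\<mu> r)\<^sup>2 - (\<nu> r)\<^sup>2)\<^sup>2 = ((\<mu>' r)\<^sup>2 - (\<nu>' r)\<^sup>2)\<^sup>2"
      using k(6)[OF r] k'(6)[OF r] by simp
    then have "\<bar>(\<mu> r)\<^sup>2 - (\<nu> r)\<^sup>2\<bar> = \<bar>(\<mu>' r)\<^sup>2 - (\<nu>' r)\<^sup>2\<bar>" by (simp only: power2_eq_iff abs_eq_iff)
    then show ?thesis using sgn[OF r] sgn_mult_abs by metis
  qed
  have sum: "(\<mu> r)\<^sup>2 + (\<nu> r)\<^sup>2 = (\<mu>' r)\<^sup>2 + (\<nu>' r)\<^sup>2" if r: "r \<in> D" for r
    using k(2)[OF r] k'(2)[OF r] k(1)[OF r] by auto
  have sq: "(\<mu> r)\<^sup>2 = (\<mu>' r)\<^sup>2" if r: "r \<in> D" for r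
    using diff[OF r] sum[OF r] by linarith
  have prod: "\<mu> r * \<nu> r = \<mu>' r * \<nu>' r" if r: "r \<in> D" for r
    using k(3)[OF r] k'(3)[OF r] by simp
  \<comment> \<open>The sign s of this product is the common sign by which the two pairs may
    differ.\<close>
  have "continuous_on D (\<lambda>r. \<mu> r * \<mu>' r)"
    using realizes_continuous(1)[OF D(1)] R R' by (intro continuous_on_mult) blast+
  then obtain s where s: "s \<in> {1, - 1}" "\<And>r. r \<in> D \<Longrightarrow> sgn (\<mu> r * \<mu>' r) = s"
    using continuous_nonzero_sgn_constant[OF D(2), of "\<lambda>r. \<mu> r * \<mu>' r"] k(4) k'(4) by fastforce
  have \<mu>: "\<mu> r = s * \<mu>' r" and \<nu>: "\<nu> r = s * \<nu>' r" if r: "r \<in> D" for r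
  proof -
    have "\<mu> r = \<mu>' r \<or> \<mu> r = - \<mu>' r" using sq[OF r] by (simp add: power2_eq_iff)
    then show 1: "\<mu> r = s * \<mu>' r"
    proof
      assume "\<mu> r = \<mu>' r"
      moreover have "\<mu>' r * \<mu>' r > 0" using k'(4)[OF r] not_real_square_gt_zero by blast
      ultimately show ?thesis using s(2)[OF r] by simp
    next
      assume "\<mu> r = - \<mu>' r"
      moreover have "\<mu>' r * \<mu>' r > 0" using k'(4)[OF r] not_real_square_gt_zero by blast
      ultimately show ?thesis using s(2)[OF r] by auto
    qed
    have "\<mu>' r * (s * \<nu> r) = \<mu>' r * \<nu>' r" using prod[OF r] unfolding 1 by (simp add: ac_simps)
    then have "s * \<nu> r = \<nu>' r" using k'(4)[OF r] by simp
    then show "\<nu> r = s * \<nu>' r" using s(1) by auto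
  qed
  obtain f p q \<alpha> \<beta> b c x y n m where
    sm: "smooth_on D f" "smooth_on D p" "smooth_on D q" "smooth_on D \<alpha>" "smooth_on D \<beta>"
    "smooth_on D b" "smooth_on D c" "smooth_on D x" "smooth_on D y" "smooth_on D n" "smooth_on D m"
    and f: "\<And>r. r \<in> D \<Longrightarrow> f r > 0" "\<And>r. r \<in> D \<Longrightarrow> has_partials f (f r * p r) (f r * q r) r"
    "\<And>r. r \<in> D \<Longrightarrow> (f r)\<^sup>2 = 1 / sqrt \<bar>(\<mu> r)\<^sup>2 - (\<nu> r)\<^sup>2\<bar>"
    "\<And>r. r \<in> D \<Longrightarrow> \<alpha> r = f r * \<nu> r" "\<And>r. r \<in> D \<Longrightarrow> \<beta> r = f r * \<mu> r"
    and F: "moving_frame D e f p q \<alpha> \<beta> b c z x y n m"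
    and o: "\<And>r. r \<in> D \<Longrightarrow> orthonormal_basis4 e (x r) (y r) (n r) (m r)"
    by (rule realizes_moving_frame[OF D(1) R], rule that; assumption)
  obtain f' p' q' \<alpha>' \<beta>' b' c' x' y' n' m' where
    sm': "smooth_on D f'" "smooth_on D p'" "smooth_on D q'" "smooth_on D \<alpha>'" "smooth_on D \<beta>'"
    "smooth_on D b'" "smooth_on D c'" "smooth_on D x'" "smooth_on D y'" "smooth_on D n'" "smooth_on D m'"
    and f': "\<And>r. r \<in> D \<Longrightarrow> f' r > 0" "\<And>r. r \<in> D \<Longrightarrow> has_partials f' (f' r * p' r) (f' r * q' r) r"
    "\<And>r. r \<in> D \<Longrightarrow> (f' r)\<^sup>2 = 1 / sqrt \<bar>(\<mu>' r)\<^sup>2 - (\<nu>' r)\<^sup>2\<bar>"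
    "\<And>r. r \<in> D \<Longrightarrow> \<alpha>' r = f' r * \<nu>' r" "\<And>r. r \<in> D \<Longrightarrow> \<beta>' r = f' r * \<mu>' r"
    and F': "moving_frame D e f' p' q' \<alpha>' \<beta>' b' c' z' x' y' n' m'"
    and o': "\<And>r. r \<in> D \<Longrightarrow> orthonormal_basis4 e (x' r) (y' r) (n' r) (m' r)"
    by (rule realizes_moving_frame[OF D(1) R'], rule that; assumption)
  have ff: "f r = f' r" if r: "r \<in> D" for r
  proof -
    have "(f r)\<^sup>2 = (f' r)\<^sup>2" using f(3)[OF r] f'(3)[OF r] diff[OF r] by simp
    then show ?thesis using f(1)[OF r] f'(1)[OF r] by (simp add: power2_eq_iff)
  qed
  have pq: "p r = p' r" "q r = q' r" if r: "r \<in> D" for r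
    using has_partials_unique[OF has_partials_cong[OF f(2)[OF r] D(1) r ff] f'(2)[OF r]] ff[OF r] f'(1)[OF r]
    by simp_all
  have ss': "s * (s * t) = t" for t using s(1) by auto
  \<comment> \<open>Multiplying both normals by s multiplies \<alpha>' and \<beta>' by s and leaves
    b' and c' unchanged, because these relate one normal to the other.\<close>
  have F2: "moving_frame D e f' p' q' (\<lambda>r. s * \<alpha>' r) (\<lambda>r. s * \<beta>' r) b' c' z' x' y' (\<lambda>r. s *\<^sub>R n' r) (\<lambda>r. s *\<^sub>R m' r)"
    unfolding moving_frame_def
  proof (intro ballI conjI)
    fix r assume r: "r \<in> D"
    note d = moving_frame_partials[OF F' r]
    note scale = has_partials_linear[OF bounded_linear_scaleR_right[of s]]
    show "has_partials z' (f' r *\<^sub>R x' r) (f' r *\<^sub>R y' r) r" by (rule d)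
    show "has_partials x' (q' r *\<^sub>R y' r + (s * \<alpha>' r) *\<^sub>R s *\<^sub>R n' r) (p' r *\<^sub>R y' r + (s * \<beta>' r) *\<^sub>R s *\<^sub>R m' r) r"
      using d(2) by (simp add: ss' mult.left_commute mult.commute[of _ s])
    show "has_partials y' (q' r *\<^sub>R x' r + (s * \<beta>' r) *\<^sub>R s *\<^sub>R m' r) (p' r *\<^sub>R x' r + (s * \<alpha>' r) *\<^sub>R s *\<^sub>R n' r) r"
      using d(3) by (simp add: ss' mult.left_commute mult.commute[of _ s])
    show "has_partials (\<lambda>r. s *\<^sub>R n' r) (- (e * (s * \<alpha>' r)) *\<^sub>R x' r + b' r *\<^sub>R s *\<^sub>R m' r)
        ((e * (s * \<alpha>' r)) *\<^sub>R y' r + c' r *\<^sub>R s *\<^sub>R m' r) r"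
      using scale[OF d(4)] by (simp add: algebra_simps)
    show "has_partials (\<lambda>r. s *\<^sub>R m' r) (- (e * (s * \<beta>' r)) *\<^sub>R y' r + b' r *\<^sub>R s *\<^sub>R n' r)
        ((e * (s * \<beta>' r)) *\<^sub>R x' r + c' r *\<^sub>R s *\<^sub>R n' r) r"
      using scale[OF d(5)] by (simp add: algebra_simps)
  qed
  have o2: "orthonormal_basis4 e (x' r) (y' r) (s *\<^sub>R n' r) (s *\<^sub>R m' r)" if "r \<in> D" for r
    using o'[OF that] s(1) by (auto simp: orthonormal_basis4_def ip_simps)
  have \<alpha>\<beta>: "\<alpha> r = s * \<alpha>' r" "\<beta> r = s * \<beta>' r" if r: "r \<in> D" for r
    using f(4,5)[OF r] f'(4,5)[OF r] \<mu>[OF r] \<nu>[OF r] ff[OF r] by simp_all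
  have sm2: "smooth_on D (\<lambda>r. s * \<alpha>' r)" "smooth_on D (\<lambda>r. s * \<beta>' r)" "smooth_on D (\<lambda>r. s *\<^sub>R n' r)"
    by (intro smooth_on_mult smooth_on_scaleR smooth_on_const D sm')+
  \<comment> \<open>The normal connection is not independent data: since \<beta> does not vanish,
    two Codazzi equations solve for b and c.\<close>
  have bc: "b r = b' r" "c r = c' r" if r: "r \<in> D" for r
  proof -
    have pa: "partial_v \<alpha> r = partial_v (\<lambda>r. s * \<alpha>' r) r" "partial_u \<alpha> r = partial_u (\<lambda>r. s * \<alpha>' r) r"
      by (rule partial_cong[OF D(1) r]; simp add: \<alpha>\<beta>)+
    have "partial_v \<alpha> r + q r * \<alpha> r = \<beta> r * b r" "partial_u \<alpha> r + p r * \<alpha> r = \<beta> r * c r"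
      by (rule moving_frame_compat[OF D(1) F o sm(8,9,10,2-7) r]; assumption)+
    moreover have "partial_v (\<lambda>r. s * \<alpha>' r) r + q' r * (s * \<alpha>' r) = (s * \<beta>' r) * b' r"
      "partial_u (\<lambda>r. s * \<alpha>' r) r + p' r * (s * \<alpha>' r) = (s * \<beta>' r) * c' r"
      by (rule moving_frame_compat[OF D(1) F2 o2 sm'(8,9) sm2(3) sm'(2,3) sm2(1,2) sm'(6,7) r]; assumption)+
    ultimately have "\<beta> r * b r = \<beta> r * b' r" "\<beta> r * c r = \<beta> r * c' r"
      using pa pq[OF r] \<alpha>\<beta>[OF r] by auto
    moreover have "\<beta> r \<noteq> 0" using f(1,5)[OF r] k(4)[OF r] by simp
    ultimately show "b r = b' r" "c r = c' r" by simp_all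
  qed
  have F3: "moving_frame D e f p q \<alpha> \<beta> b c z' x' y' (\<lambda>r. s *\<^sub>R n' r) (\<lambda>r. s *\<^sub>R m' r)"
    using F2 unfolding moving_frame_def by (simp add: ff pq \<alpha>\<beta> bc)
  show ?thesis by (rule moving_frame_unique[OF D F F3 o o2])
qed

section \<open>Existence\<close>

lemma hyp_laplacian_cong:
  assumes "open S" "p \<in> S" "\<And>q. q \<in> S \<Longrightarrow> f q = g q"
  shows "hyp_laplacian f p = hyp_laplacian g p"
proof -
  have "partial_u (partial_u f) p = partial_u (partial_u g) p"
    by (rule partial_cong(1)[OF assms(1,2)], rule partial_cong(1)[OF assms(1) _ assms(3)])
  moreover have "partial_v (partial_v f) p = partial_v (partial_v g) p"
    by (rule partial_cong(2)[OF assms(1,2)], rule partial_cong(2)[OF assms(1) _ assms(3)])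
  ultimately show ?thesis by (simp add: hyp_laplacian_def)
qed

lemma hyp_laplacian_cmult:
  fixes g :: "real \<times> real \<Rightarrow> real"
  assumes S: "open S" "smooth_on S g" "p \<in> S"
  shows "hyp_laplacian (\<lambda>q. k * g q) p = k * hyp_laplacian g p"
proof -
  have d: "partial_u (\<lambda>q. k * h q) q = k * partial_u h q" "partial_v (\<lambda>q. k * h q) q = k * partial_v h q"
    if "smooth_on S h" "q \<in> S" for h :: "real \<times> real \<Rightarrow> real" and q
    using has_partials_imp[OF has_partials_mult[OF has_partials_const[of k]
          smooth_on_has_partials[OF S(1) that]]] by simp_all
  have "partial_u (partial_u (\<lambda>q. k * g q)) p = partial_u (\<lambda>q. k * partial_u g q) p"
    by (rule partial_cong(1)[OF S(1,3)]) (rule d[OF S(2)])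
  moreover have "partial_v (partial_v (\<lambda>q. k * g q)) p = partial_v (\<lambda>q. k * partial_v g q) p"
    by (rule partial_cong(2)[OF S(1,3)]) (rule d[OF S(2)])
  ultimately show ?thesis
    using d[OF smooth_on_partial(1)[OF S(2)] S(3)] d[OF smooth_on_partial(2)[OF S(2)] S(3)]
    by (simp add: hyp_laplacian_def algebra_simps)
qed

lemma curvature_quotient_pos:
  fixes K \<kappa> e :: real
  assumes "K\<^sup>2 - \<kappa>\<^sup>2 > 0" "e \<in> {1, - 1}"
  shows "(K + e * \<kappa>) / (K - e * \<kappa>) > 0"
proof -
  have "(K + e * \<kappa>) * (K - e * \<kappa>) > 0"
    using assms by (auto simp: power2_eq_square algebra_simps)
  then show ?thesis by (simp add: zero_less_mult_iff zero_less_divide_iff)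
qed

text \<open>Replacing \<open>\<epsilon>\<close> by \<open>- \<epsilon>\<close> changes the sign of both sides of the second equation.\<close>

lemma natural_equations_uminus:
  assumes D: "open D" and K: "\<And>p. p \<in> D \<Longrightarrow> (K p)\<^sup>2 - (\<kappa> p)\<^sup>2 > 0"
    and sm: "smooth_on D K" "smooth_on D \<kappa>"
    and e: "e \<in> {1, - 1}" and N: "natural_equations D e K \<kappa>"
  shows "natural_equations D (- e) K \<kappa>"
  unfolding natural_equations_def
proof (intro ballI conjI)
  fix p assume p: "p \<in> D"
  let ?g = "\<lambda>q. ln ((K q + e * \<kappa> q) / (K q - e * \<kappa> q))"
  have pos: "(K q + e * \<kappa> q) / (K q - e * \<kappa> q) > 0" if "q \<in> D" for q
    by (rule curvature_quotient_pos[OF K[OF that] e])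
  have nz: "K q - e * \<kappa> q \<noteq> 0" if "q \<in> D" for q
    using pos[OF that] by (metis div_by_0 less_irrefl)
  have g: "smooth_on D ?g"
    by (intro smooth_on_ln smooth_on_divide smooth_on_add smooth_on_diff smooth_on_mult
        smooth_on_const D sm pos nz)
  have "hyp_laplacian (\<lambda>q. ln ((K q + - e * \<kappa> q) / (K q - - e * \<kappa> q))) p
      = hyp_laplacian (\<lambda>q. - 1 * ?g q) p"
  proof (rule hyp_laplacian_cong[OF D p])
    fix q assume "q \<in> D"
    have "(K q + - e * \<kappa> q) / (K q - - e * \<kappa> q) = inverse ((K q + e * \<kappa> q) / (K q - e * \<kappa> q))"
      by (simp add: inverse_divide)
    then show "ln ((K q + - e * \<kappa> q) / (K q - - e * \<kappa> q)) = - 1 * ?g q"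
      using pos[OF \<open>q \<in> D\<close>] by (simp only: ln_inverse)
  qed
  then have "hyp_laplacian (\<lambda>q. ln ((K q + - e * \<kappa> q) / (K q - - e * \<kappa> q))) p = - hyp_laplacian ?g p"
    using hyp_laplacian_cmult[OF D g p, of "- 1"] by simp
  then show "root 4 ((K p)\<^sup>2 - (\<kappa> p)\<^sup>2) * hyp_laplacian (\<lambda>q. ln ((K q + - e * \<kappa> q) / (K q - - e * \<kappa> q))) p
      = 4 * - e * \<kappa> p"
    using N p by (simp add: natural_equations_def)
qed (use N in \<open>simp add: natural_equations_def\<close>)

lemma realizes_exists:
  assumes D: "open D" "connected D" "simply_connected D" "D \<noteq> {}"
    and sm: "smooth_on D K" "smooth_on D \<kappa>" and \<kappa>0: "\<And>r. r \<in> D \<Longrightarrow> \<kappa> r \<noteq> 0"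
    and pos: "\<And>r. r \<in> D \<Longrightarrow> (K r)\<^sup>2 - (\<kappa> r)\<^sup>2 > 0"
    and e: "e \<in> {1, - 1}" and eK: "\<And>r. r \<in> D \<Longrightarrow> e * K r < 0"
    and N: "natural_equations D e K \<kappa>" and \<delta>: "\<delta> \<in> {1, - 1}"
  shows "\<exists>z \<mu> \<nu>. realizes D K \<kappa> e z \<mu> \<nu> \<and> (\<forall>r\<in>D. sgn ((\<mu> r)\<^sup>2 - (\<nu> r)\<^sup>2) = \<delta>)"
proof -
  define S where "S r = ln ((K r)\<^sup>2 - (\<kappa> r)\<^sup>2)" for r
  define L where "L r = ln ((K r + e * \<kappa> r) / (K r - e * \<kappa> r))" for r
  define \<phi> where "\<phi> r = - 1 / 8 * S r" for r
  define \<psi> where "\<psi> r = 1 / 4 * L r" for r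
  have qpos: "(K r + e * \<kappa> r) / (K r - e * \<kappa> r) > 0" if "r \<in> D" for r
    by (rule curvature_quotient_pos[OF pos[OF that] e])
  have nz: "K r - e * \<kappa> r \<noteq> 0" if "r \<in> D" for r
    using qpos[OF that] by (metis div_by_0 less_irrefl)
  have Ssm: "smooth_on D S" unfolding S_def[abs_def] power2_eq_square
    by (intro smooth_on_ln smooth_on_diff smooth_on_mult D sm pos[unfolded power2_eq_square])
  have Lsm: "smooth_on D L" unfolding L_def[abs_def]
    by (intro smooth_on_ln smooth_on_divide smooth_on_add smooth_on_diff smooth_on_mult
        smooth_on_const D sm qpos nz)
  have \<phi>sm: "smooth_on D \<phi>" and \<psi>sm: "smooth_on D \<psi>"
    unfolding \<phi>_def[abs_def] \<psi>_def[abs_def]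
    by (intro smooth_on_mult smooth_on_const D Ssm Lsm)+
  \<comment> \<open>For \<delta> = 1 these are sinh \<psi> and cosh \<psi>, for \<delta> = -1 the
    other way round. In both cases d/d\<psi> exchanges A and B and B^2 - A^2 = \<delta>, so the
    choice fixes the sign of \<mu>^2 - \<nu>^2.\<close>
  define A where "A r = 1 / 2 * (exp (\<psi> r) - \<delta> * exp (- \<psi> r))" for r
  define B where "B r = 1 / 2 * (exp (\<psi> r) + \<delta> * exp (- \<psi> r))" for r
  define f where "f r = exp (\<phi> r)" for r
  define p where "p = partial_u \<phi>"
  define q where "q = partial_v \<phi>"
  define b where "b = partial_v \<psi>"
  define c where "c = partial_u \<psi>"
  define \<alpha> where "\<alpha> r = A r * exp (- \<phi> r)" for r
  define \<beta> where "\<beta> r = B r * exp (- \<phi> r)" for r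
  have ABsm: "smooth_on D A" "smooth_on D B"
    unfolding A_def[abs_def] B_def[abs_def]
    by (intro smooth_on_mult smooth_on_const smooth_on_diff smooth_on_add smooth_on_exp smooth_on_minus D \<psi>sm)+
  have coefsm: "smooth_on D f" "smooth_on D p" "smooth_on D q" "smooth_on D \<alpha>" "smooth_on D \<beta>"
    "smooth_on D b" "smooth_on D c"
    unfolding f_def[abs_def] p_def q_def b_def c_def \<alpha>_def[abs_def] \<beta>_def[abs_def]
    by (intro smooth_on_mult smooth_on_exp smooth_on_minus smooth_on_partial D \<phi>sm \<psi>sm ABsm)+
  have exp_p: "has_partials (\<lambda>s. exp (g s)) (exp (g r) * partial_u g r) (exp (g r) * partial_v g r) r"
    "has_partials (\<lambda>s. exp (- g s)) (exp (- g r) * - partial_u g r) (exp (- g r) * - partial_v g r) r"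
    if "smooth_on D g" "r \<in> D" for g :: "real \<times> real \<Rightarrow> real" and r
    using has_partials_compose_real[OF smooth_on_has_partials[OF D(1) that] DERIV_exp]
      has_partials_compose_real[OF has_partials_minus[OF smooth_on_has_partials[OF D(1) that]] DERIV_exp]
    by simp_all
  have df: "has_partials f (f r * p r) (f r * q r) r" if "r \<in> D" for r
    unfolding f_def[abs_def] p_def q_def using exp_p(1)[OF \<phi>sm that] by simp
  have dA: "has_partials A (B r * c r) (B r * b r) r" and dB: "has_partials B (A r * c r) (A r * b r) r"
    if r: "r \<in> D" for r
  proof -
    note h = has_partials_mult[OF has_partials_const[of "1 / 2"]] and
      d = has_partials_mult[OF has_partials_const[of \<delta>] exp_p(2)[OF \<psi>sm r]]
    show "has_partials A (B r * c r) (B r * b r) r"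
      unfolding A_def[abs_def] B_def[abs_def] b_def c_def
      by (rule has_partials_eq_rhs[OF h[OF has_partials_diff[OF exp_p(1)[OF \<psi>sm r] d]]])
        (simp_all add: algebra_simps)
    show "has_partials B (A r * c r) (A r * b r) r"
      unfolding A_def[abs_def] B_def[abs_def] b_def c_def
      by (rule has_partials_eq_rhs[OF h[OF has_partials_add[OF exp_p(1)[OF \<psi>sm r] d]]])
        (simp_all add: algebra_simps)
  qed
  \<comment> \<open>The four Codazzi equations, with the gradient of \<psi> as normal connection:
    the factor exp(-\<phi>) produces the terms with p and q, and the exchange of A and B the right
    sides.\<close>
  have d\<alpha>: "partial_u \<alpha> r + p r * \<alpha> r = \<beta> r * c r" "partial_v \<alpha> r + q r * \<alpha> r = \<beta> r * b r"
    and d\<beta>: "partial_u \<beta> r + p r * \<beta> r = \<alpha> r * c r" "partial_v \<beta> r + q r * \<beta> r = \<alpha> r * b r"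
    if r: "r \<in> D" for r
    using has_partials_imp[OF has_partials_mult[OF dA[OF r] exp_p(2)[OF \<phi>sm r]]]
      has_partials_imp[OF has_partials_mult[OF dB[OF r] exp_p(2)[OF \<phi>sm r]]]
    by (simp_all add: \<alpha>_def[abs_def] \<beta>_def[abs_def] p_def q_def algebra_simps)
  have \<delta>2: "\<delta> * \<delta> = 1" using \<delta> by auto
  define H where "H r = - e * K r" for r
  \<comment> \<open>The left sides will be (\<mu> + \<nu>)^2 and (\<mu> - \<nu>)^2; the coefficients
    1/8 and 1/4 in \<phi> and \<psi> are chosen to make these two identities hold.\<close>
  have key: "exp (- 4 * \<phi> r) * exp (2 * \<psi> r) = H r - \<kappa> r" "exp (- 4 * \<phi> r) * exp (- 2 * \<psi> r) = H r + \<kappa> r"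
    if r: "r \<in> D" for r
  proof -
    have H: "H r > 0" using eK[OF r] by (simp add: H_def)
    have "(H r - \<kappa> r) * (H r + \<kappa> r) = (K r)\<^sup>2 - (\<kappa> r)\<^sup>2"
      using e by (auto simp: H_def power2_eq_square algebra_simps)
    then have prod: "(H r - \<kappa> r) * (H r + \<kappa> r) > 0" using pos[OF r] by simp
    \<comment> \<open>The product of the two factors is positive and their sum is 2 H > 0, so both
      are positive and their logarithms exist.\<close>
    have hp: "H r - \<kappa> r > 0" "H r + \<kappa> r > 0"
      using prod H by (auto simp: zero_less_mult_iff)
    have S: "S r = ln (H r - \<kappa> r) + ln (H r + \<kappa> r)"
      unfolding S_def \<open>(H r - \<kappa> r) * (H r + \<kappa> r) = (K r)\<^sup>2 - (\<kappa> r)\<^sup>2\<close>[symmetric]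
      using hp by (simp add: ln_mult)
    have "(K r + e * \<kappa> r) / (K r - e * \<kappa> r) = (H r - \<kappa> r) / (H r + \<kappa> r)"
      using e hp nz[OF r] by (auto simp: H_def field_simps)
    then have L: "L r = ln (H r - \<kappa> r) - ln (H r + \<kappa> r)"
      unfolding L_def using hp by (simp add: ln_div)
    have "- 4 * \<phi> r + 2 * \<psi> r = ln (H r - \<kappa> r)" "- 4 * \<phi> r + - 2 * \<psi> r = ln (H r + \<kappa> r)"
      unfolding \<phi>_def \<psi>_def S L by (simp_all add: field_simps)
    then show "exp (- 4 * \<phi> r) * exp (2 * \<psi> r) = H r - \<kappa> r" "exp (- 4 * \<phi> r) * exp (- 2 * \<psi> r) = H r + \<kappa> r"
      unfolding exp_add[symmetric] using hp by simp_all
  qed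
  have e2\<psi>: "exp (2 * \<psi> r) = exp (\<psi> r) * exp (\<psi> r)" "exp (- 2 * \<psi> r) = exp (- \<psi> r) * exp (- \<psi> r)"
    "exp (\<psi> r) * exp (- \<psi> r) = 1" for r
    by (simp_all flip: exp_add)
  have AB: "(A r)\<^sup>2 + (B r)\<^sup>2 = 1 / 2 * (exp (2 * \<psi> r) + exp (- 2 * \<psi> r))"
    "A r * B r = 1 / 4 * (exp (2 * \<psi> r) - exp (- 2 * \<psi> r))" "(B r)\<^sup>2 - (A r)\<^sup>2 = \<delta>" for r
    unfolding A_def B_def e2\<psi>(1,2) using e2\<psi>(3)[of r] \<delta>
    by (auto simp: power2_eq_square algebra_simps)
  have AB': "exp (- 4 * \<phi> r) * ((A r)\<^sup>2 + (B r)\<^sup>2) = H r" "exp (- 4 * \<phi> r) * (A r * B r) = - \<kappa> r / 2"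
    if r: "r \<in> D" for r
  proof -
    have half: "t * (1 / 2 * (v + w)) = 1 / 2 * (t * v + t * w)" "t * (1 / 4 * (v - w)) = 1 / 4 * (t * v - t * w)"
      for t v w :: real by (simp_all add: algebra_simps diff_divide_distrib)
    show "exp (- 4 * \<phi> r) * ((A r)\<^sup>2 + (B r)\<^sup>2) = H r" "exp (- 4 * \<phi> r) * (A r * B r) = - \<kappa> r / 2"
      unfolding AB half key[OF r] by (simp_all add: field_simps)
  qed
  have f4: "exp (- \<phi> r) * exp (- \<phi> r) = exp (2 * \<phi> r) * exp (- 4 * \<phi> r)"
    "exp (- \<phi> r) / f r = exp (- 2 * \<phi> r)" "exp (- 2 * \<phi> r) * exp (- 2 * \<phi> r) = exp (- 4 * \<phi> r)" for r
    by (simp_all add: f_def flip: exp_add exp_diff)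
  \<comment> \<open>The fourth root in the natural equations is the reciprocal of the conformal
    factor f^2.\<close>
  have root4: "1 / root 4 ((K r)\<^sup>2 - (\<kappa> r)\<^sup>2) = exp (2 * \<phi> r)" if r: "r \<in> D" for r
  proof -
    have "root 4 ((K r)\<^sup>2 - (\<kappa> r)\<^sup>2) = exp (1 / 4 * S r)"
      using pos[OF r] by (simp add: root_powr_inverse powr_def S_def)
    moreover have "2 * \<phi> r = - (1 / 4 * S r)" by (simp add: \<phi>_def)
    ultimately show ?thesis by (simp only: exp_minus inverse_eq_divide)
  qed
  have r4nz: "root 4 ((K r)\<^sup>2 - (\<kappa> r)\<^sup>2) \<noteq> 0" if "r \<in> D" for r
    using pos[OF that] by simp
  \<comment> \<open>The coefficient -1/8 of \<phi> cancels the 8 of the first natural equation: the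
    left side is the hyperbolic Laplacian of \<phi>, that is -K f^2, and this is e f^2 H.\<close>
  have gauss_eq: "partial_u p r - partial_v q r = e * ((\<alpha> r)\<^sup>2 + (\<beta> r)\<^sup>2)" if r: "r \<in> D" for r
  proof -
    have "root 4 ((K r)\<^sup>2 - (\<kappa> r)\<^sup>2) * hyp_laplacian S r = 8 * K r"
      using N r unfolding natural_equations_def S_def[abs_def] by blast
    then have "hyp_laplacian S r = 8 * K r * (1 / root 4 ((K r)\<^sup>2 - (\<kappa> r)\<^sup>2))"
      using r4nz[OF r] by (simp add: field_simps)
    then have "hyp_laplacian S r = 8 * K r * exp (2 * \<phi> r)" unfolding root4[OF r] .
    moreover have "hyp_laplacian \<phi> r = - 1 / 8 * hyp_laplacian S r"
      unfolding \<phi>_def[abs_def] by (rule hyp_laplacian_cmult[OF D(1) Ssm r])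
    ultimately have "hyp_laplacian \<phi> r = - K r * exp (2 * \<phi> r)" by simp
    moreover have "(\<alpha> r)\<^sup>2 + (\<beta> r)\<^sup>2 = exp (- \<phi> r) * exp (- \<phi> r) * ((A r)\<^sup>2 + (B r)\<^sup>2)"
      by (simp add: \<alpha>_def \<beta>_def power2_eq_square algebra_simps)
    then have "(\<alpha> r)\<^sup>2 + (\<beta> r)\<^sup>2 = exp (2 * \<phi> r) * H r"
      unfolding f4(1) using AB'(1)[OF r] by (simp only: mult.assoc)
    moreover have "e * (exp (2 * \<phi> r) * H r) = - K r * exp (2 * \<phi> r)" using e by (auto simp: H_def)
    ultimately show ?thesis unfolding hyp_laplacian_def p_def q_def by simp
  qed
  \<comment> \<open>The left side is minus the hyperbolic Laplacian of \<psi>; the coefficient 1/4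
    cancels the 4 of the second natural equation and leaves -e \<kappa> f^2.\<close>
  have ricci_eq: "partial_v b r - partial_u c r = 2 * e * \<alpha> r * \<beta> r" if r: "r \<in> D" for r
  proof -
    have "root 4 ((K r)\<^sup>2 - (\<kappa> r)\<^sup>2) * hyp_laplacian L r = 4 * e * \<kappa> r"
      using N r unfolding natural_equations_def L_def[abs_def] by blast
    then have "hyp_laplacian L r = 4 * e * \<kappa> r * (1 / root 4 ((K r)\<^sup>2 - (\<kappa> r)\<^sup>2))"
      using r4nz[OF r] by (simp add: field_simps)
    then have "hyp_laplacian L r = 4 * e * \<kappa> r * exp (2 * \<phi> r)" unfolding root4[OF r] .
    moreover have "hyp_laplacian \<psi> r = 1 / 4 * hyp_laplacian L r"
      unfolding \<psi>_def[abs_def] by (rule hyp_laplacian_cmult[OF D(1) Lsm r])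
    ultimately have "hyp_laplacian \<psi> r = e * \<kappa> r * exp (2 * \<phi> r)" by simp
    moreover have "\<alpha> r * \<beta> r = exp (- \<phi> r) * exp (- \<phi> r) * (A r * B r)"
      by (simp add: \<alpha>_def \<beta>_def)
    then have "\<alpha> r * \<beta> r = exp (2 * \<phi> r) * (- \<kappa> r / 2)"
      unfolding f4(1) using AB'(2)[OF r] by (simp only: mult.assoc)
    then have "2 * e * \<alpha> r * \<beta> r = - (e * \<kappa> r * exp (2 * \<phi> r))" by (simp add: mult.assoc)
    ultimately show ?thesis unfolding hyp_laplacian_def b_def c_def by linarith
  qed
  obtain z x y n m where F: "moving_frame D e f p q \<alpha> \<beta> b c z x y n m"
    and o: "\<And>r. r \<in> D \<Longrightarrow> orthonormal_basis4 e (x r) (y r) (n r) (m r)"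
    and zsm: "smooth_on D z" "smooth_on D x" "smooth_on D y" "smooth_on D n" "smooth_on D m"
    using moving_frame_exists[OF D e coefsm has_partials_imp(1)[OF df] has_partials_imp(2)[OF df]
        gauss_eq d\<alpha>(2,1) d\<beta>(2,1) ricci_eq] by blast
  have fpos: "f r > 0" for r by (simp add: f_def)
  define \<mu> where "\<mu> r = \<beta> r / f r" for r
  define \<nu> where "\<nu> r = \<alpha> r / f r" for r
  have \<mu>\<nu>: "\<mu> r = B r * exp (- 2 * \<phi> r)" "\<nu> r = A r * exp (- 2 * \<phi> r)" for r
    using f4(2)[of r] by (simp_all add: \<mu>_def \<nu>_def \<alpha>_def \<beta>_def flip: times_divide_eq_right)
  have \<mu>\<nu>2: "(\<mu> r)\<^sup>2 + (\<nu> r)\<^sup>2 = exp (- 4 * \<phi> r) * ((A r)\<^sup>2 + (B r)\<^sup>2)"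
    "\<mu> r * \<nu> r = exp (- 4 * \<phi> r) * (A r * B r)"
    "(\<mu> r)\<^sup>2 - (\<nu> r)\<^sup>2 = exp (- 4 * \<phi> r) * ((B r)\<^sup>2 - (A r)\<^sup>2)" for r
    unfolding \<mu>\<nu> f4(3)[symmetric] by (simp_all add: power2_eq_square algebra_simps)
  have gauss: "gauss_curvature z x y r = K r" if r: "r \<in> D" for r
  proof -
    have "gauss_curvature z x y r = - e * ((\<alpha> r)\<^sup>2 + (\<beta> r)\<^sup>2) / (f r)\<^sup>2"
      by (rule gauss_curvature_moving_frame[OF D(1) F o fpos df r])
    also have "\<dots> = - e * ((\<mu> r)\<^sup>2 + (\<nu> r)\<^sup>2)"
      by (simp add: \<mu>_def \<nu>_def power_divide add_divide_distrib diff_divide_distrib algebra_simps)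
    also have "\<dots> = - e * H r" unfolding \<mu>\<nu>2 AB'(1)[OF r] ..
    also have "\<dots> = K r" using e by (auto simp: H_def)
    finally show ?thesis .
  qed
  have normal: "normal_curvature z x y n m r = \<kappa> r" if r: "r \<in> D" for r
  proof -
    have "normal_curvature z x y n m r = - 2 * \<alpha> r * \<beta> r / (f r)\<^sup>2"
      by (rule normal_curvature_moving_frame[OF D(1) F o fpos df coefsm(6,7) ricci_eq r])
    also have "\<dots> = - 2 * (\<mu> r * \<nu> r)"
      by (simp add: \<mu>_def \<nu>_def power2_eq_square)
    also have "\<dots> = \<kappa> r" unfolding \<mu>\<nu>2 AB'(2)[OF r] by simp
    finally show ?thesis .
  qed
  have munz: "\<mu> r * \<nu> r \<noteq> 0" if r: "r \<in> D" for r
    unfolding \<mu>\<nu>2 AB'(2)[OF r] using \<kappa>0[OF r] by simp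
  then have abnz: "\<alpha> r \<noteq> 0" "\<beta> r \<noteq> 0" if "r \<in> D" for r
    using that by (auto simp: \<mu>_def \<nu>_def)
  have curv: "(gauss_curvature z x y r)\<^sup>2 - (normal_curvature z x y n m r)\<^sup>2 > 0" if r: "r \<in> D" for r
    unfolding gauss[OF r] normal[OF r] by (rule pos[OF r])
  have gt: "orthonormal_frame_field D z e x y n m" "minimal_lorentz_general_type D z"
    by (rule moving_frame_general_type[OF D(1) F o fpos df zsm e abnz curv]; assumption)+
  have sff: "second_fund_form z r (x r) (x r) = \<nu> r *\<^sub>R n r" "second_fund_form z r (x r) (y r) = \<mu> r *\<^sub>R m r"
    "second_fund_form z r (y r) (y r) = \<nu> r *\<^sub>R n r" if r: "r \<in> D" for r
    unfolding \<mu>_def \<nu>_def by (rule second_fund_form_moving_frame[OF D(1) F o fpos df r]; assumption)+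
  have gf: "geometric_frame_field D z e x y n m \<mu> \<nu>"
    unfolding geometric_frame_field_def using gt(1) munz sff by blast
  have mn: "(\<mu> r)\<^sup>2 - (\<nu> r)\<^sup>2 = exp (- 4 * \<phi> r) * \<delta>" for r
    unfolding \<mu>\<nu>2 AB(3) ..
  \<comment> \<open>Because B^2 - A^2 = \<delta> has absolute value 1, |\<mu>^2 - \<nu>^2| is
    exactly exp(-4 \<phi>): this is what makes the isothermal parameters canonical.\<close>
  have f2: "1 / sqrt \<bar>(\<mu> r)\<^sup>2 - (\<nu> r)\<^sup>2\<bar> = (f r)\<^sup>2" for r
  proof -
    have "\<bar>(\<mu> r)\<^sup>2 - (\<nu> r)\<^sup>2\<bar> = exp (- 4 * \<phi> r)" unfolding mn using \<delta> by auto
    also have "\<dots> = (exp (- 2 * \<phi> r))\<^sup>2" by (simp only: power2_eq_square f4(3))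
    finally have "sqrt \<bar>(\<mu> r)\<^sup>2 - (\<nu> r)\<^sup>2\<bar> = exp (- 2 * \<phi> r)" by simp
    then show ?thesis by (simp add: f_def exp_minus exp_double inverse_eq_divide)
  qed
  have cp: "canonical_parameters D z x y \<mu> \<nu>"
    unfolding canonical_parameters_def
  proof
    fix r assume r: "r \<in> D"
    note zz = has_partials_imp[OF moving_frame_partials(1)[OF F r]]
    note ips = orthonormal_basis4_ip[OF o[OF r]]
    have "coeff_E z r = (f r)\<^sup>2" "coeff_F z r = 0" "coeff_G z r = - (f r)\<^sup>2"
      by (simp_all add: coeff_E_def coeff_F_def coeff_G_def zz ip_simps ips power2_eq_square)
    moreover have "- 1 / sqrt \<bar>(\<mu> r)\<^sup>2 - (\<nu> r)\<^sup>2\<bar> = - (f r)\<^sup>2"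
      using f2[of r] by (simp only: minus_divide_left[symmetric])
    ultimately show "partial_u z r = sqrt (coeff_E z r) *\<^sub>R x r \<and> partial_v z r = sqrt (- coeff_G z r) *\<^sub>R y r \<and>
        coeff_E z r = 1 / sqrt \<bar>(\<mu> r)\<^sup>2 - (\<nu> r)\<^sup>2\<bar> \<and> coeff_F z r = 0 \<and>
        coeff_G z r = - 1 / sqrt \<bar>(\<mu> r)\<^sup>2 - (\<nu> r)\<^sup>2\<bar>"
      unfolding f2 zz using fpos[of r] by simp
  qed
  have "realizes D K \<kappa> e z \<mu> \<nu>"
    unfolding realizes_def using gt(2) gf cp gauss normal by blast
  moreover have "\<forall>r\<in>D. sgn ((\<mu> r)\<^sup>2 - (\<nu> r)\<^sup>2) = \<delta>"
    unfolding mn using \<delta> by (auto simp: sgn_mult)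
  ultimately show ?thesis by blast
qed

text \<open>The sign e of the geometric normal is determined by K. Existence is stated on simply
  connected subdomains, where integrating the frame equations meets no monodromy; the other two
  assertions cover every subdomain. The sign \<delta> labels the two choices of order between
  |\<mu>| and |\<nu>| left open by K and \<kappa>.\<close>

theorem theorem4p3:
  fixes D :: "(real \<times> real) set"
    and K \<kappa> :: "real \<times> real \<Rightarrow> real"
    and \<epsilon> :: real
  assumes "planar_domain D"
    and "smooth_on D K" and "smooth_on D \<kappa>"
    and "\<forall>p\<in>D. K p \<noteq> 0" and "\<forall>p\<in>D. \<kappa> p \<noteq> 0"
    and "\<forall>p\<in>D. (K p)\<^sup>2 - (\<kappa> p)\<^sup>2 > 0"
    and "\<epsilon> \<in> {1, - 1}"
    and "natural_equations D \<epsilon> K \<kappa>"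
  shows "\<exists>e\<in>{1, - 1}. natural_equations D e K \<kappa> \<and> (\<forall>p\<in>D. e * K p < 0) \<and>
    (\<forall>D'. planar_domain D' \<and> D' \<subseteq> D \<longrightarrow>
      \<comment> \<open>existence\<close>
      (simply_connected D' \<longrightarrow>
        (\<forall>\<delta>\<in>{1, - 1}. \<exists>z \<mu> \<nu>. realizes D' K \<kappa> e z \<mu> \<nu> \<and>
           (\<forall>p\<in>D'. sgn ((\<mu> p)\<^sup>2 - (\<nu> p)\<^sup>2) = \<delta>))) \<and>
      \<comment> \<open>the causal character of the geometric normal field, and the sign dichotomy\<close>
      (\<forall>e' z \<mu> \<nu>. realizes D' K \<kappa> e' z \<mu> \<nu> \<longrightarrow>
         e' = e \<and> (\<exists>\<delta>\<in>{1, - 1}. \<forall>p\<in>D'. sgn ((\<mu> p)\<^sup>2 - (\<nu> p)\<^sup>2) = \<delta>)) \<and>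
      \<comment> \<open>uniqueness\<close>
      (\<forall>z\<^sub>1 \<mu>\<^sub>1 \<nu>\<^sub>1 z\<^sub>2 \<mu>\<^sub>2 \<nu>\<^sub>2.
         realizes D' K \<kappa> e z\<^sub>1 \<mu>\<^sub>1 \<nu>\<^sub>1 \<and> realizes D' K \<kappa> e z\<^sub>2 \<mu>\<^sub>2 \<nu>\<^sub>2 \<and>
         (\<forall>p\<in>D'. sgn ((\<mu>\<^sub>1 p)\<^sup>2 - (\<nu>\<^sub>1 p)\<^sup>2) = sgn ((\<mu>\<^sub>2 p)\<^sup>2 - (\<nu>\<^sub>2 p)\<^sup>2)) \<longrightarrow>
         (\<exists>f. rigid_motion f \<and> (\<forall>p\<in>D'. z\<^sub>2 p = f (z\<^sub>1 p)))))"
proof -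
  have D: "open D" "connected D" using assms(1) by (auto simp: planar_domain_def)
  have pos: "(K p)\<^sup>2 - (\<kappa> p)\<^sup>2 > 0" if "p \<in> D" for p using assms(6) that by blast
  obtain s where s: "s \<in> {1, - 1}" "\<forall>p\<in>D. sgn (K p) = s"
    using continuous_nonzero_sgn_constant[OF D(2) smooth_on_imp_continuous_on[OF assms(2)]] assms(4) by blast
  \<comment> \<open>K = -e (\<mu>^2 + \<nu>^2) in a geometric frame, so e must be opposite to the
    constant sign of K.\<close>
  define e where "e = - s"
  have e: "e \<in> {1, - 1}" using s(1) by (auto simp: e_def)
  have eK: "e * K p < 0" if "p \<in> D" for p
  proof -
    have "K p * s = \<bar>K p\<bar>" using s(2) that by (simp add: abs_sgn)
    moreover have "\<bar>K p\<bar> > 0" using assms(4) that by simp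
    ultimately show ?thesis by (simp add: e_def mult.commute)
  qed
  \<comment> \<open>The given \<epsilon> may be the opposite of e; the natural equations then pass
    from one sign to the other.\<close>
  have N: "natural_equations D e K \<kappa>"
  proof (cases "e = \<epsilon>")
    case False
    then have "e = - \<epsilon>" using e assms(7) by auto
    then show ?thesis using natural_equations_uminus[OF D(1) pos assms(2,3,7,8)] by simp
  qed (use assms(8) in simp)
  have sub: "open D'" "connected D'" "D' \<noteq> {}" "\<And>p. p \<in> D' \<Longrightarrow> p \<in> D"
    if "planar_domain D' \<and> D' \<subseteq> D" for D'
    using that by (auto simp: planar_domain_def)
  have ex: "\<exists>z \<mu> \<nu>. realizes D' K \<kappa> e z \<mu> \<nu> \<and> (\<forall>p\<in>D'. sgn ((\<mu> p)\<^sup>2 - (\<nu> p)\<^sup>2) = \<delta>)"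
    if D': "planar_domain D' \<and> D' \<subseteq> D" and sc: "simply_connected D'" and \<delta>: "\<delta> \<in> {1, - 1}" for D' \<delta>
  proof (rule realizes_exists[OF sub(1,2)[OF D'] sc sub(3)[OF D'] _ _ _ pos e eK _ \<delta>])
    show "smooth_on D' K" "smooth_on D' \<kappa>" using assms(2,3) D' smooth_on_subset by blast+
    show "natural_equations D' e K \<kappa>" using N sub(4)[OF D'] by (simp add: natural_equations_def)
  qed (use assms(5) sub(4)[OF D'] in blast)+
  have sgn: "e' = e \<and> (\<exists>\<delta>\<in>{1, - 1}. \<forall>p\<in>D'. sgn ((\<mu> p)\<^sup>2 - (\<nu> p)\<^sup>2) = \<delta>)"
    if D': "planar_domain D' \<and> D' \<subseteq> D" and R: "realizes D' K \<kappa> e' z \<mu> \<nu>" for D' e' z \<mu> \<nu>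
  proof
    show "e' = e" "\<exists>\<delta>\<in>{1, - 1}. \<forall>p\<in>D'. sgn ((\<mu> p)\<^sup>2 - (\<nu> p)\<^sup>2) = \<delta>"
      by (rule realizes_sign_unique[OF sub(1-3)[OF D'] eK pos e R]; rule sub(4)[OF D']; assumption)+
  qed
  have unique: "\<exists>f. rigid_motion f \<and> (\<forall>p\<in>D'. z\<^sub>2 p = f (z\<^sub>1 p))"
    if D': "planar_domain D' \<and> D' \<subseteq> D"
      and R: "realizes D' K \<kappa> e z\<^sub>1 \<mu>\<^sub>1 \<nu>\<^sub>1 \<and> realizes D' K \<kappa> e z\<^sub>2 \<mu>\<^sub>2 \<nu>\<^sub>2 \<and>
        (\<forall>p\<in>D'. sgn ((\<mu>\<^sub>1 p)\<^sup>2 - (\<nu>\<^sub>1 p)\<^sup>2) = sgn ((\<mu>\<^sub>2 p)\<^sup>2 - (\<nu>\<^sub>2 p)\<^sup>2))"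
    for D' z\<^sub>1 \<mu>\<^sub>1 \<nu>\<^sub>1 z\<^sub>2 \<mu>\<^sub>2 \<nu>\<^sub>2
  proof (rule realizes_unique[OF sub(1-3)[OF D'] pos conjunct1[OF R] conjunct1[OF conjunct2[OF R]]])
    show "sgn ((\<mu>\<^sub>1 p)\<^sup>2 - (\<nu>\<^sub>1 p)\<^sup>2) = sgn ((\<mu>\<^sub>2 p)\<^sup>2 - (\<nu>\<^sub>2 p)\<^sup>2)" if "p \<in> D'" for p
      using R that by blast
  qed (rule sub(4)[OF D'])
  show ?thesis
    by (rule bexI[OF _ e], intro conjI allI impI ballI)
       (rule N, erule eK, rule ex, assumption+, rule conjunct1[OF sgn], assumption+,
        rule conjunct2[OF sgn], assumption+, rule unique, assumption+)
qed

end
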